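(* Let $k\in\mathbb N$ and let $s\ge2$ be real. Let $\Delta^*_s$ be an admissible exponent for minor arcs (as defined in the context). Then for every $\varepsilon>0$ there exists $\eta>0$ such that, for all sufficiently large $P$, all $R$ with $2\le R\le P^\eta$, and all real $Q$ with $1\le Q\le \tfrac12 P^{k/2}R^{-k}$, one has \[ \int_{\mathfrak N(Q,P)}|f(\alpha;P,R)|^s\,d\alpha\ll P^{s-k+\varepsilon}Q^{2\Delta^*_s/k}, \] with implied constant depending only on $\varepsilon,\eta,k,s$.
   Context: For real $P,R\ge1$, $\mathscr A(P,R)$ is the set of integers $n\in[1,P]$ all of whose prime divisors are at most $R$; $e(z)=e^{2\pi iz}$; $f(\alpha;P,R)=\sum_{x\in\mathscr A(P,R)}e(\alpha x^k)$; $U_u(P,R)=\int_0^1|f(\alpha;P,R)|^u\,d\alpha$. A real $\Delta_u$ is an admissible exponent (for $k$) if for every $\varepsilon>0$ there is $\eta>0$ (depending on $\varepsilon,k,u$) such that for $P$ sufficiently large and $1\le R\le P^\eta$ one has $U_u(P,R)\le CP^{u-k+\Delta_u+\varepsilon}$ with $C=C(\varepsilon,\eta,k,u)$. Suppose admissible exponents $\Delta_u$ have been fixed for each $u>0$ under consideration, and set $\tau(k)=\max_{w\in\mathbb N}(k-2\Delta_{2w})/(4w^2)$ (assumed to be attained). Suppose admissible exponents $\Delta_u$ are given for $2\le u\le s$; then $\Delta_s^*=\min_{0\le t\le s-2}(\Delta_{s-t}-t\tau(k))$ is called an admissible exponent for minor arcs. For $1\le Q\le P^{k/2}$, $\mathfrak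 M(Q,P)$ is the union over integers $1\le q\le Q$, $0\le a\le q$, $(a,q)=1$, of $\{\alpha\in[0,1):|q\alpha-a|\le QP^{-k}\}$, and $\mathfrak N(Q,P)=\mathfrak M(Q,P)\setminus\mathfrak M(Q/2,P)$. *)

theory Defs
  imports "HOL-Analysis.Analysis" "HOL-Computational_Algebra.Primes"
begin

definition smooth_set :: "real \<Rightarrow> real \<Rightarrow> nat set" where
  "smooth_set P R = {n. 1 \<le> n \<and> real n \<le> P \<and> (\<forall>p. prime p \<and> p dvd n \<longrightarrow> real p \<le> R)}"

definition ee :: "real \<Rightarrow> complex" where
  "ee z = exp (2 * of_real pi * \<i> * of_real z)"

definition weyl_f :: "nat \<Rightarrow> real \<Rightarrow> real \<Rightarrow> real \<Rightarrow> complex" where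
  "weyl_f k P R \<alpha> = (\<Sum>x\<in>smooth_set P R. ee (\<alpha> * real x ^ k))"

definition U_mean :: "nat \<Rightarrow> real \<Rightarrow> real \<Rightarrow> real \<Rightarrow> real" where
  "U_mean k u P R = integral {0..1} (\<lambda>\<alpha>. cmod (weyl_f k P R \<alpha>) powr u)"

definition admissible_exponent :: "nat \<Rightarrow> real \<Rightarrow> real \<Rightarrow> bool" where
  "admissible_exponent k u \<Delta> \<longleftrightarrow>
     (\<forall>\<epsilon>>0. \<exists>\<eta>>0. \<exists>C. \<exists>P0. \<forall>P\<ge>P0. \<forall>R. 1 \<le> R \<and> R \<le> P powr \<eta> \<longrightarrow>
        U_mean k u P R \<le> C * P powr (u - real k + \<Delta> + \<epsilon>))"

definition is_tau :: "nat \<Rightarrow> (real \<Rightarrow> real) \<Rightarrow> real \<Rightarrow> bool" where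
  "is_tau k \<Delta> \<tau> \<longleftrightarrow>
     (let S = {(real k - 2 * \<Delta> (2 * real w)) / (4 * real w ^ 2) | w::nat. 1 \<le> w}
      in \<tau> \<in> S \<and> (\<forall>x\<in>S. x \<le> \<tau>))"

definition minor_arc_exponent :: "nat \<Rightarrow> (real \<Rightarrow> real) \<Rightarrow> real \<Rightarrow> real \<Rightarrow> bool" where
  "minor_arc_exponent k \<Delta> s \<Delta>s \<longleftrightarrow>
     (\<exists>\<tau>. is_tau k \<Delta> \<tau> \<and>
        (let S = {\<Delta> (s - t) - t * \<tau> | t::real. 0 \<le> t \<and> t \<le> s - 2}
         in \<Delta>s \<in> S \<and> (\<forall>x\<in>S. \<Delta>s \<le> x)))"

definition major_arcs :: "nat \<Rightarrow> real \<Rightarrow> real \<Rightarrow> real set" where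
  "major_arcs k Q P = {\<alpha>. 0 \<le> \<alpha> \<and> \<alpha> < 1 \<and>
     (\<exists>q a::nat. 1 \<le> q \<and> real q \<le> Q \<and> a \<le> q \<and> coprime a q \<and>
        \<bar>real q * \<alpha> - real a\<bar> \<le> Q * P powr (- real k))}"

definition major_arcs_N :: "nat \<Rightarrow> real \<Rightarrow> real \<Rightarrow> real set" where
  "major_arcs_N k Q P = major_arcs k Q P - major_arcs k (Q / 2) P"

end

(*
  At length Y = (2 Q)^(2/k) the arcs of level Q are essentially the whole of [0,1), so it
  suffices to pass from length P to length about Y.  Given an arc with denominator q, write a
  smooth number as l y, where l consists of the largest primes not dividing q and has size about
  P / Y; at most P^eps P / Y smooth numbers have no such factorization.  Since l is coprime to q,
  multiplication by l^k carries arcs of level Q and length P to arcs of level Q and length P / l,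
  and does so injectively.  Hence:

  - for u >= 2 the u-th moment of f over the major arcs is at most P^(u-k+eps) Y^(Delta_u), by
    Hoelder's inequality and the admissible mean value at length P / l;
  - on the arcs of level Q outside those of level Q/2 we have |f| <= P^(1+eps) Y^(-tau), because a
    bilinear (large sieve) argument at length P / l applies to l^k alpha.

  Here eps absorbs powers of R.  Writing |f|^s = |f|^t |f|^(s-t) combines the two bounds.
  The error terms are harmless because Delta_u >= k - u/2, which follows by comparing the moments
  with the number of products of v integers not exceeding n, as n tends to infinity.
*)
theory Submission
  imports Defs
begin

section \<open>Additive characters\<close>

text \<open>At length P the denominator q of an arc may be far smaller than P^(k/2), while a large
  sieve is efficient only for denominators near the square root of the k-th power of the length. At
  length X = P / l, between Y and R Y, the number l^k \<alpha> keeps the denominator q with error at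
  most Q / X^k, but q and the error do not both fit level Q / 2. Either q is already close to
  X^(k/2), or Dirichlet's theorem supplies a second denominator that is, up to powers of R. The
  obstacle is that l must avoid the primes of q, while q varies with \<alpha>. Hence the cofactor of
  l is not an ordinary smooth number: it may contain large primes of q. These are split off as a
  factor h, which leaves a full smooth Weyl sum of length P / (l h); the weight 1 / h obtained from
  the mean value makes the sum over h cost a logarithm only. The index set of all (p, l, h) is
  independent of q, and q enters through arcs whose denominators are coprime to l. Every bound is
  proved for all R >= 1 with an explicit power of R, so \<eta> is chosen only at the very
  end.\<close>

lemma ee_add: "ee (x + y) = ee x * ee y"
  by (simp add: ee_def exp_add[symmetric] algebra_simps)

lemma ee_0 [simp]: "ee 0 = 1"
  by (simp add: ee_def)

lemma ee_alt: "ee x = exp (\<i> * of_real (2 * pi * x))"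
  by (simp add: ee_def algebra_simps)

lemma cmod_ee [simp]: "cmod (ee x) = 1"
  unfolding ee_alt by (rule norm_exp_i_times)

lemma ee_of_int [simp]: "ee (of_int n) = 1"
proof -
  have "ee (of_int n) = exp ((2 * of_int n * pi) * \<i>)"
    by (simp add: ee_def mult_ac)
  also have "\<dots> = 1" using exp_integer_2pi[of "of_int n"] by (simp add: mult_ac)
  finally show ?thesis .
qed

lemma ee_power: "ee x ^ n = ee (x * real n)"
  by (induction n) (simp_all add: ee_add[symmetric] algebra_simps)

lemma cnj_ee: "cnj (ee x) = ee (- x)"
  unfolding ee_alt by (simp add: exp_cnj)

lemma continuous_on_ee [continuous_intros]:
  "continuous_on S f \<Longrightarrow> continuous_on S (\<lambda>x. ee (f x))"
  unfolding ee_def by (intro continuous_intros)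

lemma ee_add_of_int [simp]: "ee (x + of_int n) = ee x"
  by (simp add: ee_add)

lemma ee_diff_of_int [simp]: "ee (x - of_int n) = ee x"
  using ee_add_of_int[of x "-n"] by simp

text \<open>Weak form of Jordan's inequality, read off from the cubic Taylor estimate: x^2 <= 3 on
  this range makes the error x^3 / 6 at most x / 2.\<close>

lemma sin_ge_half:
  assumes "0 \<le> x" "x \<le> pi / 2" shows "x / 2 \<le> sin (x::real)"
proof -
  have "\<bar>sin x - (\<Sum>m<3. sin_coeff m * x ^ m)\<bar> \<le> inverse (fact 3) * \<bar>x\<bar> ^ 3"
    by (rule Maclaurin_sin_bound)
  then have "\<bar>sin x - x\<bar> \<le> x ^ 3 / 6"
    using assms by (simp add: eval_nat_numeral sin_coeff_def fact_numeral)
  moreover have "x\<^sup>2 \<le> 3"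
  proof -
    have "x \<le> 1.7" using assms pi_less_4 pi_approx by simp
    then have "x^2 \<le> 1.7^2" by (intro power_mono assms)
    then show ?thesis by (simp add: power2_eq_square)
  qed
  then have "x ^ 3 \<le> 3 * x"
    using mult_right_mono[of "x^2" 3 x] assms by (simp add: power2_eq_square power3_eq_cube)
  ultimately show ?thesis by linarith
qed

text \<open>|1 - e(x)| is a chord of length 2 sin(pi |y|), with |y| <= 1/2 the distance from x to
  the nearest integer. The factor 2, half the sharp one, cancels the trivial bound 2 for the
  numerator of a geometric sum.\<close>

lemma cmod_one_minus_ee_ge: "2 * \<bar>x - of_int (round x)\<bar> \<le> cmod (1 - ee x)"
proof -
  define y where "y = x - of_int (round x)"
  have y: "\<bar>y\<bar> \<le> 1/2"
    using of_int_round_abs_le[of x] unfolding y_def by (simp add: abs_minus_commute)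
  have "ee x = ee y" unfolding y_def by simp
  then have "cmod (1 - ee x) = 2 * \<bar>sin (pi * y)\<bar>"
    using dist_exp_i_1[of "2*pi*y"] by (simp add: ee_alt norm_minus_commute)
  moreover have "\<bar>sin (pi * y)\<bar> = sin (pi * \<bar>y\<bar>)"
  proof -
    have "sin (pi * \<bar>y\<bar>) \<ge> 0" using y by (intro sin_ge_zero) auto
    then show ?thesis by (cases "y \<ge> 0") (auto simp: abs_if split: if_splits)
  qed
  moreover have "pi * \<bar>y\<bar> / 2 \<le> sin (pi * \<bar>y\<bar>)"
    using y by (intro sin_ge_half) (auto simp: field_simps)
  moreover have "2 * \<bar>y\<bar> \<le> pi * \<bar>y\<bar>" using pi_ge_two by (intro mult_right_mono) auto
  ultimately show ?thesis unfolding y_def by linarith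
qed

text \<open>Summation of the geometric series. The product form needs no division and stays true at
  integers x, where the distance vanishes.\<close>

lemma cmod_sum_ee_le:
  "cmod (\<Sum>i<n. ee (x * real i)) * \<bar>x - of_int (round x)\<bar> \<le> 1"
proof -
  have "(1 - ee x) * (\<Sum>i<n. ee (x * real i)) = 1 - ee x ^ n"
    using one_diff_power_eq[of "ee x" n] by (simp add: ee_power)
  then have "cmod (1 - ee x) * cmod (\<Sum>i<n. ee (x * real i)) = cmod (1 - ee x ^ n)"
    by (metis norm_mult)
  also have "\<dots> \<le> 2" 
    using norm_triangle_ineq4[of 1 "ee x ^ n"] by (simp add: norm_power)
  finally have "cmod (1 - ee x) * cmod (\<Sum>i<n. ee (x * real i)) \<le> 2" .
  moreover have "2 * \<bar>x - of_int (round x)\<bar> * cmod (\<Sum>i<n. ee (x * real i)) 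
      \<le> cmod (1 - ee x) * cmod (\<Sum>i<n. ee (x * real i))"
    by (intro mult_right_mono cmod_one_minus_ee_ge) auto
  ultimately show ?thesis by (simp add: mult.commute)
qed

lemma cmod_sum_ee_le_card: "cmod (\<Sum>i\<in>S. ee (f i)) \<le> real (card S)"
  using sum_norm_le[of S "\<lambda>i. ee (f i)" "\<lambda>_. 1"] by simp

section \<open>Harmonic sums and convexity inequalities\<close>

lemma sum_inverse_le_ln: "n \<ge> 1 \<Longrightarrow> (\<Sum>t=1..n. 1 / real t) \<le> 1 + ln (real n)"
proof (induction n rule: nat_induct_at_least)
  case (Suc n)
  have "ln (real n / real (Suc n)) \<le> real n / real (Suc n) - 1"
    using Suc.hyps by (intro ln_le_minus_one) auto
  then have "1 / real (Suc n) \<le> ln (real (Suc n)) - ln (real n)"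
    using Suc.hyps by (simp add: ln_div field_simps)
  with Suc.IH show ?case by simp
qed simp

lemma power_mean_powr:
  fixes x :: "'a \<Rightarrow> real"
  assumes "finite S" "u \<ge> 1" "\<And>i. i \<in> S \<Longrightarrow> x i \<ge> 0"
  shows "(\<Sum>i\<in>S. x i) powr u \<le> real (card S) powr (u - 1) * (\<Sum>i\<in>S. x i powr u)"
proof -
  \<comment> \<open>Jensen's inequality is applied at positive points only. The vanishing terms
    change neither sum, and passing back from \<open>card T\<close> to \<open>card S\<close>
    enlarges the bound because u >= 1.\<close>
  define T where "T = {i\<in>S. x i > 0}"
  have T: "finite T" "T \<subseteq> S" using assms unfolding T_def by auto
  have z: "x i = 0" if "i \<in> S - T" for i using that assms(3)[of i] unfolding T_def by auto
  have s1: "(\<Sum>i\<in>S. x i) = (\<Sum>i\<in>T. x i)" 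
    by (rule sum.mono_neutral_right) (use assms T z in auto)
  have s2: "(\<Sum>i\<in>S. x i powr u) = (\<Sum>i\<in>T. x i powr u)"
    by (rule sum.mono_neutral_right) (use assms T z in auto)
  show ?thesis
  proof (cases "T = {}")
    case True then show ?thesis unfolding s1 s2 by simp
  next
    case False
    define c where "c = real (card T)"
    have c: "c > 0" unfolding c_def using False T by (simp add: card_gt_0_iff)
    have "(\<lambda>x. x powr u) (\<Sum>i\<in>T. (1 / c) *\<^sub>R x i) \<le> (\<Sum>i\<in>T. (1/c) * (x i powr u))"
    proof (rule convex_on_sum[OF T(1) False powr_convex[OF assms(2)]])
      show "(\<Sum>i\<in>T. 1 / c) = 1" using c unfolding c_def by simp
    qed (use c in \<open>auto simp: T_def\<close>)
    then have "((\<Sum>i\<in>T. x i) / c) powr u \<le> (\<Sum>i\<in>T. x i powr u) / c"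
      by (simp add: sum_divide_distrib[symmetric] sum_distrib_left[symmetric])
    moreover have "((\<Sum>i\<in>T. x i) / c) powr u = (\<Sum>i\<in>T. x i) powr u / c powr u"
      by (rule powr_divide)
    ultimately have "(\<Sum>i\<in>T. x i) powr u \<le> (\<Sum>i\<in>T. x i powr u) / c * c powr u"
      using c by (simp add: pos_divide_le_eq)
    also have "\<dots> = c powr (u - 1) * (\<Sum>i\<in>T. x i powr u)"
      using c by (simp add: powr_diff)
    also have "\<dots> \<le> real (card S) powr (u - 1) * (\<Sum>i\<in>T. x i powr u)"
      unfolding c_def using assms T by (intro mult_right_mono powr_mono2 sum_nonneg) (auto intro: card_mono)
    finally show ?thesis unfolding s1 s2 .
  qed
qed

text \<open>Hoelder's inequality with an integer exponent, as Jensen's inequality for the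
  probability weights a i / A. It serves with weights 1 and with representation numbers as
  weights.\<close>

lemma weighted_power_mean:
  fixes a x :: "'a \<Rightarrow> real"
  assumes "finite S" "\<And>i. i \<in> S \<Longrightarrow> a i \<ge> 0" "\<And>i. i \<in> S \<Longrightarrow> x i \<ge> 0"
  shows "(\<Sum>i\<in>S. a i * x i) ^ Suc w \<le> (\<Sum>i\<in>S. a i) ^ w * (\<Sum>i\<in>S. a i * x i ^ Suc w)"
proof (cases "(\<Sum>i\<in>S. a i) = 0")
  case True
  then have "\<And>i. i \<in> S \<Longrightarrow> a i = 0" using assms by (simp add: sum_nonneg_eq_0_iff)
  then show ?thesis by simp
next
  case False
  then have pos: "(\<Sum>i\<in>S. a i) > 0" using assms by (metis less_eq_real_def sum_nonneg)
  define A where "A = (\<Sum>i\<in>S. a i)"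
  have cv: "convex_on {0..} (\<lambda>x::real. x ^ Suc w)"
  proof (cases "even (Suc w)")
    case True then show ?thesis using convex_power_even convex_on_subset by blast
  next
    case False then show ?thesis by (rule convex_power_odd)
  qed
  have "(\<lambda>x. x ^ Suc w) (\<Sum>i\<in>S. (a i / A) *\<^sub>R x i) \<le> (\<Sum>i\<in>S. (a i/A) * (x i ^ Suc w))"
  proof (rule convex_on_sum[OF _ _ cv])
    show "(\<Sum>i\<in>S. a i / A) = 1" using pos unfolding A_def by (simp flip: sum_divide_distrib)
  qed (use assms pos A_def in auto)
  then have "((\<Sum>i\<in>S. a i * x i) / A) ^ Suc w \<le> (\<Sum>i\<in>S. a i * x i ^ Suc w) / A"
    by (simp add: sum_divide_distrib)
  then have "(\<Sum>i\<in>S. a i * x i) ^ Suc w \<le> (\<Sum>i\<in>S. a i * x i ^ Suc w) / A * A ^ Suc w"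
    using pos by (simp only: power_divide A_def pos_divide_le_eq zero_less_power)
  also have "\<dots> = A ^ w * (\<Sum>i\<in>S. a i * x i ^ Suc w)"
    using pos unfolding A_def by simp
  finally show ?thesis unfolding A_def .
qed

section \<open>Large sieve inequalities\<close>

lemma sum_UN_le:
  fixes f :: "'a \<Rightarrow> real"
  assumes "finite I" "\<And>i. i \<in> I \<Longrightarrow> finite (T i)" "\<And>x. f x \<ge> 0"
  shows "(\<Sum>x\<in>(\<Union>i\<in>I. T i). f x) \<le> (\<Sum>i\<in>I. \<Sum>x\<in>T i. f x)"
  using assms(1,2)
proof (induction I rule: finite_induct)
  case (insert i I)
  have "(\<Sum>x\<in>T i \<union> (\<Union>i\<in>I. T i). f x) \<le> (\<Sum>x\<in>T i. f x) + (\<Sum>x\<in>(\<Union>i\<in>I. T i). f x)"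
    using insert assms(3) by (subst sum_Un) (auto intro!: sum_nonneg)
  with insert show ?case by simp
qed simp

text \<open>Within a block of at most half the denominator the points \<open>\<theta> * j\<close> are \<open>1 / (2 * r)\<close>-separated
  modulo one, so the integer parts of \<open>2 * r * \<parallel>\<theta> * j\<parallel>\<close> (with a sign) are distinct.\<close>
lemma sum_geometric_block:
  fixes \<theta> :: real and S :: "int set" and b :: int and r N :: nat
  assumes r: "r \<ge> 1" and ap: "\<bar>real r * \<theta> - of_int b\<bar> \<le> 1 / real r" and cop: "coprime b (int r)"
    and S: "finite S" and diam: "\<And>i j. i \<in> S \<Longrightarrow> j \<in> S \<Longrightarrow> 2 * \<bar>i - j\<bar> \<le> int r"
  shows "(\<Sum>j\<in>S. cmod (\<Sum>n<N. ee (\<theta> * of_int j * real n))) \<le> 2 * (real N + 2 * real r * (1 + ln (real r)))"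
proof -
  define E where "E j = cmod (\<Sum>n<N. ee (\<theta> * of_int j * real n))" for j
  define s where "s j = \<theta> * of_int j - of_int (round (\<theta> * of_int j))" for j :: int
  define t where "t j = nat \<lfloor>2 * real r * \<bar>s j\<bar>\<rfloor>" for j
  \<comment> \<open>Majorant of a geometric sum in terms of t, the integer part of 2 r times the
    distance to the nearest integer: the trivial bound N for t = 0, and 2 r / t otherwise.\<close>
  define h where "h n = (if n = 0 then real N else 2 * real r / real n)" for n :: nat
  have s_half: "\<bar>s j\<bar> \<le> 1/2" for j
    using of_int_round_abs_le[of "\<theta> * of_int j"] unfolding s_def by (simp add: abs_minus_commute)
  have E1: "E j * \<bar>s j\<bar> \<le> 1" for j
    unfolding E_def s_def by (rule cmod_sum_ee_le)
  have E2: "E j \<le> real N" for j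
    unfolding E_def using cmod_sum_ee_le_card[of "\<lambda>n. \<theta> * of_int j * real n" "{..<N}"] by simp
  have tr: "real (t j) \<le> 2 * real r * \<bar>s j\<bar>" "2 * real r * \<bar>s j\<bar> < real (t j) + 1" for j
    unfolding t_def by (auto simp: of_nat_nat)
  have Eh: "E j \<le> h (t j)" for j
  proof (cases "t j = 0")
    case True then show ?thesis using E2[of j] by (simp add: h_def)
  next
    case False
    then have "real (t j) > 0" by simp
    have "real (t j) * E j \<le> 2 * real r * (E j * \<bar>s j\<bar>)"
      using mult_right_mono[OF tr(1)[of j], of "E j"] by (simp add: E_def mult_ac)
    also have "\<dots> \<le> 2 * real r" using mult_left_mono[OF E1[of j], of "2 * real r"] by simp
    finally show ?thesis using False by (simp add: h_def field_simps)
  qed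
  have t_le: "t j \<le> r" for j
  proof -
    have "2 * real r * \<bar>s j\<bar> \<le> real r"
      using mult_left_mono[OF s_half[of j], of "2 * real r"] by simp
    then show ?thesis using tr(1)[of j] by linarith
  qed
  have inj: "inj_on (\<lambda>j. (s j \<ge> 0, t j)) S"
  proof (rule inj_onI)
    fix i j assume ij: "i \<in> S" "j \<in> S" and eq: "(s i \<ge> 0, t i) = (s j \<ge> 0, t j)"
    have "\<bar>2 * real r * \<bar>s i\<bar> - 2 * real r * \<bar>s j\<bar>\<bar> < 1"
      using tr[of i] tr[of j] eq by auto
    moreover have "\<bar>2 * real r * \<bar>s i\<bar> - 2 * real r * \<bar>s j\<bar>\<bar> = 2 * real r * \<bar>s i - s j\<bar>"
    proof -
      have "\<bar>2 * real r * \<bar>s i\<bar> - 2 * real r * \<bar>s j\<bar>\<bar> = 2 * real r * \<bar>\<bar>s i\<bar> - \<bar>s j\<bar>\<bar>"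
        by (simp add: abs_mult flip: right_diff_distrib)
      moreover have "\<bar>\<bar>s i\<bar> - \<bar>s j\<bar>\<bar> = \<bar>s i - s j\<bar>" using eq by auto
      ultimately show ?thesis by simp
    qed
    ultimately have *: "2 * real r * \<bar>s i - s j\<bar> < 1" by simp
    define m where "m = round (\<theta> * of_int i) - round (\<theta> * of_int j)"
    define d where "d = i - j"
    have sd: "s i - s j = \<theta> * of_int d - of_int m"
      unfolding s_def m_def d_def by (simp add: algebra_simps)
    have d: "2 * \<bar>real_of_int d\<bar> \<le> real r" using diam[OF ij] unfolding d_def by linarith
    have "2 * \<bar>real r * (\<theta> * of_int d - of_int m)\<bar> < 1"
      using * unfolding sd by (simp add: abs_mult)
    \<comment> \<open>Splits an integer from the approximation error. The left side is below 1/2 and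
      the error at most 1/2 in absolute value, so the integer d b - r m has absolute value below
      1.\<close>
    moreover have "real r * (\<theta> * of_int d - of_int m) = of_int d * (real r * \<theta> - of_int b) + of_int (d * b - int r * m)"
      by (simp add: algebra_simps)
    moreover have "2 * \<bar>of_int d * (real r * \<theta> - of_int b)\<bar> \<le> 1"
    proof -
      have "2 * \<bar>of_int d * (real r * \<theta> - of_int b)\<bar> \<le> real r * (1 / real r)"
        unfolding abs_mult mult.assoc[symmetric] using d ap by (intro mult_mono) auto
      then show ?thesis using r by simp
    qed
    ultimately have "\<bar>real_of_int (d * b - int r * m)\<bar> < 1" by linarith
    then have "d * b - int r * m = 0" by linarith
    then have "int r dvd d * b" by (metis dvd_triv_left eq_iff_diff_eq_0)
    then have "int r dvd d" using cop by (metis coprime_commute coprime_dvd_mult_left_iff)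
    moreover have "\<bar>d\<bar> < int r" using d r by linarith
    ultimately have "d = 0" using dvd_imp_le_int[of d "int r"] by auto
    then show "i = j" by (simp add: d_def)
  qed
  have "(\<Sum>j\<in>S. E j) \<le> (\<Sum>j\<in>S. h (snd (s j \<ge> 0, t j)))"
    using Eh by (intro sum_mono) simp
  also have "\<dots> = (\<Sum>x\<in>(\<lambda>j. (s j \<ge> 0, t j)) ` S. h (snd x))"
    by (rule sum.reindex[OF inj, symmetric, unfolded o_def])
  also have "\<dots> \<le> (\<Sum>x\<in>(UNIV :: bool set) \<times> {0..r}. h (snd x))"
    using t_le by (intro sum_mono2) (auto simp: h_def)
  also have "\<dots> = (\<Sum>x\<in>(UNIV :: bool set). \<Sum>n\<in>{0..r}. h n)"
    by (subst sum.cartesian_product) (simp add: case_prod_unfold)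
  also have "\<dots> = 2 * (\<Sum>n\<in>{0..r}. h n)" by (simp add: UNIV_bool)
  also have "(\<Sum>n\<in>{0..r}. h n) = real N + (\<Sum>n=1..r. h n)"
    by (simp add: sum.atLeast_Suc_atMost h_def)
  also have "(\<Sum>n=1..r. h n) = 2 * real r * (\<Sum>n=1..r. 1 / real n)"
    unfolding sum_distrib_left by (intro sum.cong) (auto simp: h_def)
  also have "\<dots> \<le> 2 * real r * (1 + ln (real r))"
    using sum_inverse_le_ln[OF r] by (intro mult_left_mono) auto
  finally show ?thesis unfolding E_def by simp
qed

lemma sum_geometric_interval:
  fixes \<theta> :: real and j0 b :: int and r N J :: nat
  assumes r: "r \<ge> 1" and ap: "\<bar>real r * \<theta> - of_int b\<bar> \<le> 1 / real r" and cop: "coprime b (int r)"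
  shows "(\<Sum>j\<in>{j0..j0 + int J}. cmod (\<Sum>n<N. ee (\<theta> * of_int j * real n)))
     \<le> (2 * real J / real r + 1) * (2 * (real N + 2 * real r * (1 + ln (real r))))"
proof -
  define E where "E j = cmod (\<Sum>n<N. ee (\<theta> * of_int j * real n))" for j
  \<comment> \<open>r / 2 rounded up: two points of a block differ by at most B - 1 <= r / 2, as the
    block estimate requires, and still J / B <= 2 J / r.\<close>
  define B where "B = (r + 1) div 2"
  have B: "B \<ge> 1" "2 * B \<le> r + 1" "r \<le> 2 * B" using r unfolding B_def by linarith+
  define T where "T i = {j0 + int i * int B ..< j0 + int (Suc i) * int B}" for i
  have sub: "{j0..j0 + int J} \<subseteq> (\<Union>i\<le>J div B. T i)"
  proof
    fix j assume j: "j \<in> {j0..j0 + int J}"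
    define n where "n = nat (j - j0)"
    have n: "j = j0 + int n" "n \<le> J" using j unfolding n_def by auto
    have "n div B \<le> J div B" using n(2) by (rule div_le_mono)
    moreover have "n div B * B \<le> n" "n < Suc (n div B) * B" 
      using B(1) by (auto simp: dividend_less_div_times)
    then have "int (n div B * B) \<le> int n" "int n < int (Suc (n div B) * B)"
      by (simp_all only: of_nat_le_iff of_nat_less_iff)
    then have "j \<in> T (n div B)" unfolding T_def n(1)
      by (simp only: of_nat_mult atLeastLessThan_iff add_le_cancel_left add_less_cancel_left)
    ultimately show "j \<in> (\<Union>i\<le>J div B. T i)" by blast
  qed
  have "(\<Sum>j\<in>{j0..j0 + int J}. E j) \<le> (\<Sum>j\<in>(\<Union>i\<le>J div B. T i). E j)"
    using sub by (intro sum_mono2) (auto simp: E_def T_def)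
  also have "\<dots> \<le> (\<Sum>i\<le>J div B. \<Sum>j\<in>T i. E j)"
    by (intro sum_UN_le) (auto simp: E_def T_def)
  also have "\<dots> \<le> (\<Sum>i\<le>J div B. 2 * (real N + 2 * real r * (1 + ln (real r))))"
    unfolding E_def
  proof (intro sum_mono sum_geometric_block[OF r ap cop])
    fix i and a c :: int assume "a \<in> T i" "c \<in> T i"
    then have "\<bar>a - c\<bar> \<le> int B - 1" unfolding T_def by (auto simp: algebra_simps)
    then have "2 * \<bar>a - c\<bar> \<le> 2 * (int B - 1)" by (rule mult_left_mono) simp
    moreover have "int (2 * B) \<le> int (r + 1)" using B(2) by (simp only: of_nat_le_iff)
    then have "2 * (int B - 1) \<le> int r" by simp
    ultimately show "2 * \<bar>a - c\<bar> \<le> int r" by (rule order_trans)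
  qed (simp add: T_def)
  also have "\<dots> = (real (J div B) + 1) * (2 * (real N + 2 * real r * (1 + ln (real r))))"
    by (simp add: algebra_simps)
  also have "\<dots> \<le> (2 * real J / real r + 1) * (2 * (real N + 2 * real r * (1 + ln (real r))))"
  proof (intro mult_right_mono add_right_mono)
    have "real (J div B) \<le> real J / real B" using of_nat_div_le_of_nat[of J B] by simp
    also have "\<dots> \<le> real J / (real r / 2)" using B r by (intro divide_left_mono) auto
    finally show "real (J div B) \<le> 2 * real J / real r" by (simp add: mult.commute)
  qed (use r in auto)
  finally show ?thesis unfolding E_def .
qed

section \<open>Orthogonality, Parseval's identity and majorants of coefficients\<close>

lemma integral_ee_of_int:
  "((\<lambda>\<alpha>. ee (of_int d * \<alpha>)) has_integral (if d = 0 then 1 else 0)) {0..1}"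
proof (cases "d = 0")
  case True
  then show ?thesis using has_integral_const_real[of "1::complex" 0 1] by simp
next
  case False
  define c where "c = 2 * of_real pi * \<i> * of_int d"
  have c: "c \<noteq> 0" using False unfolding c_def by simp
  have eq: "ee (of_int d * \<alpha>) = exp (c * of_real \<alpha>)" for \<alpha>
    unfolding ee_def c_def by (simp add: mult_ac)
  have "((\<lambda>\<alpha>. ee (of_int d * \<alpha>)) has_integral (exp (c * of_real 1) / c - exp (c * of_real 0) / c)) {0..1}"
    unfolding eq
  proof (rule fundamental_theorem_of_calculus)
    fix x :: real
    show "((\<lambda>x. exp (c * of_real x) / c) has_vector_derivative exp (c * of_real x)) (at x within {0..1})"
      using c by (auto intro!: has_vector_derivative_real_field derivative_eq_intros)
  qed simp
  moreover have "exp (c * of_real 1) = 1"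
    using ee_of_int[of d] eq[of 1] by simp
  ultimately show ?thesis using False by simp
qed

lemma poly_sum_atMost:
  fixes p :: "'a::comm_semiring_1 poly"
  assumes "degree p \<le> D" shows "poly p x = (\<Sum>n\<le>D. coeff p n * x ^ n)"
  unfolding poly_altdef
  by (rule sum.mono_neutral_left) (use assms in \<open>auto simp: coeff_eq_0\<close>)

lemma parseval_poly:
  fixes p :: "complex poly"
  assumes "degree p \<le> D"
  shows "((\<lambda>\<alpha>. (cmod (poly p (ee \<alpha>)))\<^sup>2) has_integral (\<Sum>n\<le>D. (cmod (coeff p n))\<^sup>2)) {0..1}"
proof -
  have eq: "complex_of_real ((cmod (poly p (ee \<alpha>)))\<^sup>2) =
      (\<Sum>m\<le>D. \<Sum>n\<le>D. coeff p m * cnj (coeff p n) * ee (of_int (int m - int n) * \<alpha>))" for \<alpha>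
  proof -
    have "complex_of_real ((cmod (poly p (ee \<alpha>)))\<^sup>2) = poly p (ee \<alpha>) * cnj (poly p (ee \<alpha>))"
      by (rule complex_norm_square)
    also have "\<dots> = (\<Sum>m\<le>D. \<Sum>n\<le>D. (coeff p m * ee \<alpha> ^ m) * cnj (coeff p n * ee \<alpha> ^ n))"
      unfolding poly_sum_atMost[OF assms] cnj_sum by (rule sum_product)
    also have "\<dots> = (\<Sum>m\<le>D. \<Sum>n\<le>D. coeff p m * cnj (coeff p n) * ee (of_int (int m - int n) * \<alpha>))"
    proof (intro sum.cong refl)
      fix m n
      have "ee \<alpha> ^ m * cnj (ee \<alpha> ^ n) = ee (of_int (int m - int n) * \<alpha>)"
        by (simp add: ee_power cnj_ee ee_add[symmetric] algebra_simps)
      then show "(coeff p m * ee \<alpha> ^ m) * cnj (coeff p n * ee \<alpha> ^ n) 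
          = coeff p m * cnj (coeff p n) * ee (of_int (int m - int n) * \<alpha>)"
        by (simp add: mult_ac)
    qed
    finally show ?thesis .
  qed
  have "((\<lambda>\<alpha>. complex_of_real ((cmod (poly p (ee \<alpha>)))\<^sup>2)) has_integral
      (\<Sum>m\<le>D. \<Sum>n\<le>D. coeff p m * cnj (coeff p n) * (if int m - int n = 0 then 1 else 0))) {0..1}"
    unfolding eq by (intro has_integral_sum has_integral_mult_right integral_ee_of_int) auto
  also have "(\<Sum>m\<le>D. \<Sum>n\<le>D. coeff p m * cnj (coeff p n) * (if int m - int n = 0 then 1 else 0))
      = (\<Sum>m\<le>D. \<Sum>n\<le>D. if m = n then coeff p m * cnj (coeff p m) else 0)"
    by (intro sum.cong) auto
  also have "\<dots> = complex_of_real (\<Sum>n\<le>D. (cmod (coeff p n))\<^sup>2)"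
    by (simp add: complex_norm_square[symmetric] flip: of_real_power)
  finally have "((\<lambda>\<alpha>. Re (complex_of_real ((cmod (poly p (ee \<alpha>)))\<^sup>2))) has_integral
      Re (complex_of_real (\<Sum>n\<le>D. (cmod (coeff p n))\<^sup>2))) {0..1}"
    by (rule has_integral_Re)
  then show ?thesis by simp
qed

definition coeff_dom :: "complex poly \<Rightarrow> real poly \<Rightarrow> bool" where
  "coeff_dom p P \<longleftrightarrow> (\<forall>n. cmod (coeff p n) \<le> coeff P n)"

lemma coeff_dom_mult: "coeff_dom p P \<Longrightarrow> coeff_dom q Q \<Longrightarrow> coeff_dom (p * q) (P * Q)"
  unfolding coeff_dom_def coeff_mult
  by (auto intro!: order_trans[OF norm_sum] sum_mono mult_mono order_trans[OF norm_ge_zero] simp: norm_mult)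

lemma coeff_dom_power: "coeff_dom p P \<Longrightarrow> coeff_dom (p ^ w) (P ^ w)"
proof (induction w)
  case 0 then show ?case by (simp add: coeff_dom_def)
qed (simp add: coeff_dom_mult)


lemma unimodular_multiplier: obtains e where "cmod e = 1" "e * z = of_real (cmod z)"
proof (cases "z = 0")
  case False
  show ?thesis
    by (rule that[of "cnj z / of_real (cmod z)"])
      (use False complex_norm_square[of z] in \<open>simp_all add: norm_divide field_simps power2_eq_square\<close>)
qed (use that[of 1] in simp)

lemma coeff_sum_monom_dom:
  assumes "\<And>z. z \<in> C \<Longrightarrow> cmod (b z) \<le> 1"
  shows "coeff_dom (\<Sum>z\<in>C. monom (b z) (z ^ k)) (\<Sum>z\<in>C. monom 1 (z ^ k))"
  unfolding coeff_dom_def coeff_sum using assms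
  by (auto intro!: order_trans[OF norm_sum] sum_mono)

text \<open>Schur's test. Expanding the square gives a quadratic form in the coefficients whose
  kernel is symmetric, since exchanging the indices conjugates the inner sum. By 2 s_i s_j <= s_i^2
  + s_j^2 the form is bounded by the largest row sum \<Lambda>. The majorant \<open>s\<close> lets
  unknown phases be replaced by representation numbers.\<close>

lemma dual_large_sieve:
  fixes q :: "complex poly" and \<Lambda> \<theta> :: real and s :: "nat \<Rightarrow> real"
  assumes s: "\<And>j. cmod (coeff q j) \<le> s j" and J: "degree q \<le> J"
    and \<Lambda>: "\<And>j1. j1 \<le> J \<Longrightarrow>
       (\<Sum>j2\<le>J. cmod (\<Sum>n<N. ee (\<theta> * of_int (int j2 - int j1) * real n))) \<le> \<Lambda>"
  shows "(\<Sum>n<N. (cmod (poly q (ee (\<theta> * real n))))\<^sup>2) \<le> \<Lambda> * (\<Sum>j\<le>J. (s j)\<^sup>2)"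
proof -
  define K where "K i j = cmod (\<Sum>n<N. ee (\<theta> * of_int (int j - int i) * real n))" for i j
  have K_sym: "K i j = K j i" for i j
  proof -
    have "(\<Sum>n<N. ee (\<theta> * of_int (int i - int j) * real n)) = cnj (\<Sum>n<N. ee (\<theta> * of_int (int j - int i) * real n))"
      unfolding cnj_sum cnj_ee by (intro sum.cong refl arg_cong[of _ _ ee]) (simp add: algebra_simps)
    then show ?thesis unfolding K_def by (metis complex_mod_cnj)
  qed
  have eq: "complex_of_real ((cmod (poly q (ee (\<theta> * real n))))\<^sup>2) =
      (\<Sum>j\<le>J. \<Sum>i\<le>J. coeff q j * cnj (coeff q i) * ee (\<theta> * of_int (int j - int i) * real n))" for n
  proof -
    have "complex_of_real ((cmod (poly q (ee (\<theta> * real n))))\<^sup>2) 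
        = poly q (ee (\<theta> * real n)) * cnj (poly q (ee (\<theta> * real n)))"
      by (rule complex_norm_square)
    also have "\<dots> = (\<Sum>j\<le>J. \<Sum>i\<le>J. (coeff q j * ee (\<theta> * real n) ^ j) * cnj (coeff q i * ee (\<theta> * real n) ^ i))"
      unfolding poly_sum_atMost[OF J] cnj_sum by (rule sum_product)
    also have "\<dots> = (\<Sum>j\<le>J. \<Sum>i\<le>J. coeff q j * cnj (coeff q i) * ee (\<theta> * of_int (int j - int i) * real n))"
    proof (intro sum.cong refl)
      fix j i
      have "ee (\<theta> * real n) ^ j * cnj (ee (\<theta> * real n) ^ i) = ee (\<theta> * of_int (int j - int i) * real n)"
        by (simp add: ee_power cnj_ee ee_add[symmetric] algebra_simps)
      then show "(coeff q j * ee (\<theta> * real n) ^ j) * cnj (coeff q i * ee (\<theta> * real n) ^ i)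
          = coeff q j * cnj (coeff q i) * ee (\<theta> * of_int (int j - int i) * real n)"
        by (simp add: mult_ac)
    qed
    finally show ?thesis .
  qed
  have "complex_of_real (\<Sum>n<N. (cmod (poly q (ee (\<theta> * real n))))\<^sup>2) =
      (\<Sum>n<N. \<Sum>j\<le>J. \<Sum>i\<le>J. coeff q j * cnj (coeff q i) * ee (\<theta> * of_int (int j - int i) * real n))"
    unfolding of_real_sum eq ..
  also have "\<dots> = (\<Sum>j\<le>J. \<Sum>i\<le>J. \<Sum>n<N. coeff q j * cnj (coeff q i) * ee (\<theta> * of_int (int j - int i) * real n))"
    by (subst sum.swap) (intro sum.cong refl sum.swap)
  also have "\<dots> = (\<Sum>j\<le>J. \<Sum>i\<le>J. coeff q j * cnj (coeff q i) * (\<Sum>n<N. ee (\<theta> * of_int (int j - int i) * real n)))"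
    by (simp add: sum_distrib_left)
  finally have e2: "complex_of_real (\<Sum>n<N. (cmod (poly q (ee (\<theta> * real n))))\<^sup>2) = \<dots>" .
  have "(\<Sum>n<N. (cmod (poly q (ee (\<theta> * real n))))\<^sup>2) 
      = cmod (complex_of_real (\<Sum>n<N. (cmod (poly q (ee (\<theta> * real n))))\<^sup>2))"
    by (simp only: norm_of_real) (simp add: sum_nonneg)
  also have "\<dots> \<le> (\<Sum>j\<le>J. \<Sum>i\<le>J. s j * s i * K i j)"
    unfolding e2
  proof (intro sum_norm_le)
    fix j i assume "j \<in> {..J}" "i \<in> {..J}"
    show "cmod (coeff q j * cnj (coeff q i) * (\<Sum>n<N. ee (\<theta> * of_int (int j - int i) * real n))) \<le> s j * s i * K i j"
      unfolding norm_mult complex_mod_cnj K_def 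
      by (intro mult_mono s mult_nonneg_nonneg order_refl order_trans[OF norm_ge_zero s]) auto
  qed
  also have "\<dots> \<le> (\<Sum>j\<le>J. \<Sum>i\<le>J. ((s j)\<^sup>2 * K i j + (s i)\<^sup>2 * K i j) / 2)"
  proof (intro sum_mono)
    fix j i
    have "2 * (s j * s i) \<le> (s j)\<^sup>2 + (s i)\<^sup>2"
      using sum_squares_bound[of "s j" "s i"] by simp
    then have "2 * (s j * s i) * K i j \<le> ((s j)\<^sup>2 + (s i)\<^sup>2) * K i j"
      by (intro mult_right_mono) (auto simp: K_def)
    then show "s j * s i * K i j \<le> ((s j)\<^sup>2 * K i j + (s i)\<^sup>2 * K i j) / 2"
      by (simp add: algebra_simps)
  qed
  also have "\<dots> = ((\<Sum>j\<le>J. \<Sum>i\<le>J. (s j)\<^sup>2 * K i j) + (\<Sum>j\<le>J. \<Sum>i\<le>J. (s i)\<^sup>2 * K i j)) / 2"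
    by (simp only: sum_divide_distrib[symmetric] sum.distrib)
  also have "(\<Sum>j\<le>J. \<Sum>i\<le>J. (s i)\<^sup>2 * K i j) = (\<Sum>j\<le>J. \<Sum>i\<le>J. (s j)\<^sup>2 * K j i)"
    by (rule sum.swap)
  also have "\<dots> = (\<Sum>j\<le>J. \<Sum>i\<le>J. (s j)\<^sup>2 * K i j)"
    using K_sym by (intro sum.cong refl) simp
  also have "((\<Sum>j\<le>J. \<Sum>i\<le>J. (s j)\<^sup>2 * K i j) + (\<Sum>j\<le>J. \<Sum>i\<le>J. (s j)\<^sup>2 * K i j)) / 2
     = (\<Sum>j\<le>J. (s j)\<^sup>2 * (\<Sum>i\<le>J. K j i))"
    unfolding sum_distrib_left field_sum_of_halves add_divide_distrib
    by (intro sum.cong refl arg_cong2[of _ _ _ _ "(*)"] K_sym)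
  also have "\<dots> \<le> (\<Sum>j\<le>J. (s j)\<^sup>2 * \<Lambda>)"
    unfolding K_def by (intro sum_mono mult_left_mono \<Lambda>) auto
  also have "\<dots> = \<Lambda> * (\<Sum>j\<le>J. (s j)\<^sup>2)" by (simp add: sum_distrib_left mult.commute)
  finally show ?thesis .
qed

lemma poly_sum_monom:
  fixes b :: "nat \<Rightarrow> 'a::comm_semiring_1"
  shows "poly (\<Sum>z\<in>C. monom (b z) (z ^ k)) x = (\<Sum>z\<in>C. b z * x ^ (z ^ k))"
  by (simp add: poly_sum poly_monom)

lemma degree_coeff_dom_le:
  assumes "coeff_dom p P" shows "degree p \<le> degree P"
proof (rule degree_le, intro allI impI)
  fix i assume "degree P < i"
  then have "coeff P i = 0" by (rule coeff_eq_0)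
  then show "coeff p i = 0" using assms unfolding coeff_dom_def by (metis norm_le_zero_iff)
qed

text \<open>With w = v + 1, Hoelder over m raises the inner sum to the power w, Hoelder over n
  raises the dual sum to the power w, and Cauchy-Schwarz squares: hence the exponent 2 w^2. The
  squared coefficients of \<open>PC\<close> and \<open>PB\<close> sum to 2w-th moments of Weyl sums
  over C and B, and the large sieve decouples the two variables at the cost \<Lambda>.\<close>

lemma sum_power_bilinear:
  fixes B C :: "nat set" and b :: "nat \<Rightarrow> complex" and k v :: nat and \<theta> \<Lambda> :: real
  defines "PB \<equiv> (\<Sum>m\<in>B. monom (1::real) (m ^ k)) ^ Suc v"
    and "PC \<equiv> (\<Sum>z\<in>C. monom (1::real) (z ^ k)) ^ Suc v"
  assumes fin: "finite B" "finite C" and b: "\<And>z. z \<in> C \<Longrightarrow> cmod (b z) \<le> 1"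
    and J: "degree PB \<le> J" and D: "degree PC \<le> D"
    and \<Lambda>: "\<And>j1. j1 \<le> J \<Longrightarrow>
       (\<Sum>j2\<le>J. cmod (\<Sum>n<Suc D. ee (\<theta> * of_int (int j2 - int j1) * real n))) \<le> \<Lambda>"
  shows "(\<Sum>m\<in>B. cmod (\<Sum>z\<in>C. b z * ee (\<theta> * real m ^ k * real z ^ k))) ^ (2 * Suc v * Suc v)
     \<le> real (card B) ^ (2 * v * Suc v) * real (card C) ^ (2 * v * Suc v) 
       * (\<Sum>n\<le>D. (coeff PC n)\<^sup>2) * (\<Lambda> * (\<Sum>n\<le>J. (coeff PB n)\<^sup>2))"
proof -
  define w where "w = Suc v"
  define G where "G m = (\<Sum>z\<in>C. b z * ee (\<theta> * real m ^ k * real z ^ k))" for m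
  define pb where "pb = (\<Sum>z\<in>C. monom (b z) (z ^ k))"
  have G: "G m = poly pb (ee (\<theta> * real m ^ k))" for m
    unfolding G_def pb_def poly_sum_monom by (simp add: ee_power mult.assoc)
  \<comment> \<open>Phases that turn the sum of |G m|^w into a sum without absolute values, so that
    the order of summation can be changed.\<close>
  have "\<exists>e. cmod e = 1 \<and> e * G m ^ w = of_real (cmod (G m ^ w))" for m
    using unimodular_multiplier[of "G m ^ w"] by metis
  then obtain e where e: "\<And>m. cmod (e m) = 1" "\<And>m. e m * G m ^ w = of_real (cmod (G m ^ w))" by metis
  define ve where "ve = (\<Sum>m\<in>B. monom (e m) (m ^ k))"
  define V where "V n = cmod (poly ve (ee (\<theta> * real n)))" for n
  define \<rho> where "\<rho> n = coeff PC n" for n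
  have dom: "coeff_dom (pb ^ w) PC"
    unfolding pb_def PC_def w_def by (intro coeff_dom_power coeff_sum_monom_dom b)
  have domv: "coeff_dom (ve ^ w) PB"
    unfolding ve_def PB_def w_def by (intro coeff_dom_power coeff_sum_monom_dom) (simp add: e)
  have \<rho>0: "\<rho> n \<ge> 0" for n using dom norm_ge_zero order_trans unfolding coeff_dom_def \<rho>_def by blast
  have degp: "degree (pb ^ w) \<le> D" using degree_coeff_dom_le[OF dom] D by simp
  \<comment> \<open>G m ^ w is a polynomial in e(\<theta> m^k) whose n-th coefficient is at most the
    number \<rho> n of representations of n as a sum of w k-th powers from C. After the exchange of
    sums only V n, a sum over m at frequency \<theta> n, carries the oscillation.\<close>
  have "complex_of_real (\<Sum>m\<in>B. cmod (G m) ^ w) = (\<Sum>m\<in>B. e m * G m ^ w)"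
    by (simp add: e(2) norm_power)
  also have "\<dots> = (\<Sum>m\<in>B. \<Sum>n\<le>D. e m * (coeff (pb ^ w) n * ee (\<theta> * real m ^ k) ^ n))"
    by (simp only: G poly_power[symmetric] poly_sum_atMost[OF degp] sum_distrib_left)
  also have "\<dots> = (\<Sum>n\<le>D. \<Sum>m\<in>B. e m * (coeff (pb ^ w) n * ee (\<theta> * real m ^ k) ^ n))"
    by (rule sum.swap)
  also have "\<dots> = (\<Sum>n\<le>D. coeff (pb ^ w) n * poly ve (ee (\<theta> * real n)))"
    unfolding ve_def poly_sum_monom sum_distrib_left
    by (intro sum.cong refl) (simp add: ee_power algebra_simps)
  finally have "cmod (complex_of_real (\<Sum>m\<in>B. cmod (G m) ^ w)) \<le> (\<Sum>n\<le>D. \<rho> n * V n)"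
    using dom by (auto intro!: sum_norm_le mult_right_mono simp: norm_mult V_def coeff_dom_def \<rho>_def)
  then have st1: "(\<Sum>m\<in>B. cmod (G m) ^ w) \<le> (\<Sum>n\<le>D. \<rho> n * V n)"
    by (metis abs_le_D1 norm_of_real)
  have V0: "V n \<ge> 0" for n unfolding V_def by simp
  have st2: "(\<Sum>n\<le>D. \<rho> n * V n) ^ w \<le> (\<Sum>n\<le>D. \<rho> n) ^ v * (\<Sum>n\<le>D. \<rho> n * V n ^ w)"
    unfolding w_def by (rule weighted_power_mean) (auto simp: \<rho>0 V0)
  have st3: "(\<Sum>n\<le>D. \<rho> n * V n ^ w)\<^sup>2 \<le> (\<Sum>n\<le>D. (\<rho> n)\<^sup>2) * (\<Sum>n\<le>D. (V n ^ w)\<^sup>2)"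
    by (rule Cauchy_Schwarz_ineq_sum)
  have "(\<Sum>n<Suc D. (cmod (poly (ve ^ w) (ee (\<theta> * real n))))\<^sup>2) \<le> \<Lambda> * (\<Sum>n\<le>J. (coeff PB n)\<^sup>2)"
  proof (rule dual_large_sieve)
    show "degree (ve ^ w) \<le> J" using degree_coeff_dom_le[OF domv] J by simp
  qed (use domv \<Lambda> in \<open>auto simp: coeff_dom_def\<close>)
  then have st4: "(\<Sum>n\<le>D. (V n ^ w)\<^sup>2) \<le> \<Lambda> * (\<Sum>n\<le>J. (coeff PB n)\<^sup>2)"
    by (simp add: V_def norm_power poly_power lessThan_Suc_atMost)
  \<comment> \<open>The total number of w-tuples from C, obtained by evaluating \<open>PC\<close> at
    1.\<close>
  have st5: "(\<Sum>n\<le>D. \<rho> n) = real (card C) ^ w"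
    using poly_sum_atMost[OF D, of 1] unfolding \<rho>_def PC_def w_def poly_power poly_sum_monom by simp
  have st0: "(\<Sum>m\<in>B. cmod (G m)) ^ w \<le> real (card B) ^ v * (\<Sum>m\<in>B. cmod (G m) ^ w)"
    using weighted_power_mean[of B "\<lambda>_. 1" "\<lambda>m. cmod (G m)" v] fin by (simp add: w_def)
  have "(\<Sum>m\<in>B. cmod (G m)) ^ (2 * w * w) = (((\<Sum>m\<in>B. cmod (G m)) ^ w) ^ w)\<^sup>2"
    by (simp add: power_mult[symmetric] mult_ac)
  also have "\<dots> \<le> ((real (card B) ^ v * (\<Sum>n\<le>D. \<rho> n * V n)) ^ w)\<^sup>2"
    by (intro power_mono order_trans[OF st0] mult_left_mono st1) (auto intro!: sum_nonneg zero_le_power)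
  also have "\<dots> = real (card B) ^ (2 * v * w) * ((\<Sum>n\<le>D. \<rho> n * V n) ^ w)\<^sup>2"
    by (simp add: power_mult_distrib power_mult[symmetric] mult_ac)
  also have "\<dots> \<le> real (card B) ^ (2 * v * w) * ((\<Sum>n\<le>D. \<rho> n) ^ v * (\<Sum>n\<le>D. \<rho> n * V n ^ w))\<^sup>2"
    by (intro mult_left_mono power_mono st2) (auto intro!: sum_nonneg zero_le_power simp: \<rho>0 V0)
  also have "\<dots> = real (card B) ^ (2 * v * w) * real (card C) ^ (2 * v * w) * (\<Sum>n\<le>D. \<rho> n * V n ^ w)\<^sup>2"
    unfolding st5 by (simp add: power_mult_distrib power_mult[symmetric] mult_ac)
  also have "\<dots> \<le> real (card B) ^ (2 * v * w) * real (card C) ^ (2 * v * w) * 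
      ((\<Sum>n\<le>D. (\<rho> n)\<^sup>2) * (\<Lambda> * (\<Sum>n\<le>J. (coeff PB n)\<^sup>2)))"
    by (intro mult_left_mono order_trans[OF st3] st4 mult_nonneg_nonneg sum_nonneg) auto
  finally show ?thesis unfolding G_def \<rho>_def w_def by (simp only: mult.assoc)
qed

section \<open>Completion of sums with a variable cutoff\<close>

lemma sum_ee_residues:
  fixes d :: int and n :: nat
  assumes "n \<ge> 1" "\<bar>d\<bar> < int n"
  shows "(\<Sum>c<n. ee (of_int d / real n * real c)) = (if d = 0 then of_nat n else 0)"
proof (cases "d = 0")
  case False
  define x where "x = of_int d / real n"
  have "(1 - ee x) * (\<Sum>i<n. ee (x * real i)) = 1 - ee x ^ n"
    using one_diff_power_eq[of "ee x" n] by (simp add: ee_power)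
  also have "ee x ^ n = 1"
    using assms by (simp add: ee_power x_def)
  finally have "(1 - ee x) * (\<Sum>i<n. ee (x * real i)) = 0" by simp
  moreover have "ee x \<noteq> 1"
  proof
    assume "ee x = 1"
    then have "x = of_int (round x)" using cmod_one_minus_ee_ge[of x] by simp
    then have "real_of_int d = of_int (round x * int n)"
      using assms unfolding x_def by (simp add: field_simps)
    then have "d = round x * int n" by (simp only: of_int_eq_iff)
    then have "int n dvd d" by simp
    then show False using False assms dvd_imp_le_int[of d "int n"] by auto
  qed
  ultimately show ?thesis using False by (simp add: x_def)
qed simp

text \<open>The distance is at least the minimum of c / n and 1 - c / n, and the reciprocal of a
  minimum is at most the sum of the reciprocals. In this form the sum over c becomes two harmonic
  sums without a case distinction.\<close>

lemma frac_dist_ge: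
  fixes c n :: nat
  assumes "0 < c" "c < n"
  shows "1 / \<bar>- (real c / real n) - of_int (round (- (real c / real n)))\<bar> \<le> real n * (1 / real c + 1 / real (n - c))"
    (is "1 / ?D \<le> _")
proof -
  define x where "x = real c / real n"
  have x: "0 < x" "x < 1" using assms unfolding x_def by auto
  have "?D \<ge> x \<or> ?D \<ge> 1 - x"
  proof (cases "round (-x) \<ge> 0")
    case True
    then have "real_of_int (round (-x)) \<ge> 0" by simp
    then show ?thesis unfolding x_def by linarith
  next
    case False
    then have "round (-x) \<le> -1" by linarith
    then have "real_of_int (round (-x)) \<le> -1" by linarith
    then show ?thesis unfolding x_def by linarith
  qed
  then have "1 / ?D \<le> 1 / x \<or> 1 / ?D \<le> 1 / (1 - x)"
    using x frac_le[of 1 1 x ?D] frac_le[of 1 1 "1 - x" ?D] by auto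
  moreover have "1 / x > 0" "1 / (1 - x) > 0" using x by auto
  ultimately have "1 / ?D \<le> 1 / x + 1 / (1 - x)" by linarith
  also have "1 / x = real n * (1 / real c)" unfolding x_def by simp
  also have "1 / (1 - x) = real n * (1 / real (n - c))"
    using assms unfolding x_def by (simp add: of_nat_diff field_simps)
  finally show ?thesis by (simp add: distrib_left)
qed

text \<open>Removal of the cutoff \<open>z \<le> N m\<close> by expanding its indicator function in additive characters modulo \<open>n\<close>.\<close>
lemma completion:
  fixes g :: "'a \<Rightarrow> nat \<Rightarrow> complex" and N :: "'a \<Rightarrow> nat"
  assumes fin: "finite B" and n: "n \<ge> 1" and C: "\<And>z. z \<in> C \<Longrightarrow> z < n"
  obtains \<gamma> where "(\<Sum>m\<in>B. cmod (\<Sum>z\<in>{z\<in>C. z \<le> N m}. g m z)) 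
     \<le> (3 + 2 * ln (real n)) * (\<Sum>m\<in>B. cmod (\<Sum>z\<in>C. ee (\<gamma> * real z) * g m z))"
proof -
  have finC: "finite C" using C by (meson finite_nat_iff_bounded lessThan_iff subsetI)
  \<comment> \<open>Lowering the cutoff to n - 1 loses nothing on C and keeps all differences z - y
    below n in absolute value, so that congruence modulo n means equality.\<close>
  define M where "M m = min (N m) (n - 1)" for m
  have M: "M m < n" for m using n unfolding M_def by auto
  have MN: "{z\<in>C. z \<le> N m} = {z\<in>C. z \<le> M m}" for m using C unfolding M_def by force
  define T where "T c = (\<Sum>m\<in>B. cmod (\<Sum>z\<in>C. ee (real c / real n * real z) * g m z))" for c :: nat
  \<comment> \<open>The weight of frequency c / n, a bound for |D m c| / n. It does not depend on m,
    so the frequencies can be compared after the sum over m.\<close>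
  define W where "W c = (if c = 0 then 1 else 1 / real c + 1 / real (n - c))" for c :: nat
  define D where "D m c = (\<Sum>y<Suc (M m). ee (- (real c / real n) * real y))" for m c
  have D: "cmod (D m c) \<le> real n * W c" if "c < n" for m c
  proof (cases "c = 0")
    case True
    have "cmod (D m c) \<le> real (card {..<Suc (M m)})" unfolding D_def by (rule cmod_sum_ee_le_card)
    also have "\<dots> \<le> real n * W c" using M[of m] True by (simp add: W_def)
    finally show ?thesis .
  next
    case False
    have "cmod (D m c) * \<bar>- (real c / real n) - of_int (round (- (real c / real n)))\<bar> \<le> 1"
      unfolding D_def by (rule cmod_sum_ee_le)
    moreover have "\<bar>- (real c / real n) - of_int (round (- (real c / real n)))\<bar> > 0"
    proof (rule ccontr)
      assume "\<not> ?thesis"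
      then have "- (real c / real n) = of_int (round (- (real c / real n)))" by simp
      then have "real c = real_of_int (- round (- (real c / real n)) * int n)"
        using n by (simp add: field_simps)
      then have "int c = - round (- (real c / real n)) * int n" by (metis of_int_eq_iff of_int_of_nat_eq)
      then have "int n dvd int c" by (metis dvd_triv_right)
      then show False using False that by (auto dest: dvd_imp_le)
    qed
    ultimately have "cmod (D m c) \<le> 1 / \<bar>- (real c / real n) - of_int (round (- (real c / real n)))\<bar>"
      by (simp add: pos_le_divide_eq)
    also have "\<dots> \<le> real n * W c" using frac_dist_ge[of c n] False that by (simp add: W_def)
    finally show ?thesis .
  qed
  have ind: "(if z \<le> M m then 1 else 0) = (\<Sum>c<n. ee (real c / real n * real z) * D m c) / of_nat n"
    if "z \<in> C" for z m
  proof -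
    have "(\<Sum>c<n. ee (real c / real n * real z) * D m c) 
        = (\<Sum>c<n. \<Sum>y<Suc (M m). ee (of_int (int z - int y) / real n * real c))"
      unfolding D_def sum_distrib_left ee_add[symmetric] using n
      by (intro sum.cong refl arg_cong[of _ _ ee]) (simp add: algebra_simps diff_divide_distrib)
    also have "\<dots> = (\<Sum>y<Suc (M m). \<Sum>c<n. ee (of_int (int z - int y) / real n * real c))"
      by (rule sum.swap)
    also have "\<dots> = (\<Sum>y<Suc (M m). if int z - int y = 0 then of_nat n else 0)"
      using n M[of m] C[OF that] by (intro sum.cong refl sum_ee_residues) auto
    also have "\<dots> = (\<Sum>y<Suc (M m). if z = y then of_nat n else 0)"
      by (intro sum.cong refl) simp
    also have "\<dots> = (if z \<le> M m then of_nat n else 0)"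
      by simp
    finally show ?thesis using n by simp
  qed
  have "(\<Sum>m\<in>B. cmod (\<Sum>z\<in>{z\<in>C. z \<le> N m}. g m z)) \<le> (\<Sum>c<n. W c * T c)"
  proof -
    have "cmod (\<Sum>z\<in>{z\<in>C. z \<le> N m}. g m z) \<le> (\<Sum>c<n. W c * cmod (\<Sum>z\<in>C. ee (real c / real n * real z) * g m z))" for m
    proof -
      have "(\<Sum>z\<in>{z\<in>C. z \<le> N m}. g m z) = (\<Sum>z\<in>C. (if z \<le> M m then 1 else 0) * g m z)"
        unfolding MN by (simp add: sum.inter_filter[OF finC] if_distrib if_distribR cong: if_cong)
      also have "\<dots> = (\<Sum>z\<in>C. (\<Sum>c<n. ee (real c / real n * real z) * D m c) / of_nat n * g m z)"
        by (intro sum.cong refl) (simp add: ind)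
      also have "\<dots> = (\<Sum>z\<in>C. \<Sum>c<n. D m c / of_nat n * (ee (real c / real n * real z) * g m z))"
        by (simp add: sum_divide_distrib sum_distrib_left sum_distrib_right mult_ac)
      also have "\<dots> = (\<Sum>c<n. \<Sum>z\<in>C. D m c / of_nat n * (ee (real c / real n * real z) * g m z))"
        by (rule sum.swap)
      also have "\<dots> = (\<Sum>c<n. D m c / of_nat n * (\<Sum>z\<in>C. ee (real c / real n * real z) * g m z))"
        by (simp add: sum_distrib_left)
      finally have eq: "(\<Sum>z\<in>{z\<in>C. z \<le> N m}. g m z) = \<dots>" .
      show ?thesis unfolding eq
      proof (intro sum_norm_le)
        fix c assume "c \<in> {..<n}"
        then have "cmod (D m c) / real n \<le> W c" using D[of c m] n by (simp add: pos_divide_le_eq mult.commute)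
        then show "cmod (D m c / of_nat n * (\<Sum>z\<in>C. ee (real c / real n * real z) * g m z)) 
            \<le> W c * cmod (\<Sum>z\<in>C. ee (real c / real n * real z) * g m z)"
          unfolding norm_mult norm_divide by (intro mult_right_mono) auto
      qed
    qed
    then have "(\<Sum>m\<in>B. cmod (\<Sum>z\<in>{z\<in>C. z \<le> N m}. g m z)) 
       \<le> (\<Sum>m\<in>B. \<Sum>c<n. W c * cmod (\<Sum>z\<in>C. ee (real c / real n * real z) * g m z))"
      by (intro sum_mono)
    also have "\<dots> = (\<Sum>c<n. W c * T c)"
      unfolding T_def by (subst sum.swap) (simp add: sum_distrib_left)
    finally show ?thesis .
  qed
  \<comment> \<open>The worst frequency yields \<gamma> = c / n, common to all m. The weights add up
    to at most 1 + 2 (1 + ln n).\<close>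
  moreover obtain c where c: "c < n" "\<And>c'. c' < n \<Longrightarrow> T c' \<le> T c"
  proof -
    have "Max (T ` {..<n}) \<in> T ` {..<n}" using n by (intro Max_in) (auto simp: lessThan_empty_iff)
    then obtain c where "c < n" "T c = Max (T ` {..<n})" by auto
    then show ?thesis using that[of c] by simp
  qed
  have "(\<Sum>c'<n. W c' * T c') \<le> (\<Sum>c'<n. W c' * T c)"
    by (intro sum_mono mult_left_mono c) (auto simp: W_def)
  also have "\<dots> = (\<Sum>c'<n. W c') * T c" by (simp add: sum_distrib_right)
  also have "\<dots> \<le> (3 + 2 * ln (real n)) * T c"
  proof (intro mult_right_mono)
    have "(\<Sum>c'<n. W c') = 1 + (\<Sum>c'\<in>{1..<n}. W c')"
      using n by (simp add: lessThan_atLeast0 sum.atLeast_Suc_lessThan W_def)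
    also have "(\<Sum>c'\<in>{1..<n}. W c') = (\<Sum>c'\<in>{1..<n}. 1 / real c') + (\<Sum>c'\<in>{1..<n}. 1 / real (n - c'))"
      unfolding sum.distrib[symmetric] by (intro sum.cong) (auto simp: W_def)
    also have "(\<Sum>c'\<in>{1..<n}. 1 / real (n - c')) = (\<Sum>c'\<in>{1..<n}. 1 / real c')"
      by (rule sum.reindex_bij_witness[of _ "\<lambda>i. n - i" "\<lambda>i. n - i"]) auto
    also have "(\<Sum>c'\<in>{1..<n}. 1 / real c') \<le> (\<Sum>c'=1..n. 1 / real c')"
      by (intro sum_mono2) auto
    also have "\<dots> \<le> 1 + ln (real n)" by (rule sum_inverse_le_ln[OF n])
    finally show "(\<Sum>c'<n. W c') \<le> 3 + 2 * ln (real n)" by simp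
    show "T c \<ge> 0" unfolding T_def by (intro sum_nonneg) simp
  qed
  ultimately have "(\<Sum>m\<in>B. cmod (\<Sum>z\<in>{z\<in>C. z \<le> N m}. g m z)) \<le> (3 + 2 * ln (real n)) * T c"
    by linarith
  then show ?thesis unfolding T_def by (rule that)
qed

section \<open>Factorization of smooth numbers\<close>

text \<open>Only the primes in \<open>Ps\<close> matter, so \<open>Ps\<close> may be any set of
  numbers, for instance all divisors of q. The condition n >= 1 excludes 0, which every prime
  divides.\<close>

definition primes_in :: "nat set \<Rightarrow> nat \<Rightarrow> bool" where
  "primes_in Ps n \<longleftrightarrow> n \<ge> 1 \<and> (\<forall>p. prime p \<and> p dvd n \<longrightarrow> p \<in> Ps)"

definition psmooth :: "nat set \<Rightarrow> real \<Rightarrow> nat set" where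
  "psmooth Ps X = {n. primes_in Ps n \<and> real n \<le> X}"

lemma smooth_set_psmooth: "smooth_set P R = psmooth {p. real p \<le> R} P"
  unfolding smooth_set_def psmooth_def primes_in_def by auto

lemma finite_psmooth [simp]: "finite (psmooth Ps X)"
proof (rule finite_subset)
  show "psmooth Ps X \<subseteq> {..nat \<lfloor>X\<rfloor>}" unfolding psmooth_def by (auto simp: le_nat_floor)
qed simp

lemma finite_smooth_set [simp]: "finite (smooth_set P R)"
  unfolding smooth_set_psmooth by simp

lemma psmooth_mono: "(\<And>p. prime p \<Longrightarrow> p \<in> Ps \<Longrightarrow> p \<in> Qs) \<Longrightarrow> X \<le> Y \<Longrightarrow> psmooth Ps X \<subseteq> psmooth Qs Y"
  unfolding psmooth_def primes_in_def by fastforce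

lemma card_psmooth_le: "X \<ge> 0 \<Longrightarrow> real (card (psmooth Ps X)) \<le> X"
proof -
  assume X: "X \<ge> 0"
  have "psmooth Ps X \<subseteq> {1..nat \<lfloor>X\<rfloor>}" unfolding psmooth_def primes_in_def by (auto simp: le_nat_floor)
  then have "card (psmooth Ps X) \<le> nat \<lfloor>X\<rfloor>" using card_mono[of "{1..nat \<lfloor>X\<rfloor>}"] by simp
  then have "real (card (psmooth Ps X)) \<le> real (nat \<lfloor>X\<rfloor>)" by simp
  also have "\<dots> \<le> X" using X by (rule of_nat_floor)
  finally show ?thesis .
qed

lemma primes_in_mult:
  "primes_in Ps (a * b) \<longleftrightarrow> primes_in Ps a \<and> primes_in Ps b"
  unfolding primes_in_def by (auto simp: prime_dvd_mult_iff)

lemma primes_in_prime: "prime p \<Longrightarrow> primes_in Ps p \<longleftrightarrow> p \<in> Ps"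
  unfolding primes_in_def using prime_ge_1_nat by (auto dest: primes_dvd_imp_eq)

lemma primes_in_mono: "primes_in Ps n \<Longrightarrow> Ps \<subseteq> Qs \<Longrightarrow> primes_in Qs n"
  unfolding primes_in_def by auto

text \<open>Here p is the smallest prime of l, the last one taken when primes are multiplied largest
  first: before it the product was at most L, with it the product exceeds L.\<close>

definition block :: "nat set \<Rightarrow> real \<Rightarrow> nat \<Rightarrow> nat set" where
  "block Qs L p = {l. primes_in {p'\<in>Qs. p \<le> p'} l \<and> p dvd l \<and> L < real l \<and> real l \<le> L * real p}"

text \<open>The primes left for the cofactor of a block element: from \<open>Qs\<close> only those
  up to p, since the larger ones have all gone into l; outside \<open>Qs\<close> there is no
  restriction.\<close>

definition low_primes :: "nat set \<Rightarrow> nat set \<Rightarrow> nat \<Rightarrow> nat set" where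
  "low_primes Ps Qs p = {p'\<in>Ps. p' \<in> Qs \<longrightarrow> p' \<le> p}"

lemma finite_block [simp]: "finite (block Qs L p)"
proof (rule finite_subset)
  show "block Qs L p \<subseteq> {..nat \<lfloor>L * real p\<rfloor>}" unfolding block_def by (auto simp: le_nat_floor)
qed simp

text \<open>Multiply up the primes of \<open>Qs\<close> dividing \<open>x\<close>, largest first, until the product exceeds \<open>L\<close>;
  the second alternative covers the case where their total product is too small.\<close>
lemma factorization_exists:
  assumes "primes_in Ps x" "Qs \<subseteq> Ps" "L \<ge> 1"
  shows "(\<exists>p l y. prime p \<and> p \<in> Qs \<and> l \<in> block Qs L p \<and> primes_in (low_primes Ps Qs p) y \<and> x = l * y) \<or>
    (\<exists>u v. x = u * v \<and> primes_in (Ps - Qs) u \<and> primes_in Qs v \<and> real v \<le> L)"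
  using assms(1)
proof (induction x rule: less_induct)
  case (less x)
  show ?case
  proof (cases "\<exists>p. prime p \<and> p \<in> Qs \<and> p dvd x")
    case False
    then have "primes_in (Ps - Qs) x" "primes_in Qs 1" "real 1 \<le> L" "x = x * 1"
      using less.prems assms by (auto simp: primes_in_def)
    then show ?thesis by blast
  next
    case True
    \<comment> \<open>Removing the smallest prime of \<open>Qs\<close> does not disturb the product
      of the larger ones. If that product already exceeds L, p0 goes into the cofactor; otherwise it
      is multiplied on, and this is the only moment at which L can be crossed.\<close>
    define p0 where "p0 = (LEAST p. prime p \<and> p \<in> Qs \<and> p dvd x)"
    have p0: "prime p0" "p0 \<in> Qs" "p0 dvd x"
      using LeastI_ex[OF True] unfolding p0_def by auto
    have least: "p0 \<le> p" if "prime p" "p \<in> Qs" "p dvd x" for p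
      unfolding p0_def using that by (intro Least_le) auto
    obtain x' where x': "x = p0 * x'" using p0(3) by blast
    have "x \<ge> 1" using less.prems by (simp add: primes_in_def)
    then have "x' > 0" using x' by (cases x') auto
    then have "1 * x' < p0 * x'" using prime_gt_1_nat[OF p0(1)] by (intro mult_strict_right_mono) auto
    then have "x' < x" using x' by simp
    moreover have "primes_in Ps x'" using less.prems unfolding x' primes_in_mult by simp
    ultimately have "(\<exists>p l y. prime p \<and> p \<in> Qs \<and> l \<in> block Qs L p \<and> primes_in (low_primes Ps Qs p) y \<and> x' = l * y) \<or>
      (\<exists>u v. x' = u * v \<and> primes_in (Ps - Qs) u \<and> primes_in Qs v \<and> real v \<le> L)" by (rule less.IH)
    then consider (A) p l y where "prime p" "p \<in> Qs" "l \<in> block Qs L p" "primes_in (low_primes Ps Qs p) y" "x' = l * y"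
      | (B) u v where "x' = u * v" "primes_in (Ps - Qs) u" "primes_in Qs v" "real v \<le> L" by blast
    then show ?thesis
    proof cases
      case A
      have "p dvd x" using A unfolding x' by (auto simp: block_def)
      then have "p0 \<le> p" using A least by auto
      then have "primes_in (low_primes Ps Qs p) (p0 * y)"
        unfolding primes_in_mult primes_in_prime[OF p0(1)] using A p0 assms(2) by (auto simp: low_primes_def)
      moreover have "x = l * (p0 * y)" using A x' by simp
      ultimately show ?thesis using A by blast
    next
      case B
      show ?thesis
      proof (cases "real (p0 * v) \<le> L")
        case True
        moreover have "primes_in Qs (p0 * v)" unfolding primes_in_mult primes_in_prime[OF p0(1)] using B p0 by simp
        moreover have "x = u * (p0 * v)" using B x' by simp
        ultimately show ?thesis using B by blast
      next
        case False
        have "primes_in {p'\<in>Qs. p0 \<le> p'} (p0 * v)"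
        proof -
          have "p0 \<le> p'" if "prime p'" "p' dvd p0 * v" for p'
          proof (rule least[OF that(1)])
            show "p' dvd x" using that B x' by (metis dvd_mult2 mult.assoc mult.commute)
            show "p' \<in> Qs" using that B p0 by (auto simp: prime_dvd_mult_iff primes_in_def dest: primes_dvd_imp_eq)
          qed
          moreover have "primes_in Qs (p0 * v)" unfolding primes_in_mult primes_in_prime[OF p0(1)] using B p0 by simp
          ultimately show ?thesis unfolding primes_in_def by blast
        qed
        moreover have "real (p0 * v) \<le> L * real p0" using B(4) prime_gt_0_nat[OF p0(1)] by (simp add: mult.commute)
        ultimately have "p0 * v \<in> block Qs L p0" using False by (simp add: block_def)
        moreover have "primes_in (low_primes Ps Qs p0) u"
          using B(2) by (rule primes_in_mono) (auto simp: low_primes_def)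
        moreover have "x = (p0 * v) * u" using B x' by simp
        ultimately show ?thesis using p0 by blast
      qed
    qed
  qed
qed

lemma mult_prime_dvdI:
  fixes l1 l2 p :: nat
  assumes "l1 > 0" "l2 > 0" "prime p" "multiplicity p l1 < multiplicity p l2"
    "\<And>r. prime r \<Longrightarrow> r \<noteq> p \<Longrightarrow> multiplicity r l1 \<le> multiplicity r l2"
  shows "l1 * p dvd l2"
proof (rule multiplicity_le_imp_dvd)
  fix r :: nat assume r: "prime r"
  have "multiplicity r (l1 * p) = multiplicity r l1 + multiplicity r p"
    using assms r by (intro prime_elem_multiplicity_mult_distrib) (auto simp: prime_gt_0_nat)
  also have "multiplicity r p = (if r = p then 1 else 0)"
    using assms r by (simp add: prime_multiplicity_other)
  finally show "multiplicity r (l1 * p) \<le> multiplicity r l2"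
    using assms(4) assms(5)[OF r] by auto
qed (use assms prime_gt_0_nat in auto)

lemma multiplicity_eq_0_primes_in:
  "primes_in Ps n \<Longrightarrow> prime r \<Longrightarrow> r \<notin> Ps \<Longrightarrow> multiplicity r n = 0"
  unfolding primes_in_def by (meson not_dvd_imp_multiplicity_0)

text \<open>If p2 < p1, every prime power of l1 occurs in l2, because y2 has no prime of
  \<open>Qs\<close> above p2; moreover p2 divides l2 but not l1. So l1 p2 divides l2, although l2 <=
  L p2 < l1 p2. If p1 = p2, then l1 and l2 can differ only in the power of this prime, and an excess
  leads to the same contradiction.\<close>

lemma factorization_unique:
  fixes l1 l2 :: nat
  assumes "prime p1" "p1 \<in> Qs" "l1 \<in> block Qs L p1" "primes_in (low_primes Ps Qs p1) y1"
    and "prime p2" "p2 \<in> Qs" "l2 \<in> block Qs L p2" "primes_in (low_primes Ps Qs p2) y2"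
    and "l1 * y1 = l2 * y2" and le: "p2 \<le> p1"
  shows "p1 = p2 \<and> l1 = l2"
proof -
  have l: "l1 > 0" "l2 > 0" "y1 > 0" "y2 > 0"
    using assms unfolding block_def primes_in_def by auto
  have md: "multiplicity r l1 + multiplicity r y1 = multiplicity r l2 + multiplicity r y2" if "prime r" for r :: nat
  proof -
    have "multiplicity r (a * b) = multiplicity r a + multiplicity r b" if "a > 0" "b > 0" for a b
      using \<open>prime r\<close> that by (intro prime_elem_multiplicity_mult_distrib) auto
    from this[OF l(1,3)] this[OF l(2,4)] show ?thesis using assms(9) by simp
  qed
  have l1z: "multiplicity r l1 = 0" if "prime r" "r \<notin> Qs \<or> r < p1" for r
  proof (rule multiplicity_eq_0_primes_in[OF _ that(1)])
    show "primes_in {p'\<in>Qs. p1 \<le> p'} l1" using assms(3) by (simp add: block_def)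
  qed (use that(2) in auto)
  have l2z: "multiplicity r l2 = 0" if "prime r" "r \<notin> Qs \<or> r < p2" for r
  proof (rule multiplicity_eq_0_primes_in[OF _ that(1)])
    show "primes_in {p'\<in>Qs. p2 \<le> p'} l2" using assms(7) by (simp add: block_def)
  qed (use that(2) in auto)
  have y1z: "multiplicity r y1 = 0" if "prime r" "r \<in> Qs" "p1 < r" for r
    by (rule multiplicity_eq_0_primes_in[OF assms(4) that(1)]) (use that in \<open>auto simp: low_primes_def\<close>)
  have y2z: "multiplicity r y2 = 0" if "prime r" "r \<in> Qs" "p2 < r" for r
    by (rule multiplicity_eq_0_primes_in[OF assms(8) that(1)]) (use that in \<open>auto simp: low_primes_def\<close>)
  \<comment> \<open>The size window of the blocks: l > L and l' <= L p leave no room for l p to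
    divide l'.\<close>
  have nd: "\<not> (l * p dvd l')" if "l \<in> block Qs L q" "l' \<in> block Qs L p" "prime p" for l l' p q :: nat
  proof
    assume "l * p dvd l'"
    moreover have "l' > 0" using that unfolding block_def primes_in_def by auto
    ultimately have "l * p \<le> l'" by (rule dvd_imp_le)
    then have "real (l * p) \<le> real l'" by (simp only: of_nat_le_iff)
    also have "\<dots> \<le> L * real p" using that by (simp add: block_def)
    finally have "real l \<le> L" using prime_gt_0_nat[OF that(3)] by simp
    then show False using that by (simp add: block_def)
  qed
  show ?thesis
  proof (cases "p1 = p2")
    case False
    then have lt: "p2 < p1" using le by simp
    have "l1 * p2 dvd l2"
    proof (rule mult_prime_dvdI)
      have "multiplicity p2 l1 = 0" using l1z assms(5) lt by simp
      moreover have "multiplicity p2 l2 > 0"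
        using assms(5,7) l by (intro prime_multiplicity_gt_zero_iff[THEN iffD2]) (auto simp: block_def)
      ultimately show "multiplicity p2 l1 < multiplicity p2 l2" by simp
      fix r :: nat assume r: "prime r" 
      show "multiplicity r l1 \<le> multiplicity r l2"
      proof (cases "r \<in> Qs \<and> p1 \<le> r")
        case True
        then have "multiplicity r y2 = 0" using y2z[OF r] lt by linarith
        then show ?thesis using md[OF r] by linarith
      next
        case False
        then have "multiplicity r l1 = 0" using l1z[OF r] by linarith
        then show ?thesis by simp
      qed
    qed (use l assms in auto)
    then show ?thesis using nd assms by blast
  next
    case True
    have eq: "multiplicity r l1 = multiplicity r l2" if "prime r" "r \<noteq> p1" for r :: nat
    proof (cases "r \<in> Qs \<and> p1 < r")
      case r: True
      then have "multiplicity r y1 = 0" "multiplicity r y2 = 0"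
        using y1z[OF that(1)] y2z[OF that(1)] True by auto
      then show ?thesis using md[OF that(1)] by linarith
    next
      case False
      then have "r \<notin> Qs \<or> r < p1" using that(2) by linarith
      then have "multiplicity r l1 = 0" "multiplicity r l2 = 0"
        using l1z[OF that(1)] l2z[OF that(1)] True by auto
      then show ?thesis by simp
    qed
    have "\<not> multiplicity p1 l1 < multiplicity p1 l2"
    proof
      assume "multiplicity p1 l1 < multiplicity p1 l2"
      then have "l1 * p1 dvd l2" by (rule mult_prime_dvdI[OF l(1,2) assms(1)]) (simp add: eq)
      then show False using nd[OF assms(3) assms(7) assms(5)] True by simp
    qed
    moreover have "\<not> multiplicity p1 l2 < multiplicity p1 l1"
    proof
      assume "multiplicity p1 l2 < multiplicity p1 l1"
      then have "l2 * p1 dvd l1" by (rule mult_prime_dvdI[OF l(2,1) assms(1)]) (simp add: eq)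
      then show False using nd[OF assms(7) assms(3) assms(1)] by simp
    qed
    ultimately have "multiplicity r l1 = multiplicity r l2" if "prime r" for r :: nat
      using eq[OF that] by (cases "r = p1") auto
    then have "l1 = l2" by (rule multiplicity_eq_nat[OF l(1,2)])
    then show ?thesis using True by simp
  qed
qed

text \<open>Numbers with a block factorization correspond bijectively to the triples in
  \<open>T\<close>. The others are products u v with v <= L and u free of primes of
  \<open>Qs\<close>, and are estimated trivially; this is useful when few u exist.\<close>

lemma cmod_sum_psmooth_le:
  fixes F :: "nat \<Rightarrow> complex"
  assumes Qs: "finite Qs" "Qs \<subseteq> Ps" "\<And>p. p \<in> Qs \<Longrightarrow> prime p" and L: "L \<ge> 1"
    and F: "\<And>x. cmod (F x) \<le> 1"
  shows "cmod (\<Sum>x\<in>psmooth Ps X. F x) \<le> 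
    (\<Sum>p\<in>Qs. \<Sum>l\<in>block Qs L p. cmod (\<Sum>y\<in>psmooth (low_primes Ps Qs p) (X / real l). F (l * y)))
      + L * real (card (psmooth (Ps - Qs) X))"
proof -
  define T where "T = (SIGMA p:Qs. SIGMA l:block Qs L p. psmooth (low_primes Ps Qs p) (X / real l))"
  define h where "h = (\<lambda>(p::nat, l::nat, y::nat). l * y)"
  have inj: "inj_on h T"
  proof (rule inj_onI)
    fix a b assume ab: "a \<in> T" "b \<in> T" "h a = h b"
    obtain p1 l1 y1 p2 l2 y2 where e: "a = (p1, l1, y1)" "b = (p2, l2, y2)" by (metis prod_cases3)
    have m1: "prime p1" "p1 \<in> Qs" "l1 \<in> block Qs L p1" "primes_in (low_primes Ps Qs p1) y1"
      using ab Qs unfolding e T_def psmooth_def by auto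
    have m2: "prime p2" "p2 \<in> Qs" "l2 \<in> block Qs L p2" "primes_in (low_primes Ps Qs p2) y2"
      using ab Qs unfolding e T_def psmooth_def by auto
    have eq: "l1 * y1 = l2 * y2" using ab unfolding e h_def by simp
    have "p1 = p2 \<and> l1 = l2"
    proof (cases "p2 \<le> p1")
      case True then show ?thesis using factorization_unique[OF m1 m2 eq] by blast
    next
      case False then show ?thesis using factorization_unique[OF m2 m1 eq[symmetric]] by auto
    qed
    moreover have "l1 > 0" using m1 unfolding block_def primes_in_def by auto
    ultimately show "a = b" using eq unfolding e by auto
  qed
  have hT: "h ` T \<subseteq> psmooth Ps X"
  proof
    fix x assume "x \<in> h ` T"
    then obtain p l y where "p \<in> Qs" "l \<in> block Qs L p" "primes_in (low_primes Ps Qs p) y" "real y \<le> X / real l" "x = l * y"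
      unfolding T_def h_def psmooth_def by auto
    moreover have "real l > 0" using calculation unfolding block_def primes_in_def by auto
    ultimately show "x \<in> psmooth Ps X"
      using Qs(2) unfolding psmooth_def block_def
      by (auto simp: primes_in_mult field_simps low_primes_def elim!: primes_in_mono)
  qed
  have finT: "finite T" unfolding T_def using Qs by auto
  define E where "E = psmooth Ps X - h ` T"
  have "E \<subseteq> (\<lambda>(u, v). u * v) ` (psmooth (Ps - Qs) X \<times> {1..nat \<lfloor>L\<rfloor>})"
  proof
    fix x assume x: "x \<in> E"
    then have px: "primes_in Ps x" "real x \<le> X" unfolding E_def psmooth_def by auto
    from factorization_exists[OF px(1) Qs(2) L]
    consider (A) p l y where "p \<in> Qs" "l \<in> block Qs L p" "primes_in (low_primes Ps Qs p) y" "x = l * y"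
      | (B) u v where "x = u * v" "primes_in (Ps - Qs) u" "primes_in Qs v" "real v \<le> L" by blast
    then show "x \<in> (\<lambda>(u, v). u * v) ` (psmooth (Ps - Qs) X \<times> {1..nat \<lfloor>L\<rfloor>})"
    proof cases
      case A
      have "real l > 0" using A unfolding block_def primes_in_def by auto
      then have "(p, l, y) \<in> T" using A px unfolding T_def psmooth_def by (auto simp: field_simps)
      then have "x \<in> h ` T" using A(4) by (intro image_eqI[of _ _ "(p, l, y)"]) (simp_all add: h_def)
      then show ?thesis using x unfolding E_def by simp
    next
      case B
      have "v \<ge> 1" using B(3) by (simp add: primes_in_def)
      then have "u \<le> x" using B(1) by simp
      then have "real u \<le> X" using px(2) by simp
      then have "u \<in> psmooth (Ps - Qs) X" using B unfolding psmooth_def by auto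
      moreover have "v \<in> {1..nat \<lfloor>L\<rfloor>}" using \<open>v \<ge> 1\<close> B(4) by (simp add: le_nat_floor)
      ultimately show ?thesis using B(1) by (intro image_eqI[of _ _ "(u, v)"]) simp_all
    qed
  qed
  then have "card E \<le> card (psmooth (Ps - Qs) X \<times> {1..nat \<lfloor>L\<rfloor>})"
    by (rule surj_card_le[rotated]) simp
  then have "real (card E) \<le> real (card (psmooth (Ps - Qs) X)) * real (nat \<lfloor>L\<rfloor>)"
    by (simp add: card_cartesian_product flip: of_nat_mult)
  also have "\<dots> \<le> real (card (psmooth (Ps - Qs) X)) * L"
    using L by (intro mult_left_mono of_nat_floor) auto
  finally have cE: "real (card E) \<le> L * real (card (psmooth (Ps - Qs) X))" by (simp add: mult.commute)
  have "(\<Sum>x\<in>psmooth Ps X. F x) = (\<Sum>x\<in>h ` T. F x) + (\<Sum>x\<in>E. F x)"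
    unfolding E_def using hT by (subst sum.subset_diff[of "h ` T"]) (auto simp: add.commute)
  also have "(\<Sum>x\<in>h ` T. F x) = (\<Sum>p\<in>Qs. \<Sum>l\<in>block Qs L p. \<Sum>y\<in>psmooth (low_primes Ps Qs p) (X / real l). F (l * y))"
  proof -
    have "(\<Sum>p\<in>Qs. \<Sum>l\<in>block Qs L p. \<Sum>y\<in>psmooth (low_primes Ps Qs p) (X / real l). F (l * y))
      = (\<Sum>p\<in>Qs. \<Sum>(l, y)\<in>(SIGMA l:block Qs L p. psmooth (low_primes Ps Qs p) (X / real l)). F (l * y))"
      by (intro sum.cong refl sum.Sigma) auto
    also have "\<dots> = (\<Sum>(p, l, y)\<in>T. F (l * y))"
      unfolding T_def using Qs(1) by (intro sum.Sigma) auto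
    also have "\<dots> = (\<Sum>a\<in>T. F (h a))" by (intro sum.cong refl) (auto simp: h_def)
    finally show ?thesis unfolding sum.reindex[OF inj] o_def by simp
  qed
  finally have "cmod (\<Sum>x\<in>psmooth Ps X. F x) \<le> 
     cmod (\<Sum>p\<in>Qs. \<Sum>l\<in>block Qs L p. \<Sum>y\<in>psmooth (low_primes Ps Qs p) (X / real l). F (l * y)) + cmod (\<Sum>x\<in>E. F x)"
    by (simp add: norm_triangle_ineq)
  also have "cmod (\<Sum>x\<in>E. F x) \<le> real (card E)"
    using sum_norm_le[of E F "\<lambda>_. 1"] F by simp
  also have "cmod (\<Sum>p\<in>Qs. \<Sum>l\<in>block Qs L p. \<Sum>y\<in>psmooth (low_primes Ps Qs p) (X / real l). F (l * y))
     \<le> (\<Sum>p\<in>Qs. \<Sum>l\<in>block Qs L p. cmod (\<Sum>y\<in>psmooth (low_primes Ps Qs p) (X / real l). F (l * y)))"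
    by (intro sum_norm_le) auto
  finally show ?thesis using cE by linarith
qed

section \<open>Coprime splittings, Rankin's method and the divisor bound\<close>

lemma primes_in_union_split:
  assumes "primes_in (A \<union> B) x" obtains h z where "x = h * z" "primes_in A h" "primes_in B z"
  using assms
proof (induction x arbitrary: thesis rule: less_induct)
  case (less x)
  show ?case
  proof (cases "x = 1")
    case True
    then show ?thesis by (intro less.prems(1)[of 1 1]) (auto simp: primes_in_def)
  next
    case False
    then obtain p where p: "prime p" "p dvd x" using prime_factor_nat by blast
    then obtain x' where x': "x = p * x'" by blast
    have "x \<ge> 1" using less.prems by (simp add: primes_in_def)
    then have "x' > 0" using x' by (cases x') auto
    then have "1 * x' < p * x'" using prime_gt_1_nat[OF p(1)] by (intro mult_strict_right_mono) auto
    then have "x' < x" using x' by simp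
    moreover have pr: "p \<in> A \<union> B" "primes_in (A \<union> B) x'"
      using less.prems(2) p(1) unfolding x' primes_in_mult primes_in_prime[OF p(1)] by auto
    ultimately obtain h z where hz: "x' = h * z" "primes_in A h" "primes_in B z"
      using less.IH[of x'] by blast
    show ?thesis
    proof (cases "p \<in> A")
      case True
      then show ?thesis using hz x' p(1)
        by (intro less.prems(1)[of "p * h" z]) (auto simp: primes_in_mult primes_in_prime)
    next
      case False
      then show ?thesis using hz x' p(1) pr(1)
        by (intro less.prems(1)[of h "p * z"]) (auto simp: primes_in_mult primes_in_prime)
    qed
  qed
qed

lemma primes_in_coprime:
  assumes "primes_in A h" "primes_in B z" "A \<inter> B = {}" shows "coprime h z"
proof (rule ccontr)
  assume "\<not> coprime h z"
  then obtain p where "prime p" "p dvd h" "p dvd z"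
    using prime_factor_nat[of "gcd h z"] by (auto simp: coprime_iff_gcd_eq_1)
  then show False using assms unfolding primes_in_def by auto
qed

text \<open>As A and B are disjoint, h is coprime to the z of any other factorization, so the two h
  divide each other and the factorization is unique.\<close>

lemma sum_psmooth_union:
  fixes F :: "nat \<Rightarrow> 'a::comm_monoid_add"
  assumes "A \<inter> B = {}"
  shows "(\<Sum>x\<in>psmooth (A \<union> B) X. F x) = (\<Sum>h\<in>psmooth A X. \<Sum>z\<in>psmooth B (X / real h). F (h * z))"
proof -
  define T where "T = (SIGMA h:psmooth A X. psmooth B (X / real h))"
  define m where "m = (\<lambda>(h::nat, z::nat). h * z)"
  have inj: "inj_on m T"
  proof (rule inj_onI)
    fix a b assume ab: "a \<in> T" "b \<in> T" "m a = m b"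
    obtain h z h' z' where e: "a = (h, z)" "b = (h', z')" by (metis surj_pair)
    have p: "primes_in A h" "primes_in A h'" "primes_in B z" "primes_in B z'"
      using ab unfolding e T_def psmooth_def by auto
    have eq: "h * z = h' * z'" using ab unfolding e m_def by simp
    have "coprime h z'" "coprime h' z" using primes_in_coprime[OF _ _ assms] p by blast+
    then have "h dvd h'" "h' dvd h" using eq 
      by (metis coprime_dvd_mult_left_iff dvd_triv_left)+
    then have "h = h'" by (rule dvd_antisym)
    moreover have "h > 0" using p by (simp add: primes_in_def)
    ultimately show "a = b" using eq e by simp
  qed
  have img: "psmooth (A \<union> B) X = m ` T"
  proof (intro equalityI subsetI)
    fix x assume x: "x \<in> psmooth (A \<union> B) X"
    then obtain h z where hz: "x = h * z" "primes_in A h" "primes_in B z"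
      using primes_in_union_split unfolding psmooth_def by (metis mem_Collect_eq)
    have hz0: "h \<ge> 1" "z \<ge> 1" using hz by (auto simp: primes_in_def)
    then have "real h \<le> real x" unfolding hz by simp
    then have "h \<in> psmooth A X" using x hz unfolding psmooth_def by auto
    moreover have "z \<in> psmooth B (X / real h)" using x hz hz0 unfolding psmooth_def by (simp add: field_simps)
    ultimately show "x \<in> m ` T" using hz unfolding T_def m_def by force
  next
    fix x assume "x \<in> m ` T"
    then obtain h z where hz: "primes_in A h" "primes_in B z" "real z \<le> X / real h" "x = h * z"
      unfolding T_def m_def psmooth_def by auto
    have "h \<ge> 1" using hz by (simp add: primes_in_def)
    then have "real x \<le> X" using hz by (simp add: field_simps)
    moreover have "primes_in (A \<union> B) x" unfolding hz(4) primes_in_mult using hz by (auto elim: primes_in_mono)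
    ultimately show "x \<in> psmooth (A \<union> B) X" by (simp add: psmooth_def)
  qed
  have "(\<Sum>x\<in>psmooth (A \<union> B) X. F x) = (\<Sum>a\<in>T. F (m a))"
    unfolding img by (simp add: sum.reindex[OF inj])
  also have "\<dots> = (\<Sum>(h, z)\<in>T. F (h * z))" by (intro sum.cong refl) (auto simp: m_def)
  also have "\<dots> = (\<Sum>h\<in>psmooth A X. \<Sum>z\<in>psmooth B (X / real h). F (h * z))"
    unfolding T_def by (intro sum.Sigma[symmetric]) auto
  finally show ?thesis .
qed

lemma primes_in_singleton: assumes "prime p" "primes_in {p} n" shows "\<exists>j. n = p ^ j"
  using assms(2)
proof (induction n rule: less_induct)
  case (less n)
  show ?case
  proof (cases "n = 1")
    case True then show ?thesis by (intro exI[of _ 0]) simp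
  next
    case False
    then obtain p' where p': "prime p'" "p' dvd n" using prime_factor_nat by blast
    then have "p' = p" using less.prems by (auto simp: primes_in_def)
    then obtain x' where x': "n = p * x'" using p' by blast
    have "n \<ge> 1" using less.prems by (simp add: primes_in_def)
    then have "x' > 0" using x' by (cases x') auto
    then have "1 * x' < p * x'" using prime_gt_1_nat[OF assms(1)] by (intro mult_strict_right_mono) auto
    then have "x' < n" using x' by simp
    moreover have "primes_in {p} x'" using less.prems unfolding x' primes_in_mult by simp
    ultimately obtain j where "x' = p ^ j" using less.IH by blast
    then have "n = p ^ Suc j" using x' by simp
    then show ?thesis by blast
  qed
qed

text \<open>A truncated Euler product. Splitting off the powers h of one prime leaves a sum up to X
  / h, hence the induction over all X at once.\<close>

lemma rankin_sum:
  assumes "finite S" "\<And>p. p \<in> S \<Longrightarrow> prime p" "\<epsilon> > 0"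
  shows "(\<Sum>n\<in>psmooth S X. real n powr (- \<epsilon>)) \<le> (\<Prod>p\<in>S. 1 / (1 - real p powr (- \<epsilon>)))"
  using assms(1,2)
proof (induction S arbitrary: X rule: finite_induct)
  case empty
  have "psmooth {} X \<subseteq> {1}" unfolding psmooth_def primes_in_def using prime_factor_nat by auto
  then have "(\<Sum>n\<in>psmooth {} X. real n powr (- \<epsilon>)) \<le> (\<Sum>n\<in>{1}. real n powr (- \<epsilon>))"
    by (intro sum_mono2) auto
  then show ?case by simp
next
  case (insert p S)
  have p: "prime p" using insert by simp
  then have p2: "real p \<ge> 2" using prime_ge_2_nat by fastforce
  define t where "t = real p powr (- \<epsilon>)"
  have t: "0 < t" "t < 1" using p2 assms(3) unfolding t_def by (auto simp: powr_less_one)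
  have t1: "(\<Sum>h\<in>psmooth {p} X. real h powr (- \<epsilon>)) \<le> 1 / (1 - t)"
  proof -
    have "psmooth {p} X \<subseteq> range (\<lambda>j. p ^ j)" using primes_in_singleton[OF p] unfolding psmooth_def by auto
    then obtain K where K: "finite K" "psmooth {p} X = (\<lambda>j. p ^ j) ` K"
      using finite_subset_image[of "psmooth {p} X" "\<lambda>j. p ^ j" UNIV] by auto
    have "inj_on (\<lambda>j. p ^ j) K" using prime_gt_1_nat[OF p] by (auto simp: inj_on_def)
    then have "(\<Sum>h\<in>psmooth {p} X. real h powr (- \<epsilon>)) = (\<Sum>j\<in>K. real (p ^ j) powr (- \<epsilon>))"
      unfolding K by (simp add: sum.reindex)
    also have "\<dots> = (\<Sum>j\<in>K. t ^ j)"
    proof (intro sum.cong refl)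
      fix j
      have "real (p ^ j) powr (- \<epsilon>) = (real p powr real j) powr (- \<epsilon>)"
        using p2 by (simp add: powr_realpow)
      also have "\<dots> = (real p powr (- \<epsilon>)) powr real j" by (simp only: powr_powr mult.commute)
      also have "\<dots> = t ^ j" using t unfolding t_def by (simp only: powr_realpow)
      finally show "real (p ^ j) powr (- \<epsilon>) = t ^ j" .
    qed
    also have "\<dots> \<le> (\<Sum>j. t ^ j)"
      by (rule sum_le_suminf) (use t K in \<open>auto intro: summable_geometric\<close>)
    also have "\<dots> = 1 / (1 - t)" using t by (intro suminf_geometric) auto
    finally show ?thesis .
  qed
  have g0: "1 / (1 - real q powr (- \<epsilon>)) \<ge> 0" if "q \<in> S" for q
  proof -
    have "real q \<ge> 2" using insert.prems that prime_ge_2_nat by fastforce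
    then show ?thesis using assms(3) powr_less_one[of "real q" "-\<epsilon>"] by simp
  qed
  have "(\<Sum>n\<in>psmooth (insert p S) X. real n powr (- \<epsilon>)) = 
      (\<Sum>h\<in>psmooth {p} X. \<Sum>z\<in>psmooth S (X / real h). real (h * z) powr (- \<epsilon>))"
    using sum_psmooth_union[of "{p}" S "\<lambda>n. real n powr (- \<epsilon>)" X] insert by simp
  also have "\<dots> = (\<Sum>h\<in>psmooth {p} X. real h powr (- \<epsilon>) * (\<Sum>z\<in>psmooth S (X / real h). real z powr (- \<epsilon>)))"
    by (simp add: powr_mult sum_distrib_left)
  also have "\<dots> \<le> (\<Sum>h\<in>psmooth {p} X. real h powr (- \<epsilon>) * (\<Prod>p\<in>S. 1 / (1 - real p powr (- \<epsilon>))))"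
    using insert by (intro sum_mono mult_left_mono) auto
  also have "\<dots> = (\<Sum>h\<in>psmooth {p} X. real h powr (- \<epsilon>)) * (\<Prod>p\<in>S. 1 / (1 - real p powr (- \<epsilon>)))"
    by (simp add: sum_distrib_right)
  also have "\<dots> \<le> 1 / (1 - t) * (\<Prod>p\<in>S. 1 / (1 - real p powr (- \<epsilon>)))"
    using t1 g0 by (intro mult_right_mono prod_nonneg) auto
  finally show ?case using insert by (simp add: t_def)
qed

text \<open>Once p >= 2^(1/\<epsilon>), the factor is at most 2 <= p^\<epsilon>. The boundedly many
  smaller primes cost at most the factor at 2 each, which makes up the constant.\<close>

lemma prod_euler_factor_bound:
  assumes "\<epsilon> > 0"
  obtains C where "C > 0" "\<And>S. finite S \<Longrightarrow> (\<And>p. p \<in> S \<Longrightarrow> prime p) \<Longrightarrow>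
     (\<Prod>p\<in>S. 1 / (1 - real p powr (- \<epsilon>))) \<le> C * real (\<Prod>S) powr \<epsilon>"
proof -
  define c where "c = 1 / (1 - 2 powr (- \<epsilon>))"
  define n0 where "n0 = nat \<lceil>2 powr (1 / \<epsilon>)\<rceil>"
  have lt1: "2 powr (- \<epsilon>) < (1::real)" using assms by (simp add: powr_less_one)
  have c1: "c \<ge> 1" using lt1 unfolding c_def by (simp add: field_simps)
  have g: "1 / (1 - real p powr (- \<epsilon>)) \<le> (if p \<le> n0 then c else 1) * real p powr \<epsilon> \<and> 1 / (1 - real p powr (- \<epsilon>)) \<ge> 0"
    if "prime p" for p
  proof -
    have p2: "real p \<ge> 2" using prime_ge_2_nat[OF that] by simp
    have le: "real p powr (- \<epsilon>) \<le> 2 powr (- \<epsilon>)" using p2 assms by (intro powr_mono2') auto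
    have pe1: "real p powr \<epsilon> \<ge> 1" using p2 assms by (intro ge_one_powr_ge_zero) auto
    show ?thesis
    proof (cases "p \<le> n0")
      case True
      have "1 / (1 - real p powr (- \<epsilon>)) \<le> c" unfolding c_def using le lt1 by (intro divide_left_mono) auto
      also have "\<dots> \<le> c * real p powr \<epsilon>" using c1 pe1 by simp
      finally show ?thesis using True le lt1 by simp
    next
      case False
      then have "2 powr (1 / \<epsilon>) \<le> real p" unfolding n0_def by linarith
      then have "(2 powr (1 / \<epsilon>)) powr \<epsilon> \<le> real p powr \<epsilon>" using assms by (intro powr_mono2) auto
      then have "real p powr \<epsilon> \<ge> 2" using assms by (simp add: powr_powr)
      moreover have "real p powr (- \<epsilon>) = 1 / real p powr \<epsilon>" by (simp add: powr_minus_divide)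
      ultimately have "real p powr (- \<epsilon>) \<le> 1 / 2" using frac_le[of 1 1 2 "real p powr \<epsilon>"] by simp
      then have "1 / (1 - real p powr (- \<epsilon>)) \<le> 2" by (simp add: field_simps)
      then show ?thesis using False \<open>real p powr \<epsilon> \<ge> 2\<close> \<open>real p powr (- \<epsilon>) \<le> 1 / 2\<close> by simp
    qed
  qed
  show ?thesis
  proof (rule that[of "c ^ n0"])
    show "c ^ n0 > 0" using c1 by simp
    fix S :: "nat set" assume S: "finite S" "\<And>p. p \<in> S \<Longrightarrow> prime p"
    have "(\<Prod>p\<in>S. 1 / (1 - real p powr (- \<epsilon>))) \<le> (\<Prod>p\<in>S. (if p \<le> n0 then c else 1) * real p powr \<epsilon>)"
      using g S by (intro prod_mono) auto
    also have "\<dots> = (\<Prod>p\<in>S. if p \<le> n0 then c else 1) * (\<Prod>p\<in>S. real p powr \<epsilon>)"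
      by (rule prod.distrib)
    also have "(\<Prod>p\<in>S. real p powr \<epsilon>) = real (\<Prod>S) powr \<epsilon>"
      by (simp add: prod_powr_distrib)
    also have "(\<Prod>p\<in>S. if p \<le> n0 then c else 1) = c ^ card {p\<in>S. p \<le> n0}"
      using S(1) by (simp add: prod.inter_filter[symmetric])
    also have "c ^ card {p\<in>S. p \<le> n0} \<le> c ^ n0"
    proof (rule power_increasing)
      have "{p\<in>S. p \<le> n0} \<subseteq> {1..n0}" using S(2) prime_ge_1_nat by force
      then show "card {p\<in>S. p \<le> n0} \<le> n0" using card_mono[of "{1..n0}"] by fastforce
    qed (use c1 in auto)
    finally show "(\<Prod>p\<in>S. 1 / (1 - real p powr (- \<epsilon>))) \<le> c ^ n0 * real (\<Prod>S) powr \<epsilon>"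
      by (simp add: mult_right_mono)
  qed
qed

lemma prod_prime_factors_le:
  fixes q :: nat assumes "q \<ge> 1" shows "\<Prod>(prime_factors q) \<le> q"
proof -
  have "(\<Prod>p\<in>prime_factors q. p) \<le> (\<Prod>p\<in>prime_factors q. p ^ multiplicity p q)"
  proof (intro prod_mono conjI)
    fix p assume "p \<in> prime_factors q"
    then have "multiplicity p q \<ge> 1" "p \<ge> 1"
      using prime_factors_multiplicity[of q] prime_ge_1_nat by (auto simp: in_prime_factors_iff)
    then show "p \<le> p ^ multiplicity p q" by (metis power_increasing power_one_right)
  qed auto
  also have "\<dots> = q" using assms by (intro prime_factorization_nat[symmetric]) auto
  finally show ?thesis .
qed

text \<open>Rankin's trick: each n <= X is counted with the weight (X / n)^\<epsilon> >= 1. The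
  resulting Euler product runs over the primes of q, whose product is at most q.\<close>

lemma card_psmooth_dvd_bound:
  assumes "\<epsilon> > 0"
  obtains C where "C > 0" "\<And>q X. q \<ge> 1 \<Longrightarrow> X \<ge> 1 \<Longrightarrow>
     real (card (psmooth {p. p dvd q} X)) \<le> C * X powr \<epsilon> * real q powr \<epsilon>"
proof -
  obtain C where C: "C > 0" "\<And>S. finite S \<Longrightarrow> (\<And>p. p \<in> S \<Longrightarrow> prime p) \<Longrightarrow>
     (\<Prod>p\<in>S. 1 / (1 - real p powr (- \<epsilon>))) \<le> C * real (\<Prod>S) powr \<epsilon>"
    using prod_euler_factor_bound[OF assms] by blast
  show ?thesis
  proof (rule that[OF C(1)])
    fix q :: nat and X :: real assume q: "q \<ge> 1" and X: "X \<ge> 1"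
    define S where "S = prime_factors q"
    have eq: "psmooth {p. p dvd q} X = psmooth S X"
      unfolding psmooth_def primes_in_def S_def using q by (auto simp: in_prime_factors_iff)
    have "real (card (psmooth S X)) = (\<Sum>n\<in>psmooth S X. 1)" by simp
    also have "\<dots> \<le> (\<Sum>n\<in>psmooth S X. X powr \<epsilon> * real n powr (- \<epsilon>))"
    proof (rule sum_mono)
      fix n assume "n \<in> psmooth S X"
      then have n: "1 \<le> n" "real n \<le> X" by (auto simp: psmooth_def primes_in_def)
      then have "real n powr \<epsilon> * real n powr (- \<epsilon>) \<le> X powr \<epsilon> * real n powr (- \<epsilon>)"
        using assms by (intro mult_right_mono powr_mono2) auto
      then show "1 \<le> X powr \<epsilon> * real n powr (- \<epsilon>)" using n by (simp add: powr_add[symmetric])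
    qed
    also have "\<dots> = X powr \<epsilon> * (\<Sum>n\<in>psmooth S X. real n powr (- \<epsilon>))" by (simp add: sum_distrib_left)
    also have "\<dots> \<le> X powr \<epsilon> * (C * real (\<Prod>S) powr \<epsilon>)"
      using assms by (intro mult_left_mono order_trans[OF rankin_sum C(2)]) (auto simp: S_def)
    also have "\<dots> \<le> X powr \<epsilon> * (C * real q powr \<epsilon>)"
      using prod_prime_factors_le[OF q] C(1) assms unfolding S_def
      by (intro mult_left_mono powr_mono2) (auto simp del: of_nat_prod intro!: prod_nonneg)
    finally show "real (card (psmooth {p. p dvd q} X)) \<le> C * X powr \<epsilon> * real q powr \<epsilon>"
      unfolding eq by (simp add: mult_ac)
  qed
qed

text \<open>A divisor of n is a number up to n composed of primes of n; the two occurrences of n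
  take half of \<epsilon> each.\<close>

lemma divisor_bound:
  assumes "\<epsilon> > 0"
  obtains C where "C > 0" "\<And>n::nat. n \<ge> 1 \<Longrightarrow> real (card {d. d dvd n}) \<le> C * real n powr \<epsilon>"
proof -
  obtain C where C: "C > 0" "\<And>q X. q \<ge> 1 \<Longrightarrow> X \<ge> 1 \<Longrightarrow>
     real (card (psmooth {p. p dvd q} X)) \<le> C * X powr (\<epsilon> / 2) * real q powr (\<epsilon> / 2)"
    using card_psmooth_dvd_bound[of "\<epsilon> / 2"] assms by auto
  show ?thesis
  proof (rule that[OF C(1)])
    fix n :: nat assume n: "n \<ge> 1"
    have "{d. d dvd n} \<subseteq> psmooth {p. p dvd n} (real n)"
    proof
      fix d assume "d \<in> {d. d dvd n}"
      then have d: "d dvd n" by simp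
      then have "d \<le> n" "d \<ge> 1" using n by (auto dest: dvd_imp_le intro: Suc_leI dvd_pos_nat)
      moreover have "p dvd n" if "p dvd d" for p using that d by (rule dvd_trans)
      ultimately show "d \<in> psmooth {p. p dvd n} (real n)" unfolding psmooth_def primes_in_def by simp
    qed
    then have "real (card {d. d dvd n}) \<le> real (card (psmooth {p. p dvd n} (real n)))"
      by (simp add: card_mono)
    also have "\<dots> \<le> C * real n powr (\<epsilon> / 2) * real n powr (\<epsilon> / 2)" using C(2)[of n "real n"] n by simp
    also have "\<dots> = C * real n powr \<epsilon>" by (simp add: mult.assoc powr_add[symmetric])
    finally show "real (card {d. d dvd n}) \<le> C * real n powr \<epsilon>" .
  qed
qed

section \<open>Mean values and admissible exponents\<close>

text \<open>The substitution \<alpha> = (\<theta> + j) / m on each of the m subintervals; \<theta> +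
  j runs through the preimages of \<theta> under multiplication by m modulo one.\<close>

lemma integral_split_residues:
  fixes f :: "real \<Rightarrow> real" and m :: nat
  assumes f: "f integrable_on {0..1}" and m: "m \<ge> 1"
  shows "\<And>j. j < m \<Longrightarrow> (\<lambda>\<theta>. f ((\<theta> + real j) / real m)) integrable_on {0..1}"
    and "integral {0..1} f = (\<Sum>j<m. integral {0..1} (\<lambda>\<theta>. f ((\<theta> + real j) / real m))) / real m"
proof -
  have sub: "f integrable_on {real j / real m..real (Suc j) / real m}" if "j < m" for j
    using that m by (intro integrable_subinterval_real[OF f]) (auto simp: divide_simps)
  have aff: "((\<lambda>\<theta>. f ((\<theta> + real j) / real m)) has_integral 
      real m * integral {real j / real m..real (Suc j) / real m} f) {0..1}" if j: "j < m" for j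
  proof -
    have "(f has_integral integral {real j / real m..real (Suc j) / real m} f) (cbox (real j / real m) (real (Suc j) / real m))"
      using sub[OF j] by (simp add: integrable_integral)
    from has_integral_affinity'[OF this, of "1 / real m" "real j / real m"] m
    have "((\<lambda>x. f (x / real m + real j / real m)) has_integral real m * integral {real j / real m..real (Suc j) / real m} f)
       {0..(real (Suc j) / real m - real j / real m) * real m}"
      by (simp add: field_simps)
    moreover have "(real (Suc j) / real m - real j / real m) * real m = 1"
      using m by (simp add: field_simps)
    ultimately show ?thesis by (simp add: add_divide_distrib)
  qed
  then show "\<And>j. j < m \<Longrightarrow> (\<lambda>\<theta>. f ((\<theta> + real j) / real m)) integrable_on {0..1}" by blast
  have "(\<Sum>j<n. integral {real j / real m..real (Suc j) / real m} f) = integral {0..real n / real m} f" if "n \<le> m" for n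
    using that
  proof (induction n)
    case (Suc n)
    have "integral {0..real n / real m} f + integral {real n / real m..real (Suc n) / real m} f 
        = integral {0..real (Suc n) / real m} f"
    proof (rule Henstock_Kurzweil_Integration.integral_combine)
      show "f integrable_on {0..real (Suc n) / real m}"
        using Suc.prems m by (intro integrable_subinterval_real[OF f]) (auto simp: divide_simps)
    qed (use m in \<open>auto simp: divide_simps\<close>)
    then show ?case using Suc by simp
  qed simp
  from this[of m] have "integral {0..1} f = (\<Sum>j<m. integral {real j / real m..real (Suc j) / real m} f)"
    using m by simp
  also have "\<dots> = (\<Sum>j<m. integral {0..1} (\<lambda>\<theta>. f ((\<theta> + real j) / real m)) / real m)"
  proof (intro sum.cong refl)
    fix j assume "j \<in> {..<m}"
    then have "integral {0..1} (\<lambda>\<theta>. f ((\<theta> + real j) / real m)) = 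
        real m * integral {real j / real m..real (Suc j) / real m} f"
      using aff[of j] by (intro integral_unique) simp
    then show "integral {real j / real m..real (Suc j) / real m} f =
        integral {0..1} (\<lambda>\<theta>. f ((\<theta> + real j) / real m)) / real m"
      using m by simp
  qed
  finally show "integral {0..1} f = (\<Sum>j<m. integral {0..1} (\<lambda>\<theta>. f ((\<theta> + real j) / real m))) / real m"
    by (simp add: sum_divide_distrib)
qed

lemma continuous_integrable_on_subset:
  fixes g :: "real \<Rightarrow> real"
  assumes "continuous_on {0..1} g" "S \<in> sets lebesgue" "S \<subseteq> {0..1}"
  shows "g integrable_on S"
proof -
  have "g absolutely_integrable_on {0..1}"
    using assms(1) by (rule absolutely_integrable_continuous_real)
  then have "g absolutely_integrable_on S" by (rule set_integrable_subset[OF _ assms(2,3)])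
  then show ?thesis by (rule set_lebesgue_integral_eq_integral(1))
qed

lemma integral_dilate:
  fixes G :: "real \<Rightarrow> real" and m :: nat
  assumes G: "continuous_on UNIV G" and per: "\<And>x j. G (x + real j) = G x" and m: "m \<ge> 1"
  shows "integral {0..1} (\<lambda>\<alpha>. G (real m * \<alpha>)) = integral {0..1} G"
proof -
  have "(\<lambda>\<alpha>. G (real m * \<alpha>)) integrable_on {0..1}"
    by (intro integrable_continuous_real continuous_on_compose2[OF G] continuous_intros) auto
  from integral_split_residues(2)[OF this m] show ?thesis
    using m per by simp
qed

text \<open>By \<open>uniq\<close>, at most one of the m preimages (\<theta> + j) / m of each
  \<theta> lies in S. The integral over S therefore sees every value of G at most once and gains the
  full factor m over the integral on the unit interval.\<close>

lemma integral_dilate_le: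
  fixes G :: "real \<Rightarrow> real" and m :: nat
  assumes G: "continuous_on UNIV G" and per: "\<And>x j. G (x + real j) = G x" and m: "m \<ge> 1"
    and G0: "\<And>x. G x \<ge> 0" and S: "S \<in> sets lebesgue" "S \<subseteq> {0..1}"
    and uniq: "\<And>\<theta> i j. (\<theta> + real i) / real m \<in> S \<Longrightarrow> (\<theta> + real j) / real m \<in> S \<Longrightarrow> i < m \<Longrightarrow> j < m \<Longrightarrow> i = j"
  shows "integral S (\<lambda>\<alpha>. G (real m * \<alpha>)) \<le> integral {0..1} G / real m"
proof -
  define f where "f \<alpha> = (if \<alpha> \<in> S then G (real m * \<alpha>) else 0)" for \<alpha>
  have cont: "continuous_on {0..1} (\<lambda>\<alpha>. G (real m * \<alpha>))"
    by (intro continuous_on_compose2[OF G] continuous_intros) auto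
  have S01: "S \<inter> {0..1} = S" using S by blast
  have f: "f integrable_on {0..1}"
    unfolding f_def integrable_restrict_Int S01 by (rule continuous_integrable_on_subset[OF cont S])
  have fj: "f ((\<theta> + real j) / real m) = (if (\<theta> + real j) / real m \<in> S then G \<theta> else 0)" for \<theta> j
    using m per[of \<theta> j] unfolding f_def by simp
  have "integral S (\<lambda>\<alpha>. G (real m * \<alpha>)) = integral {0..1} f"
    unfolding f_def using Henstock_Kurzweil_Integration.integral_restrict_Int[of "{0..1}" S "\<lambda>\<alpha>. G (real m * \<alpha>)"] S01 by simp
  also have "\<dots> = (\<Sum>j<m. integral {0..1} (\<lambda>\<theta>. f ((\<theta> + real j) / real m))) / real m"
    by (rule integral_split_residues(2)[OF f m])
  also have "(\<Sum>j<m. integral {0..1} (\<lambda>\<theta>. f ((\<theta> + real j) / real m))) = 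
     integral {0..1} (\<lambda>\<theta>. \<Sum>j<m. f ((\<theta> + real j) / real m))"
    using integral_split_residues(1)[OF f m] by (intro integral_sum[symmetric]) auto
  also have "\<dots> \<le> integral {0..1} G"
  proof (rule integral_le)
    show "(\<lambda>\<theta>. \<Sum>j<m. f ((\<theta> + real j) / real m)) integrable_on {0..1}"
      using integral_split_residues(1)[OF f m] by (intro integrable_sum) auto
    show "G integrable_on {0..1}"
      by (intro integrable_continuous_real continuous_on_subset[OF G]) auto
    fix \<theta> :: real
    define J where "J = {j\<in>{..<m}. (\<theta> + real j) / real m \<in> S}"
    have "(\<Sum>j<m. f ((\<theta> + real j) / real m)) = real (card J) * G \<theta>"
      unfolding fj J_def by (simp add: sum.inter_filter[symmetric])
    also have "card J \<le> 1" unfolding J_def using uniq[of \<theta>] by (intro card_le_Suc0_iff_eq[THEN iffD2, simplified One_nat_def[symmetric]]) auto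
    then have "real (card J) * G \<theta> \<le> 1 * G \<theta>" using G0 by (intro mult_right_mono) auto
    finally show "(\<Sum>j<m. f ((\<theta> + real j) / real m)) \<le> G \<theta>" by simp
  qed
  finally show ?thesis using m by (simp add: divide_right_mono)
qed

section \<open>Moments of the smooth Weyl sum\<close>

lemma continuous_on_weyl_f [continuous_intros]:
  "continuous_on S g \<Longrightarrow> continuous_on S (\<lambda>x. weyl_f k P R (g x))"
  unfolding weyl_f_def by (intro continuous_intros)

lemma continuous_on_weyl_powr:
  assumes "continuous_on S g" "u > 0" shows "continuous_on S (\<lambda>x. cmod (weyl_f k P R (g x)) powr u)"
  using assms by (intro continuous_on_powr' continuous_intros) auto

lemma weyl_f_add_nat: "weyl_f k P R (\<alpha> + real j) = weyl_f k P R \<alpha>"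
proof -
  have "ee ((\<alpha> + real j) * real x ^ k) = ee (\<alpha> * real x ^ k)" for x
  proof -
    have "(\<alpha> + real j) * real x ^ k = \<alpha> * real x ^ k + of_int (int (j * x ^ k))" by (simp add: distrib_right)
    then show ?thesis by (simp only: ee_add_of_int)
  qed
  then show ?thesis unfolding weyl_f_def by simp
qed

lemma cmod_weyl_f_le: "P \<ge> 0 \<Longrightarrow> cmod (weyl_f k P R \<alpha>) \<le> P"
  unfolding weyl_f_def smooth_set_psmooth by (rule order_trans[OF cmod_sum_ee_le_card card_psmooth_le])

lemma U_mean_integrable:
  "u > 0 \<Longrightarrow> (\<lambda>\<alpha>. cmod (weyl_f k P R \<alpha>) powr u) integrable_on {0..1}"
  by (intro integrable_continuous_real continuous_on_weyl_powr continuous_intros)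

lemma U_mean_nonneg: "U_mean k u P R \<ge> 0"
  unfolding U_mean_def by (cases "(\<lambda>\<alpha>. cmod (weyl_f k P R \<alpha>) powr u) integrable_on {0..1}")
    (auto intro!: Henstock_Kurzweil_Integration.integral_nonneg simp: not_integrable_integral)

lemma U_mean_le_trivial:
  assumes "P \<ge> 0" "u > 0" shows "U_mean k u P R \<le> P powr u"
proof -
  have "U_mean k u P R \<le> integral {0..1} (\<lambda>_::real. P powr u)"
    unfolding U_mean_def
  proof (rule integral_le[OF U_mean_integrable])
    show "cmod (weyl_f k P R x) powr u \<le> P powr u" for x
      using assms by (intro powr_mono2 cmod_weyl_f_le) auto
  qed (use assms in auto)
  then show ?thesis by simp
qed

lemma weyl_f_poly: "weyl_f k P R \<alpha> = poly (\<Sum>x\<in>smooth_set P R. monom 1 (x ^ k)) (ee \<alpha>)"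
  unfolding weyl_f_def poly_sum_monom by (simp add: ee_power)

lemma coeff_complex_of_real_power:
  "coeff ((\<Sum>x\<in>S. monom (1::complex) (x ^ k)) ^ w) n = of_real (coeff ((\<Sum>x\<in>S. monom (1::real) (x ^ k)) ^ w) n)"
proof (induction w arbitrary: n)
  case 0 then show ?case by (cases n) auto
next
  case (Suc w)
  have "coeff (\<Sum>x\<in>S. monom (1::complex) (x ^ k)) i = of_real (coeff (\<Sum>x\<in>S. monom (1::real) (x ^ k)) i)" for i
    unfolding coeff_sum by (simp add: of_real_sum if_distrib cong: if_cong)
  then show ?case unfolding power_Suc coeff_mult by (simp add: Suc)
qed

text \<open>Parseval's identity for the w-th power of the Weyl sum: even moments are sums of squared
  representation numbers, the form in which they leave the bilinear argument.\<close>

lemma U_mean_even: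
  assumes "degree ((\<Sum>x\<in>smooth_set P R. monom (1::real) (x ^ k)) ^ w) \<le> D" "w \<ge> 1"
  shows "U_mean k (2 * real w) P R = (\<Sum>n\<le>D. (coeff ((\<Sum>x\<in>smooth_set P R. monom (1::real) (x ^ k)) ^ w) n)\<^sup>2)"
proof -
  define p where "p = (\<Sum>x\<in>smooth_set P R. monom (1::complex) (x ^ k)) ^ w"
  define q where "q = (\<Sum>x\<in>smooth_set P R. monom (1::real) (x ^ k)) ^ w"
  have pq: "coeff p n = of_real (coeff q n)" for n
    unfolding p_def q_def by (rule coeff_complex_of_real_power)
  have "degree p \<le> D"
  proof (rule degree_le, intro allI impI)
    fix i assume "D < i"
    then have "coeff q i = 0" using assms(1) unfolding q_def by (intro coeff_eq_0) auto
    then show "coeff p i = 0" by (simp add: pq)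
  qed
  from parseval_poly[OF this] have "integral {0..1} (\<lambda>\<alpha>. (cmod (poly p (ee \<alpha>)))\<^sup>2) = (\<Sum>n\<le>D. (cmod (coeff p n))\<^sup>2)"
    by (rule integral_unique)
  also have "\<dots> = (\<Sum>n\<le>D. (coeff q n)\<^sup>2)" by (simp add: pq)
  also have "(\<lambda>\<alpha>. (cmod (poly p (ee \<alpha>)))\<^sup>2) = (\<lambda>\<alpha>. cmod (weyl_f k P R \<alpha>) powr (2 * real w))"
  proof
    fix \<alpha>
    have "cmod (weyl_f k P R \<alpha>) powr (2 * real w) = cmod (weyl_f k P R \<alpha>) powr real (2 * w)" by simp
    also have "\<dots> = cmod (weyl_f k P R \<alpha>) ^ (2 * w)"
      using assms(2) by (intro powr_realpow') auto
    also have "\<dots> = (cmod (poly p (ee \<alpha>)))\<^sup>2"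
      unfolding p_def poly_power weyl_f_poly by (simp add: norm_power power_mult[symmetric] mult.commute)
    finally show "(cmod (poly p (ee \<alpha>)))\<^sup>2 = cmod (weyl_f k P R \<alpha>) powr (2 * real w)" by simp
  qed
  finally show ?thesis unfolding U_mean_def q_def .
qed

text \<open>The coefficients are nonnegative integers, hence at most their squares, and they add up
  to the number of smooth integers.\<close>

lemma U_mean_2_ge: "real (card (smooth_set P R)) \<le> U_mean k 2 P R"
proof -
  define q where "q = (\<Sum>x\<in>smooth_set P R. monom (1::real) (x ^ k))"
  have cq: "\<exists>j::nat. coeff q n = real j" for n
  proof -
    have "coeff q n = real (\<Sum>x\<in>smooth_set P R. if x ^ k = n then 1 else 0)"
      unfolding q_def coeff_sum by (simp add: of_nat_sum if_distrib cong: if_cong)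
    then show ?thesis by blast
  qed
  have "real (card (smooth_set P R)) = poly q 1" unfolding q_def poly_sum_monom by simp
  also have "\<dots> = (\<Sum>n\<le>degree q. coeff q n)" by (simp add: poly_altdef)
  also have "\<dots> \<le> (\<Sum>n\<le>degree q. (coeff q n)\<^sup>2)"
  proof (rule sum_mono)
    fix n
    obtain j where "coeff q n = real j" using cq by blast
    moreover have "j \<le> j\<^sup>2" by (simp add: power2_nat_le_imp_le power2_eq_square)
    then have "real j \<le> (real j)\<^sup>2" by (metis of_nat_le_iff of_nat_power)
    ultimately show "coeff q n \<le> (coeff q n)\<^sup>2" by simp
  qed
  also have "\<dots> = U_mean k 2 P R"
    using U_mean_even[where w = 1 and D = "degree q" and P = P and R = R and k = k] unfolding q_def by simp
  finally show ?thesis .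
qed

section \<open>A lower bound for admissible exponents\<close>

lemma bernoulli_powr:
  assumes "t \<ge> 0" "a \<ge> (1::real)" shows "1 + a * (t - 1) \<le> t powr a"
proof (cases "a = 1")
  case False
  then have a: "a > 1" using assms by simp
  define q where "q = a / (a - 1)"
  have "t * 1 \<le> t powr a / a + 1 powr q / q"
    using assms a by (intro Youngs_inequality) (auto simp: q_def field_simps)
  moreover have "1 / q = 1 - 1 / a" using a unfolding q_def by (simp add: field_simps)
  ultimately have "a * t \<le> a * (t powr a / a + (1 - 1 / a))"
    using a by (intro mult_left_mono) auto
  also have "\<dots> = t powr a + a - 1" using a by (simp add: distrib_left right_diff_distrib)
  finally show ?thesis by (simp add: algebra_simps)
qed (use assms in auto)

text \<open>Jensen's inequality between the second and the u-th moment, proved by integrating the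
  tangent line of t^(u/2) at t = c, the number of terms. The slope is positive, so a lower bound for
  the second moment suffices.\<close>

lemma U_mean_ge:
  assumes u: "u \<ge> 2" and ne: "smooth_set P R \<noteq> {}"
  shows "real (card (smooth_set P R)) powr (u / 2) \<le> U_mean k u P R"
proof -
  define c where "c = real (card (smooth_set P R))"
  have c: "c > 0" using ne unfolding c_def by (simp add: card_gt_0_iff)
  define G where "G \<alpha> = cmod (weyl_f k P R \<alpha>)" for \<alpha>
  have int2: "(\<lambda>\<alpha>. G \<alpha> powr 2) integrable_on {0..1}" unfolding G_def by (rule U_mean_integrable) simp
  have pt: "c powr (u / 2) * (1 - u / 2) + c powr (u / 2) * (u / 2) / c * G \<alpha> powr 2 \<le> G \<alpha> powr u" for \<alpha>
  proof -
    have "1 + u / 2 * (G \<alpha> powr 2 / c - 1) \<le> (G \<alpha> powr 2 / c) powr (u / 2)"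
      using c u by (intro bernoulli_powr) auto
    also have "\<dots> = G \<alpha> powr u / c powr (u / 2)"
      by (simp add: powr_divide powr_powr)
    finally have "c powr (u / 2) * (1 + u / 2 * (G \<alpha> powr 2 / c - 1)) \<le> G \<alpha> powr u"
      using c by (simp add: field_simps)
    moreover have "c powr (u / 2) * (1 + u / 2 * (G \<alpha> powr 2 / c - 1)) = 
       c powr (u / 2) * (1 - u / 2) + c powr (u / 2) * (u / 2) / c * G \<alpha> powr 2" by (simp add: algebra_simps)
    ultimately show ?thesis by simp
  qed
  have "c powr (u / 2) = c powr (u / 2) * (1 - u / 2) + c powr (u / 2) * (u / 2) / c * c"
    using c by (simp add: algebra_simps)
  also have "\<dots> \<le> c powr (u / 2) * (1 - u / 2) + c powr (u / 2) * (u / 2) / c * U_mean k 2 P R"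
    using U_mean_2_ge[of P R k] c u unfolding c_def by (intro add_left_mono mult_left_mono) auto
  also have "\<dots> = integral {0..1} (\<lambda>\<alpha>. c powr (u / 2) * (1 - u / 2) + c powr (u / 2) * (u / 2) / c * G \<alpha> powr 2)"
    using int2 unfolding U_mean_def G_def
    by (subst integral_add) (auto intro!: integrable_on_mult_right simp del: powr_numeral times_divide_eq_left)
  also have "\<dots> \<le> integral {0..1} (\<lambda>\<alpha>. G \<alpha> powr u)"
  proof (intro integral_le pt)
    show "(\<lambda>\<alpha>. c powr (u / 2) * (1 - u / 2) + c powr (u / 2) * (u / 2) / c * G \<alpha> powr 2) integrable_on {0..1}"
      by (intro integrable_add integrable_on_mult_right int2) auto
    show "(\<lambda>\<alpha>. G \<alpha> powr u) integrable_on {0..1}" unfolding G_def using u by (intro U_mean_integrable) auto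
  qed
  finally show ?thesis unfolding c_def U_mean_def G_def .
qed

text \<open>There are n^v lists of v integers up to n. Their products are n-smooth and at most n^v,
  and each value x arises from at most d(x)^v lists, which the divisor bound makes
  negligible.\<close>

lemma card_smooth_set_lower:
  fixes v :: nat
  assumes v: "v \<ge> 1" and "\<epsilon> > 0"
  obtains C where "C > 0" "\<And>n. n \<ge> 1 \<Longrightarrow> real (n ^ v) \<le> C * real (n ^ v) powr \<epsilon> * real (card (smooth_set (real (n ^ v)) (real n)))"
proof -
  obtain C where C: "C > 0" "\<And>n::nat. n \<ge> 1 \<Longrightarrow> real (card {d. d dvd n}) \<le> C * real n powr (\<epsilon> / real v)"
    using divisor_bound[of "\<epsilon> / real v"] assms by auto
  show ?thesis
  proof (rule that[of "C ^ v"])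
    show "C ^ v > 0" using C by simp
    fix n :: nat assume n: "n \<ge> 1"
    define A where "A = smooth_set (real (n ^ v)) (real n)"
    define T where "T = {xs::nat list. set xs \<subseteq> {1..n} \<and> length xs = v}"
    define Fb where "Fb x = {xs::nat list. set xs \<subseteq> {d. d dvd x} \<and> length xs = v}" for x
    have prodlist: "prod_list xs \<ge> 1 \<and> prod_list xs \<le> n ^ length xs \<and> (\<forall>p. prime p \<and> p dvd prod_list xs \<longrightarrow> p \<le> n)
        \<and> set xs \<subseteq> {d. d dvd prod_list xs}" if "set xs \<subseteq> {1..n}" for xs
      using that
    proof (induction xs)
      case (Cons x xs)
      then have x: "1 \<le> x" "x \<le> n" and IH: "prod_list xs \<ge> 1" "prod_list xs \<le> n ^ length xs"
        "\<forall>p. prime p \<and> p dvd prod_list xs \<longrightarrow> p \<le> n" "set xs \<subseteq> {d. d dvd prod_list xs}" by auto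
      have "x * prod_list xs \<le> n * n ^ length xs" using x IH by (intro mult_mono) auto
      moreover have "x * prod_list xs \<ge> 1" using x IH by (simp add: Suc_le_eq)
      moreover have "p \<le> n" if "prime p" "p dvd x * prod_list xs" for p
        using that IH(3) x dvd_imp_le[of p x] by (auto simp: prime_dvd_mult_iff)
      ultimately show ?case using IH(4) by auto
    qed (auto dest: prime_gt_1_nat)
    have sub: "T \<subseteq> (\<Union>x\<in>A. Fb x)"
    proof
      fix xs assume "xs \<in> T"
      then have xs: "set xs \<subseteq> {1..n}" "length xs = v" unfolding T_def by auto
      have "prod_list xs \<in> A" unfolding A_def smooth_set_def using prodlist[OF xs(1)] xs(2)
        by (auto simp flip: of_nat_power)
      moreover have "xs \<in> Fb (prod_list xs)" unfolding Fb_def using prodlist[OF xs(1)] xs(2) by auto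
      ultimately show "xs \<in> (\<Union>x\<in>A. Fb x)" by blast
    qed
    have finA: "finite A" unfolding A_def by simp
    have x1: "1 \<le> x" "real x \<le> real (n ^ v)" if "x \<in> A" for x using that unfolding A_def smooth_set_def by auto
    have finF: "finite (Fb x)" if "x \<in> A" for x
      unfolding Fb_def using x1(1)[OF that] by (intro finite_lists_length_eq finite_divisors_nat) auto
    have cF: "real (card (Fb x)) \<le> C ^ v * real (n ^ v) powr \<epsilon>" if "x \<in> A" for x
    proof -
      have "card (Fb x) = card {d. d dvd x} ^ v"
        unfolding Fb_def using x1(1)[OF that] by (intro card_lists_length_eq finite_divisors_nat) auto
      then have "real (card (Fb x)) = real (card {d. d dvd x}) ^ v" by simp
      also have "\<dots> \<le> (C * real (n ^ v) powr (\<epsilon> / real v)) ^ v"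
        using C x1[OF that] assms n
        by (intro power_mono order_trans[OF C(2)] mult_left_mono powr_mono2) auto
      also have "\<dots> = C ^ v * (real (n ^ v) powr (\<epsilon> / real v)) powr real v"
        using n by (simp only: power_mult_distrib) (simp add: powr_realpow)
      also have "\<dots> = C ^ v * real (n ^ v) powr \<epsilon>" using v by (simp only: powr_powr) simp
      finally show ?thesis .
    qed
    have "real (n ^ v) = real (card T)" unfolding T_def by (simp add: card_lists_length_eq)
    also have "card T \<le> card (\<Union>x\<in>A. Fb x)" using sub finA finF by (intro card_mono) auto
    also have "\<dots> \<le> (\<Sum>x\<in>A. card (Fb x))" by (rule card_UN_le[OF finA])
    finally have "real (n ^ v) \<le> (\<Sum>x\<in>A. real (card (Fb x)))" by (simp only: of_nat_sum of_nat_le_iff)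
    also have "\<dots> \<le> (\<Sum>x\<in>A. C ^ v * real (n ^ v) powr \<epsilon>)" by (intro sum_mono cF)
    finally show "real (n ^ v) \<le> C ^ v * real (n ^ v) powr \<epsilon> * real (card (smooth_set (real (n ^ v)) (real n)))"
      unfolding A_def by (simp add: mult_ac)
  qed
qed

text \<open>The moment is at least the number of smooth integers to the power u/2, and along N =
  n^v, R = n that number is N up to an arbitrarily small power. An exponent below u/2 contradicts
  this for large n.\<close>

lemma admissible_lower:
  assumes adm: "admissible_exponent k u \<Delta>" and u: "u \<ge> 2"
  shows "u / 2 \<le> u - real k + \<Delta>"
proof (rule ccontr)
  define \<kappa> where "\<kappa> = u - real k + \<Delta>"
  assume "\<not> ?thesis"
  then have lt: "\<kappa> < u / 2" unfolding \<kappa>_def by simp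
  define \<delta> where "\<delta> = u / 2 - \<kappa>"
  have \<delta>: "\<delta> > 0" using lt unfolding \<delta>_def by simp
  \<comment> \<open>Chosen so that the losses \<epsilon> u/2 in the lower bound and \<epsilon> in
    the upper bound together use up half of the gap \<delta>.\<close>
  define \<epsilon> where "\<epsilon> = \<delta> / (2 + u)"
  have \<epsilon>: "\<epsilon> > 0" using \<delta> u unfolding \<epsilon>_def by simp
  have e2: "(u / 2) * (1 - \<epsilon>) = \<kappa> + \<epsilon> + \<delta> / 2"
  proof -
    have "\<epsilon> * (2 + u) = \<delta>" using u unfolding \<epsilon>_def by simp
    then have "\<epsilon> + \<epsilon> * (u / 2) = \<delta> / 2" by (simp add: algebra_simps)
    moreover have "(u / 2) * (1 - \<epsilon>) = u / 2 - \<epsilon> * (u / 2)"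
      using right_diff_distrib[of "u / 2" 1 \<epsilon>] by (simp add: mult.commute)
    moreover have "\<kappa> = u / 2 - \<delta>" unfolding \<delta>_def by simp
    ultimately show ?thesis by linarith
  qed
  obtain \<eta> C P0 where \<eta>: "\<eta> > 0" and C: "\<And>P R. P \<ge> P0 \<Longrightarrow> 1 \<le> R \<Longrightarrow> R \<le> P powr \<eta> \<Longrightarrow>
        U_mean k u P R \<le> C * P powr (\<kappa> + \<epsilon>)"
    using adm[unfolded admissible_exponent_def, rule_format, OF \<epsilon>] unfolding \<kappa>_def by blast
  \<comment> \<open>With v >= 1 / \<eta>, the smoothness bound n = N^(1/v) is at most N^\<eta>,
    within the range of the admissible exponent.\<close>
  define v where "v = nat \<lceil>1 / \<eta>\<rceil>"
  have v\<eta>: "1 / \<eta> \<le> real v" unfolding v_def by linarith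
  then have v: "v \<ge> 1" using \<eta> by (metis divide_pos_pos less_one not_less of_nat_0 zero_less_one)
  obtain C' where C': "C' > 0" "\<And>n. n \<ge> 1 \<Longrightarrow> real (n ^ v) \<le> C' * real (n ^ v) powr \<epsilon> * real (card (smooth_set (real (n ^ v)) (real n)))"
    using card_smooth_set_lower[OF v \<epsilon>] by blast
  define K where "K = \<bar>C\<bar> * C' powr (u / 2)"
  have K0: "K \<ge> 0" unfolding K_def by simp
  obtain n :: nat where n: "real n \<ge> max 1 (max P0 ((K + 1) powr (2 / \<delta>)))"
    using real_arch_simple by blast
  then have n1: "n \<ge> 1" by simp
  define N where "N = real (n ^ v)"
  have Nn: "N \<ge> real n" unfolding N_def using n1 v self_le_power[of "real n" v] by simp
  then have N1: "N \<ge> 1" using n1 by simp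
  have "real n = N powr (1 / real v)"
    unfolding N_def using n1 v by (simp add: powr_powr flip: powr_realpow)
  also have "\<dots> \<le> N powr \<eta>"
    using N1 v\<eta> \<eta> v by (intro powr_mono) (auto simp: field_simps)
  finally have nN: "real n \<le> N powr \<eta>" .
  define A where "A = smooth_set N (real n)"
  have "N powr (1 - \<epsilon>) \<le> C' * real (card A)"
  proof -
    have "N \<le> (C' * real (card A)) * N powr \<epsilon>"
      using C'(2)[OF n1] unfolding A_def N_def by (simp add: mult_ac)
    then have "N / N powr \<epsilon> \<le> C' * real (card A)" using N1 by (simp add: pos_divide_le_eq)
    then show ?thesis using N1 by (simp add: powr_diff)
  qed
  then have "(N powr (1 - \<epsilon>)) powr (u / 2) \<le> (C' * real (card A)) powr (u / 2)"
    using u by (intro powr_mono2) auto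
  also have "\<dots> = C' powr (u / 2) * real (card A) powr (u / 2)"
    by (simp add: powr_mult)
  also have "\<dots> \<le> C' powr (u / 2) * U_mean k u N (real n)"
  proof (intro mult_left_mono)
    have "1 \<in> A" unfolding A_def smooth_set_def using N1 by (auto dest: prime_gt_1_nat)
    then show "real (card A) powr (u / 2) \<le> U_mean k u N (real n)"
      unfolding A_def using u by (intro U_mean_ge) auto
  qed simp
  also have "\<dots> \<le> C' powr (u / 2) * (C * N powr (\<kappa> + \<epsilon>))"
    using n n1 Nn nN by (intro mult_left_mono C) auto
  also have "\<dots> \<le> K * N powr (\<kappa> + \<epsilon>)"
    unfolding K_def using mult_right_mono[OF abs_ge_self[of C], of "C' powr (u / 2) * N powr (\<kappa> + \<epsilon>)"]
    by (simp add: mult_ac)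
  also have "(N powr (1 - \<epsilon>)) powr (u / 2) = N powr (\<kappa> + \<epsilon>) * N powr (\<delta> / 2)"
    using e2 by (simp only: powr_powr powr_add[symmetric] mult.commute)
  finally have "N powr (\<kappa> + \<epsilon>) * N powr (\<delta> / 2) \<le> N powr (\<kappa> + \<epsilon>) * K" by (simp add: mult.commute)
  then have "N powr (\<delta> / 2) \<le> K" using N1 by simp
  moreover have "K + 1 \<le> N powr (\<delta> / 2)"
  proof -
    have "K + 1 = ((K + 1) powr (2 / \<delta>)) powr (\<delta> / 2)" using K0 \<delta> by (simp add: powr_powr)
    also have "\<dots> \<le> N powr (\<delta> / 2)" using n Nn \<delta> by (intro powr_mono2) auto
    finally show ?thesis .
  qed
  ultimately show False by simp
qed

text \<open>For \<open>R > Y powr \<eta>\<close> the trivial bound is absorbed into a power of \<open>R\<close>, which frees later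
  estimates from any lower bound on \<open>Y\<close>.\<close>
lemma admissible_uniform:
  assumes adm: "admissible_exponent k u \<Delta>" and u: "u \<ge> 2" and \<epsilon>: "\<epsilon> > 0"
  obtains A C where "A \<ge> 0" "C > 0"
    "\<And>Y R. Y \<ge> 1 \<Longrightarrow> R \<ge> 1 \<Longrightarrow> U_mean k u Y R \<le> C * R powr A * Y powr (u - real k + \<Delta> + \<epsilon>)"
proof -
  define \<kappa> where "\<kappa> = u - real k + \<Delta>"
  \<comment> \<open>A nonnegative exponent makes Y^(\<kappa>+\<epsilon>) >= 1, so the trivial bounds
    for small Y and for large R may be multiplied by it.\<close>
  have \<kappa>: "\<kappa> \<ge> 0" using admissible_lower[OF adm u] u unfolding \<kappa>_def by simp
  obtain \<eta> C P0 where \<eta>: "\<eta> > 0" and C: "\<And>P R. P \<ge> P0 \<Longrightarrow> 1 \<le> R \<Longrightarrow> R \<le> P powr \<eta> \<Longrightarrow>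
        U_mean k u P R \<le> C * P powr (\<kappa> + \<epsilon>)"
    using adm[unfolded admissible_exponent_def, rule_format, OF \<epsilon>] unfolding \<kappa>_def by blast
  define C1 where "C1 = \<bar>C\<bar> + max 1 P0 powr u"
  have C1: "C1 \<ge> 1" "C \<le> C1" "max 1 P0 powr u \<le> C1"
    using u ge_one_powr_ge_zero[of "max 1 P0" u] unfolding C1_def by auto
  show ?thesis
  proof (rule that[of "u / \<eta>" C1])
    show "u / \<eta> \<ge> 0" "C1 > 0" using u \<eta> C1 by auto
    fix Y R :: real assume Y: "Y \<ge> 1" and R: "R \<ge> 1"
    have R1: "R powr (u / \<eta>) \<ge> 1" using R u \<eta> by (intro ge_one_powr_ge_zero) auto
    have Y1: "Y powr (\<kappa> + \<epsilon>) \<ge> 1" using Y \<kappa> \<epsilon> by (intro ge_one_powr_ge_zero) auto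
    consider "Y \<ge> P0" "R \<le> Y powr \<eta>" | "Y < P0" | "R > Y powr \<eta>" by linarith
    then have "U_mean k u Y R \<le> C1 * R powr (u / \<eta>) * Y powr (\<kappa> + \<epsilon>)"
    proof cases
      case 1
      then have "U_mean k u Y R \<le> C * Y powr (\<kappa> + \<epsilon>)" using C R by simp
      also have "\<dots> \<le> (C1 * R powr (u / \<eta>)) * Y powr (\<kappa> + \<epsilon>)"
      proof (intro mult_right_mono)
        have "C1 * 1 \<le> C1 * R powr (u / \<eta>)" using C1 R1 by (intro mult_left_mono) auto
        then show "C \<le> C1 * R powr (u / \<eta>)" using C1 by linarith
      qed simp
      finally show ?thesis .
    next
      case 2
      have "U_mean k u Y R \<le> Y powr u" using Y u by (intro U_mean_le_trivial) auto
      also have "\<dots> \<le> max 1 P0 powr u" using 2 Y u by (intro powr_mono2) auto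
      also have "\<dots> \<le> C1 * 1 * 1" using C1 by simp
      also have "\<dots> \<le> C1 * R powr (u / \<eta>) * Y powr (\<kappa> + \<epsilon>)"
        using C1 R1 Y1 by (intro mult_mono) auto
      finally show ?thesis .
    next
      case 3
      have "U_mean k u Y R \<le> Y powr u" using Y u by (intro U_mean_le_trivial) auto
      also have "\<dots> = (Y powr \<eta>) powr (u / \<eta>)" using \<eta> by (simp add: powr_powr)
      also have "\<dots> \<le> R powr (u / \<eta>)" using 3 u \<eta> by (intro powr_mono2) auto
      also have "\<dots> = 1 * R powr (u / \<eta>) * 1" by simp
      also have "\<dots> \<le> C1 * R powr (u / \<eta>) * Y powr (\<kappa> + \<epsilon>)"
        using C1 R1 Y1 by (intro mult_mono) auto
      finally show ?thesis .
    qed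
    then show "U_mean k u Y R \<le> C1 * R powr (u / \<eta>) * Y powr (u - real k + \<Delta> + \<epsilon>)"
      unfolding \<kappa>_def .
  qed
qed

text \<open>Explicit form of f << R^a X^e. The constant and both exponents are arguments, so
  products, powers and roots act on them mechanically.\<close>

definition pow_bound :: "real \<Rightarrow> real \<Rightarrow> real \<Rightarrow> real \<Rightarrow> real \<Rightarrow> real" where
  "pow_bound c a e R X = c * R powr a * X powr e"

lemma pow_bound_mult:
  assumes "f \<le> pow_bound c a e R X" "g \<le> pow_bound c' a' e' R X" "0 \<le> f" "0 \<le> g"
  shows "f * g \<le> pow_bound (c * c') (a + a') (e + e') R X"
proof -
  have "f * g \<le> pow_bound c a e R X * pow_bound c' a' e' R X" using assms by (intro mult_mono) auto
  also have "\<dots> = pow_bound (c * c') (a + a') (e + e') R X" unfolding pow_bound_def by (simp add: powr_add mult_ac)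
  finally show ?thesis .
qed

lemma powr_mult_nat: "x > 0 \<Longrightarrow> (x powr a) ^ n = x powr (a * real n)" for x :: real
  by (induction n) (simp_all add: powr_add distrib_left)

lemma pow_bound_power:
  assumes "f \<le> pow_bound c a e R X" "0 \<le> f" "R > 0" "X > 0"
  shows "f ^ n \<le> pow_bound (c ^ n) (a * real n) (e * real n) R X"
proof -
  have "f ^ n \<le> pow_bound c a e R X ^ n" using assms by (intro power_mono) auto
  also have "\<dots> = pow_bound (c ^ n) (a * real n) (e * real n) R X"
    using assms by (cases "n = 0") (simp_all add: pow_bound_def power_mult_distrib powr_mult_nat)
  finally show ?thesis .
qed

lemma pow_bound_root:
  assumes "f ^ n \<le> pow_bound c a e R X" "0 \<le> f" "n > 0"
  shows "f \<le> pow_bound (c powr (1 / real n)) (a / real n) (e / real n) R X"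
proof -
  have "f = (f ^ n) powr (1 / real n)"
    using assms by (cases "f = 0") (simp_all add: powr_powr flip: powr_realpow)
  also have "\<dots> \<le> (pow_bound c a e R X) powr (1 / real n)" using assms by (intro powr_mono2) auto
  also have "\<dots> = pow_bound (c powr (1 / real n)) (a / real n) (e / real n) R X"
    by (simp add: pow_bound_def powr_mult powr_powr)
  finally show ?thesis .
qed

lemma pow_bound_weaken:
  assumes "f \<le> pow_bound c a e R X" "c \<le> c'" "a \<le> a'" "e \<le> e'" "R \<ge> 1" "X \<ge> 1" "0 \<le> c'"
  shows "f \<le> pow_bound c' a' e' R X"
proof -
  have "pow_bound c a e R X \<le> pow_bound c' a' e' R X"
    unfolding pow_bound_def using assms by (intro mult_mono powr_mono) auto
  then show ?thesis using assms by linarith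
qed

lemma one_plus_ln_le:
  assumes "x \<ge> 1" "\<delta> > 0" shows "1 + ln x \<le> (1 + 1 / \<delta>) * x powr (\<delta>::real)"
proof -
  have "x powr \<delta> \<ge> 1" using assms by (intro ge_one_powr_ge_zero) auto
  moreover have "ln x \<le> x powr \<delta> / \<delta>" using assms by (rule ln_powr_bound)
  ultimately show ?thesis by (simp add: algebra_simps)
qed

lemma degree_kth_power_sum:
  assumes "finite S" "\<And>x. x \<in> S \<Longrightarrow> x \<le> n"
  shows "degree ((\<Sum>x\<in>S. monom (1::real) (x ^ k)) ^ w) \<le> w * n ^ k"
proof -
  have "degree (\<Sum>x\<in>S. monom (1::real) (x ^ k)) \<le> n ^ k"
  proof (rule degree_sum_le[OF assms(1)])
    fix x assume "x \<in> S"
    then have "x ^ k \<le> n ^ k" using assms by (intro power_mono) auto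
    then show "degree (monom (1::real) (x ^ k)) \<le> n ^ k" by (simp add: degree_monom_eq)
  qed
  then have "degree (\<Sum>x\<in>S. monom (1::real) (x ^ k)) * w \<le> n ^ k * w" by (rule mult_le_mono1)
  with degree_power_le have "degree ((\<Sum>x\<in>S. monom (1::real) (x ^ k)) ^ w) \<le> n ^ k * w"
    by (rule le_trans)
  then show ?thesis by (subst mult.commute)
qed

section \<open>Pointwise bounds on minor arcs\<close>

text \<open>If r agrees with X^(k/2) up to R^k, the interval of length J consists of few blocks of
  length about r / 2, and each block costs N + r up to a logarithm. The row sum is then essentially
  X^(k/2), the size of its diagonal term.\<close>

lemma bilinear_kernel_bound:
  fixes k w r :: nat and b :: int
  assumes w: "w \<ge> 1" and "\<epsilon> > 0" and k: "k \<ge> 1"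
  obtains c a where "c \<ge> 0" "a \<ge> 0"
    "\<And>X R \<theta> r b J D j1. X \<ge> 1 \<Longrightarrow> R \<ge> 1 \<Longrightarrow> r \<ge> 1 \<Longrightarrow>
       \<bar>real r * \<theta> - of_int b\<bar> \<le> 1 / real r \<Longrightarrow> coprime b (int r) \<Longrightarrow>
       X powr (real k / 2) \<le> 5 * R ^ k * real r \<Longrightarrow> real r \<le> 5 * R ^ k * X powr (real k / 2) \<Longrightarrow>
       real J \<le> real w * R ^ k * X powr (real k / 2) \<Longrightarrow> real D \<le> real w * X powr (real k / 2) \<Longrightarrow>
       (\<Sum>j2\<le>J. cmod (\<Sum>n<Suc D. ee (\<theta> * of_int (int j2 - int j1) * real n))) \<le> pow_bound c a (real k / 2 + \<epsilon>) R X"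
proof -
  \<comment> \<open>\<delta> <= 2 \<epsilon> / k turns (X^(k/2))^\<delta> into at most X^\<epsilon>;
    \<delta> <= 1 keeps the accompanying factor (5 R^k)^\<delta> below 5 R^k.\<close>
  define \<delta> where "\<delta> = min 1 (2 * \<epsilon> / real k)"
  have \<delta>: "0 < \<delta>" "\<delta> \<le> 1" "\<delta> * (real k / 2) \<le> \<epsilon>"
  proof -
    show "0 < \<delta>" "\<delta> \<le> 1" using assms unfolding \<delta>_def by auto
    have "\<delta> * (real k / 2) \<le> 2 * \<epsilon> / real k * (real k / 2)" unfolding \<delta>_def by (intro mult_right_mono) auto
    then show "\<delta> * (real k / 2) \<le> \<epsilon>" using k by simp
  qed
  define d where "d = 1 + 1 / \<delta>"
  have d1: "d \<ge> 1" using \<delta> unfolding d_def by simp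
  \<comment> \<open>c1 and c2 collect the constants of the two factors of the interval estimate.
    Each factor also produces (R^k)^2, whence the exponent 4 k of R.\<close>
  define c1 where "c1 = 11 * real w"
  define c2 where "c2 = 2 * ((real w + 1) + 50 * d)"
  show ?thesis
  proof (rule that[of "c1 * c2" "4 * real k"])
    show "0 \<le> c1 * c2" "0 \<le> 4 * real k" using d1 unfolding c1_def c2_def by auto
    fix X R \<theta> :: real and r :: nat and b :: int and J D j1 :: nat
    assume X: "X \<ge> 1" and R: "R \<ge> 1" and r: "r \<ge> 1" and ap: "\<bar>real r * \<theta> - of_int b\<bar> \<le> 1 / real r"
      and cop: "coprime b (int r)" and r1: "X powr (real k / 2) \<le> 5 * R ^ k * real r"
      and r2: "real r \<le> 5 * R ^ k * X powr (real k / 2)"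
      and J: "real J \<le> real w * R ^ k * X powr (real k / 2)" and D: "real D \<le> real w * X powr (real k / 2)"
    define N where "N = X powr (real k / 2)"
    have N1: "N \<ge> 1" unfolding N_def using X by (intro ge_one_powr_ge_zero) auto
    define T where "T = R ^ k"
    have T1: "T \<ge> 1" unfolding T_def using R by simp
    have TT: "T \<le> T * T" using T1 by simp
    then have TT1: "1 \<le> T * T" using T1 by linarith
    define Xe where "Xe = X powr \<epsilon>"
    have Xe1: "Xe \<ge> 1" unfolding Xe_def using X assms by (intro ge_one_powr_ge_zero) auto
    have "(\<Sum>j2\<le>J. cmod (\<Sum>n<Suc D. ee (\<theta> * of_int (int j2 - int j1) * real n))) 
      = (\<Sum>j\<in>{- int j1..- int j1 + int J}. cmod (\<Sum>n<Suc D. ee (\<theta> * of_int j * real n)))"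
      by (rule sum.reindex_bij_witness[of _ "\<lambda>j. nat (j + int j1)" "\<lambda>j2. int j2 - int j1"]) auto
    also have "\<dots> \<le> (2 * real J / real r + 1) * (2 * (real (Suc D) + 2 * real r * (1 + ln (real r))))"
      by (rule sum_geometric_interval[OF r ap cop])
    also have "\<dots> \<le> (c1 * (T * T)) * (c2 * (T * T) * N * Xe)"
    proof (rule mult_mono)
      have "2 * real J \<le> 2 * (real w * T * N)" using J unfolding T_def N_def by simp
      also have "\<dots> \<le> 2 * (real w * T * (5 * T * real r))"
        using r1 T1 unfolding T_def[symmetric] N_def[symmetric] by (intro mult_left_mono) auto
      finally have "2 * real J / real r \<le> 10 * real w * (T * T)"
        using r by (simp add: field_simps)
      moreover have "1 \<le> real w * (T * T)"
        using mult_mono[of 1 "real w" 1 "T * T"] w T1 TT by simp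
      ultimately show "2 * real J / real r + 1 \<le> c1 * (T * T)" unfolding c1_def by linarith
      have "1 + ln (real r) \<le> d * real r powr \<delta>" unfolding d_def using r \<delta> by (intro one_plus_ln_le) auto
      also have "real r powr \<delta> \<le> (5 * T * N) powr \<delta>"
        using r2 \<delta> unfolding T_def N_def by (intro powr_mono2) auto
      also have "\<dots> = (5 * T) powr \<delta> * N powr \<delta>" using T1 N1 by (intro powr_mult)
      also have "\<dots> \<le> (5 * T) powr 1 * Xe"
      proof (intro mult_mono powr_mono)
        show "N powr \<delta> \<le> Xe" unfolding N_def Xe_def powr_powr using X \<delta> by (intro powr_mono) (auto simp: mult.commute)
      qed (use T1 \<delta> in auto)
      finally have ln_le: "1 + ln (real r) \<le> d * (5 * T * Xe)"
        using T1 d1 by (simp add: mult_left_mono)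
      have "real r * (1 + ln (real r)) \<le> (5 * T * N) * (d * (5 * T * Xe))"
        using r2 ln_le r T1 N1 unfolding T_def[symmetric] N_def[symmetric] by (intro mult_mono) auto
      then have "2 * (real r * (1 + ln (real r))) \<le> 2 * ((5 * T * N) * (d * (5 * T * Xe)))"
        by (intro mult_left_mono) auto
      also have "\<dots> = 50 * d * (T * T * N * Xe)" by (simp add: mult_ac)
      finally have A: "2 * real r * (1 + ln (real r)) \<le> 50 * d * (T * T * N * Xe)"
        by (simp only: mult.assoc)
      have Z1: "N \<le> T * T * N * Xe"
      proof -
        have "1 * N * 1 \<le> (T * T) * N * Xe"
          using TT1 N1 Xe1 by (intro mult_mono) auto
        then show ?thesis by simp
      qed
      have "real (Suc D) \<le> (real w + 1) * N" using D N1 unfolding N_def[symmetric] by (simp add: algebra_simps)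
      also have "\<dots> \<le> (real w + 1) * (T * T * N * Xe)" using Z1 by (intro mult_left_mono) auto
      finally have B: "real (Suc D) \<le> (real w + 1) * (T * T * N * Xe)" .
      have "real (Suc D) + 2 * real r * (1 + ln (real r)) \<le> ((real w + 1) + 50 * d) * (T * T * N * Xe)"
        using A B by (simp only: distrib_right)
      then have "2 * (real (Suc D) + 2 * real r * (1 + ln (real r))) \<le> 2 * (((real w + 1) + 50 * d) * (T * T * N * Xe))"
        by (rule mult_left_mono) simp
      then show "2 * (real (Suc D) + 2 * real r * (1 + ln (real r))) \<le> c2 * (T * T) * N * Xe"
        by (simp only: c2_def mult.assoc)
    qed (use T1 r w in \<open>auto simp: c1_def\<close>)
    also have "\<dots> = (c1 * c2) * (T * T * T * T) * (N * Xe)" by (simp add: mult_ac)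
    also have "T * T * T * T = R powr (4 * real k)"
    proof -
      have "R powr (4 * real k) = R powr real (k * 4)" by (simp add: mult.commute)
      also have "\<dots> = R ^ (k * 4)" using R by (intro powr_realpow) auto
      also have "\<dots> = T ^ 4" unfolding T_def by (rule power_mult)
      finally show ?thesis by (simp add: eval_nat_numeral mult_ac)
    qed
    also have "N * Xe = X powr (real k / 2 + \<epsilon>)" unfolding N_def Xe_def by (simp add: powr_add)
    finally show "(\<Sum>j2\<le>J. cmod (\<Sum>n<Suc D. ee (\<theta> * of_int (int j2 - int j1) * real n))) \<le> pow_bound (c1 * c2) (4 * real k) (real k / 2 + \<epsilon>) R X"
      unfolding pow_bound_def .
  qed
qed

text \<open>Dirichlet-type approximation with a denominator of size X^(k/2) up to R^k, where the
  large sieve is efficient. The 5 covers the values 4 and 9/2 that come out of the arcs.\<close>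

definition well_approximated :: "nat \<Rightarrow> real \<Rightarrow> real \<Rightarrow> real \<Rightarrow> bool" where
  "well_approximated k R X \<theta> \<longleftrightarrow> (\<exists>r b. r \<ge> 1 \<and> \<bar>real r * \<theta> - of_int b\<bar> \<le> 1 / real r \<and> coprime b (int r) \<and>
     X powr (real k / 2) \<le> 5 * R ^ k * real r \<and> real r \<le> 5 * R ^ k * X powr (real k / 2))"

text \<open>Both variables have length about sqrt X, so each 2w-th moment contributes half of its
  exponent \<kappa>. The factor R in the range of m allows for a factor l that overshoots sqrt X by
  its smallest prime.\<close>

lemma bilinear_bound:
  fixes k v :: nat
  defines "w \<equiv> Suc v"
  assumes k: "k \<ge> 1" and adm: "admissible_exponent k (2 * real w) \<Delta>" and \<epsilon>: "\<epsilon> > 0"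
  obtains c a where "c \<ge> 0" "a \<ge> 0"
    "\<And>X R \<theta> \<beta>. X \<ge> 1 \<Longrightarrow> R \<ge> 1 \<Longrightarrow> well_approximated k R X \<theta> \<Longrightarrow>
       (\<forall>z. cmod (\<beta> z) \<le> 1) \<Longrightarrow>
       (\<Sum>m\<in>smooth_set (sqrt X * R) R. cmod (\<Sum>z\<in>smooth_set (sqrt X) R. \<beta> z * ee (\<theta> * real m ^ k * real z ^ k)))
         \<le> pow_bound c a (1 - (real k - 2 * \<Delta>) / (4 * real w ^ 2) + \<epsilon>) R X"
proof -
  define \<kappa> where "\<kappa> = 2 * real w - real k + \<Delta>"
  have w1: "w \<ge> 1" "w > 0" unfolding w_def by auto
  have \<kappa>: "\<kappa> \<ge> real w" using admissible_lower[OF adm] w1 unfolding \<kappa>_def by simp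
  obtain A C where AC: "A \<ge> 0" "C > 0"
    "\<And>Y R. Y \<ge> 1 \<Longrightarrow> R \<ge> 1 \<Longrightarrow> U_mean k (2 * real w) Y R \<le> C * R powr A * Y powr (\<kappa> + \<epsilon>)"
  proof (rule admissible_uniform[OF adm _ \<epsilon>])
    show "2 \<le> 2 * real w" using w1 by simp
  qed (rule that, auto simp: \<kappa>_def)
  obtain cl al where L: "cl \<ge> 0" "al \<ge> 0"
    "\<And>X R \<theta> r b J D j1. X \<ge> 1 \<Longrightarrow> R \<ge> 1 \<Longrightarrow> r \<ge> 1 \<Longrightarrow>
       \<bar>real r * \<theta> - of_int b\<bar> \<le> 1 / real r \<Longrightarrow> coprime b (int r) \<Longrightarrow>
       X powr (real k / 2) \<le> 5 * R ^ k * real r \<Longrightarrow> real r \<le> 5 * R ^ k * X powr (real k / 2) \<Longrightarrow>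
       real J \<le> real w * R ^ k * X powr (real k / 2) \<Longrightarrow> real D \<le> real w * X powr (real k / 2) \<Longrightarrow>
       (\<Sum>j2\<le>J. cmod (\<Sum>n<Suc D. ee (\<theta> * of_int (int j2 - int j1) * real n))) \<le> pow_bound cl al (real k / 2 + \<epsilon>) R X"
    by (rule bilinear_kernel_bound[OF w1(1) \<epsilon> k]) (rule that; assumption)
  define n where "n = 2 * w * w"
  have n0: "n > 0" using w1 unfolding n_def by simp
  define m where "m = 2 * v * w"
  \<comment> \<open>Constant and exponents are left in the shape that \<open>pow_bound_mult\<close>
    and \<open>pow_bound_power\<close> produce: both cardinalities to the power m, the two moments
    and the kernel bound.\<close>
  define cT where "cT = 1 ^ m * 1 ^ m * C * (cl * C)"
  define aT where "aT = 1 * real m + 0 * real m + A + (al + (A + (\<kappa> + \<epsilon>)))"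
  define eT where "eT = 1/2 * real m + 1/2 * real m + (\<kappa> + \<epsilon>) / 2 + (real k / 2 + \<epsilon> + (\<kappa> + \<epsilon>) / 2)"
  have cT0: "cT \<ge> 0" using AC L unfolding cT_def by simp
  have aT0: "aT \<ge> 0" using AC L \<kappa> \<epsilon> unfolding aT_def by simp
  \<comment> \<open>The origin of the formula for \<tau>: the total exponent is 2 w^2 - (k - 2
    \<Delta>) / 2 up to 2 \<epsilon>, and the root of order 2 w^2 is taken.\<close>
  have eT: "eT / real n \<le> 1 - (real k - 2 * \<Delta>) / (4 * real w ^ 2) + \<epsilon>"
  proof -
    have "eT = real m + \<kappa> + real k / 2 + 2 * \<epsilon>" unfolding eT_def by (simp add: field_simps)
    also have "real m = 2 * (real w)\<^sup>2 - 2 * real w" unfolding m_def w_def by (simp add: power2_eq_square algebra_simps)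
    finally have "eT = 2 * (real w)\<^sup>2 - (real k - 2 * \<Delta>) / 2 + 2 * \<epsilon>" unfolding \<kappa>_def by (simp add: field_simps)
    moreover have "real n = 2 * (real w)\<^sup>2" unfolding n_def by (simp add: power2_eq_square)
    ultimately have "eT / real n = 1 - (real k - 2 * \<Delta>) / (4 * real w ^ 2) + \<epsilon> / (real w)\<^sup>2"
      using w1 by (simp add: add_divide_distrib diff_divide_distrib)
    also have "\<epsilon> / (real w)\<^sup>2 \<le> \<epsilon> / 1" using \<epsilon> w1 by (intro divide_left_mono) auto
    finally show ?thesis by simp
  qed
  show ?thesis
  proof (rule that[of "cT powr (1 / real n)" "aT / real n"])
    show "cT powr (1 / real n) \<ge> 0" "aT / real n \<ge> 0" using aT0 by auto
    fix X R \<theta> :: real and \<beta> :: "nat \<Rightarrow> complex"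
    assume X: "X \<ge> 1" and R: "R \<ge> 1" and "well_approximated k R X \<theta>" and \<beta>: "\<forall>z. cmod (\<beta> z) \<le> 1"
    then obtain r :: nat and b :: int where r: "r \<ge> 1" and ap: "\<bar>real r * \<theta> - of_int b\<bar> \<le> 1 / real r"
      and cop: "coprime b (int r)" and r1: "X powr (real k / 2) \<le> 5 * R ^ k * real r"
      and r2: "real r \<le> 5 * R ^ k * X powr (real k / 2)"
      unfolding well_approximated_def by blast
    define M where "M = sqrt X"
    have M1: "M \<ge> 1" unfolding M_def using X by simp
    have MX: "M = X powr (1/2)" unfolding M_def using X by (simp add: powr_half_sqrt)
    define B where "B = smooth_set (M * R) R"
    define S where "S = smooth_set M R"
    define D where "D = w * (nat \<lfloor>M\<rfloor>) ^ k"
    define J where "J = w * (nat \<lfloor>M * R\<rfloor>) ^ k"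
    have Mk: "M ^ k = X powr (real k / 2)"
      unfolding MX using X by (simp add: powr_mult_nat)
    have Dle: "real D \<le> real w * X powr (real k / 2)"
    proof -
      have "real (nat \<lfloor>M\<rfloor>) ^ k \<le> M ^ k" using M1 by (intro power_mono of_nat_floor) auto
      then show ?thesis unfolding D_def Mk[symmetric] by (simp add: mult_left_mono)
    qed
    have Jle: "real J \<le> real w * R ^ k * X powr (real k / 2)"
    proof -
      have "real (nat \<lfloor>M * R\<rfloor>) ^ k \<le> (M * R) ^ k" using M1 R by (intro power_mono of_nat_floor) auto
      then have "real w * real (nat \<lfloor>M * R\<rfloor>) ^ k \<le> real w * (M * R) ^ k" by (intro mult_left_mono) auto
      then show ?thesis unfolding J_def Mk[symmetric] by (simp add: power_mult_distrib mult_ac)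
    qed
    have dB: "degree ((\<Sum>m\<in>B. monom (1::real) (m ^ k)) ^ Suc v) \<le> J"
      unfolding J_def w_def B_def by (intro degree_kth_power_sum finite_smooth_set) (auto simp: smooth_set_def le_nat_floor)
    have dS: "degree ((\<Sum>m\<in>S. monom (1::real) (m ^ k)) ^ Suc v) \<le> D"
      unfolding D_def w_def S_def by (intro degree_kth_power_sum finite_smooth_set) (auto simp: smooth_set_def le_nat_floor)
    define \<Lambda> where "\<Lambda> = pow_bound cl al (real k / 2 + \<epsilon>) R X"
    define f where "f = (\<Sum>m\<in>B. cmod (\<Sum>z\<in>S. \<beta> z * ee (\<theta> * real m ^ k * real z ^ k)))"
    have f0: "f \<ge> 0" unfolding f_def by (intro sum_nonneg) auto
    have MR1: "M * R \<ge> 1" using M1 R mult_mono[of 1 M 1 R] by simp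
    have cB: "real (card B) \<le> pow_bound 1 1 (1/2) R X"
      unfolding B_def smooth_set_psmooth pow_bound_def using card_psmooth_le[of "M * R"] MR1 R by (simp add: MX mult.commute)
    have cS: "real (card S) \<le> pow_bound 1 0 (1/2) R X"
      unfolding S_def smooth_set_psmooth pow_bound_def using card_psmooth_le[of M] M1 R by (simp add: MX)
    have US: "U_mean k (2 * real w) M R \<le> pow_bound C A ((\<kappa> + \<epsilon>) / 2) R X"
      using AC(3)[OF M1 R] X unfolding pow_bound_def MX powr_powr by simp
    have UB: "U_mean k (2 * real w) (M * R) R \<le> pow_bound C (A + (\<kappa> + \<epsilon>)) ((\<kappa> + \<epsilon>) / 2) R X"
    proof -
      have "(M * R) powr (\<kappa> + \<epsilon>) = R powr (\<kappa> + \<epsilon>) * X powr ((\<kappa> + \<epsilon>) / 2)"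
        unfolding MX using X R by (simp add: powr_mult powr_powr)
      then show ?thesis
        using AC(3)[OF MR1 R] unfolding pow_bound_def by (simp only: powr_add[of R A "\<kappa> + \<epsilon>"] mult.assoc)
    qed
    have "f ^ n \<le> real (card B) ^ (2 * v * Suc v) * real (card S) ^ (2 * v * Suc v) 
       * (\<Sum>n\<le>D. (coeff ((\<Sum>m\<in>S. monom (1::real) (m ^ k)) ^ Suc v) n)\<^sup>2) *
       (\<Lambda> * (\<Sum>n\<le>J. (coeff ((\<Sum>m\<in>B. monom (1::real) (m ^ k)) ^ Suc v) n)\<^sup>2))"
      unfolding f_def n_def w_def
    proof (rule sum_power_bilinear[OF _ _ _ dB dS])
      fix j1
      show "(\<Sum>j2\<le>J. cmod (\<Sum>n<Suc D. ee (\<theta> * of_int (int j2 - int j1) * real n))) \<le> \<Lambda>"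
        unfolding \<Lambda>_def by (rule L(3)[OF X R r ap cop r1 r2 Jle Dle])
    qed (use \<beta> in \<open>auto simp: B_def S_def\<close>)
    also have "\<dots> = real (card B) ^ m * real (card S) ^ m * U_mean k (2 * real w) M R * (\<Lambda> * U_mean k (2 * real w) (M * R) R)"
      using U_mean_even[OF dS[unfolded S_def]] U_mean_even[OF dB[unfolded B_def]] 
      unfolding m_def w_def B_def S_def by simp
    also have "\<dots> \<le> pow_bound cT aT eT R X"
    proof -
      have pos: "R > 0" "X > 0" using R X by auto
      have \<Lambda>0: "\<Lambda> \<ge> 0" unfolding \<Lambda>_def pow_bound_def using L(1) by simp
      have q1: "real (card B) ^ m * real (card S) ^ m \<le>
          pow_bound (1 ^ m * 1 ^ m) (1 * real m + 0 * real m) (1/2 * real m + 1/2 * real m) R X"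
        by (rule pow_bound_mult[OF pow_bound_power[OF cB _ pos] pow_bound_power[OF cS _ pos]]) auto
      have q2: "real (card B) ^ m * real (card S) ^ m * U_mean k (2 * real w) M R \<le>
          pow_bound (1 ^ m * 1 ^ m * C) (1 * real m + 0 * real m + A) (1/2 * real m + 1/2 * real m + (\<kappa> + \<epsilon>) / 2) R X"
        by (rule pow_bound_mult[OF q1 US]) (auto simp: U_mean_nonneg)
      have q3: "\<Lambda> * U_mean k (2 * real w) (M * R) R \<le>
          pow_bound (cl * C) (al + (A + (\<kappa> + \<epsilon>))) (real k / 2 + \<epsilon> + (\<kappa> + \<epsilon>) / 2) R X"
        by (rule pow_bound_mult[OF _ UB]) (auto simp: \<Lambda>0 U_mean_nonneg, simp add: \<Lambda>_def)
      show ?thesis unfolding cT_def aT_def eT_def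
        by (rule pow_bound_mult[OF q2 q3]) (auto simp: \<Lambda>0 U_mean_nonneg)
    qed
    finally have "f ^ n \<le> pow_bound cT aT eT R X" .
    then have "f \<le> pow_bound (cT powr (1 / real n)) (aT / real n) (eT / real n) R X"
      by (rule pow_bound_root[OF _ f0 n0])
    then have "f \<le> pow_bound (cT powr (1 / real n)) (aT / real n) (1 - (real k - 2 * \<Delta>) / (4 * real w ^ 2) + \<epsilon>) R X"
      by (rule pow_bound_weaken) (use eT R X in auto)
    then show "(\<Sum>m\<in>smooth_set (sqrt X * R) R. cmod (\<Sum>z\<in>smooth_set (sqrt X) R. \<beta> z * ee (\<theta> * real m ^ k * real z ^ k)))
         \<le> pow_bound (cT powr (1 / real n)) (aT / real n) (1 - (real k - 2 * \<Delta>) / (4 * real w ^ 2) + \<epsilon>) R X"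
      unfolding f_def B_def S_def M_def .
  qed
qed

text \<open>Keeps the target X^(1 - \<tau>) at least sqrt X, so that the trivially estimated terms
  are admissible. It rests on the lower bound for admissible exponents.\<close>

lemma tau_le_half:
  assumes adm: "admissible_exponent k (2 * real w) \<Delta>" and w: "w \<ge> 1" and k: "k \<ge> 1"
  shows "(real k - 2 * \<Delta>) / (4 * real w ^ 2) \<le> 1 / 2"
proof -
  have "real w \<le> 2 * real w - real k + \<Delta>" using admissible_lower[OF adm] w by simp
  then have "real k - 2 * \<Delta> \<le> 2 * real w" by simp
  also have "2 * real w \<le> 2 * real w ^ 2" using w self_le_power[of "real w" 2] by simp
  finally show ?thesis using w by (simp add: field_simps)
qed

lemma card_primes_le:
  assumes "Ps \<subseteq> {p. prime p \<and> real p \<le> R}" "R \<ge> 0"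
  shows "finite Ps" "real (card Ps) \<le> R"
proof -
  have sub: "Ps \<subseteq> {1..nat \<lfloor>R\<rfloor>}"
    using assms prime_ge_1_nat by (auto simp: le_nat_floor)
  then show "finite Ps" by (rule finite_subset) simp
  have "card Ps \<le> nat \<lfloor>R\<rfloor>" using card_mono[OF _ sub] by simp
  then have "real (card Ps) \<le> real (nat \<lfloor>R\<rfloor>)" by simp
  also have "\<dots> \<le> R" using assms by (intro of_nat_floor) auto
  finally show "real (card Ps) \<le> R" .
qed

text \<open>In a factorization l y with l > sqrt X the variables are tied by y <= X / l. Completion
  removes this condition at the cost of a logarithm and an unknown twist e(\<gamma> z), hence the
  hypothesis for all \<beta>.\<close>

lemma psmooth_bilinear_block:
  assumes Ps: "Ps \<subseteq> {p. prime p \<and> real p \<le> R}" and X: "X \<ge> 1" and R: "R \<ge> 1" and p: "p \<in> Ps" and \<epsilon>: "\<epsilon> > 0"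
    and K: "\<And>\<beta>. (\<forall>z. cmod (\<beta> z) \<le> 1) \<Longrightarrow>
       (\<Sum>m\<in>smooth_set (sqrt X * R) R. cmod (\<Sum>z\<in>smooth_set (sqrt X) R. \<beta> z * ee (\<theta> * real m ^ k * real z ^ k))) \<le> K"
  shows "(\<Sum>l\<in>block Ps (sqrt X) p. cmod (\<Sum>y\<in>psmooth (low_primes Ps Ps p) (X / real l). ee (\<theta> * real (l * y) ^ k)))
     \<le> 5 * ((1 + 1 / \<epsilon>) * X powr \<epsilon>) * K"
proof -
  define M where "M = sqrt X"
  have M1: "M \<ge> 1" unfolding M_def using X by simp
  have MM: "M * M = X" unfolding M_def using X by simp
  define B where "B = block Ps M p"
  define C where "C = psmooth (low_primes Ps Ps p) M"
  define n where "n = nat \<lfloor>M\<rfloor> + 1"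
  define g where "g l y = ee (\<theta> * real l ^ k * real y ^ k)" for l y :: nat
  define N where "N l = nat \<lfloor>X / real l\<rfloor>" for l :: nat
  have Cn: "z < n" if "z \<in> C" for z
    using that unfolding C_def psmooth_def n_def by (simp add: le_nat_floor less_Suc_eq_le)
  obtain \<gamma> where \<gamma>: "(\<Sum>l\<in>B. cmod (\<Sum>z\<in>{z\<in>C. z \<le> N l}. g l z)) 
     \<le> (3 + 2 * ln (real n)) * (\<Sum>l\<in>B. cmod (\<Sum>z\<in>C. ee (\<gamma> * real z) * g l z))"
    by (rule completion[where B = B and n = n and C = C and N = N and g = g]) (use Cn in \<open>auto simp: B_def n_def\<close>)
  have eqC: "psmooth (low_primes Ps Ps p) (X / real l) = {z\<in>C. z \<le> N l}" if "l \<in> B" for l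
  proof -
    have l: "M < real l" using that unfolding B_def block_def by simp
    then have l0: "real l > 0" using M1 by linarith
    have "X / real l \<le> X / M" using l M1 X by (intro divide_left_mono) auto
    also have "\<dots> = M" using MM M1 by (simp add: field_simps)
    finally have le: "X / real l \<le> M" .
    have "real z \<le> X / real l \<longleftrightarrow> real z \<le> M \<and> z \<le> N l" for z
    proof -
      have "z \<le> N l \<longleftrightarrow> real z \<le> X / real l"
        unfolding N_def using l0 X by (auto simp: le_nat_floor le_nat_iff le_floor_iff)
      then show ?thesis using le by auto
    qed
    then show ?thesis unfolding C_def psmooth_def by auto
  qed
  \<comment> \<open>The twist times the indicator of C: with it the inner sum runs over all smooth
    z, whichever primes the cofactor is allowed.\<close>
  define \<beta> where "\<beta> z = (if z \<in> C then ee (\<gamma> * real z) else 0)" for z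
  have BS: "B \<subseteq> smooth_set (M * R) R"
  proof
    fix l assume "l \<in> B"
    then have l: "primes_in {p'\<in>Ps. p \<le> p'} l" "real l \<le> M * real p" unfolding B_def block_def by auto
    have "real p \<le> R" using Ps p by auto
    then have "M * real p \<le> M * R" using M1 by (intro mult_left_mono) auto
    then have "real l \<le> M * R" using l(2) by linarith
    then show "l \<in> smooth_set (M * R) R" using l(1) Ps unfolding smooth_set_psmooth psmooth_def primes_in_def by auto
  qed
  have CS: "C \<subseteq> smooth_set M R"
    unfolding C_def smooth_set_psmooth using Ps by (intro psmooth_mono) (auto simp: low_primes_def)
  have "(\<Sum>l\<in>B. cmod (\<Sum>z\<in>C. ee (\<gamma> * real z) * g l z)) \<le> (\<Sum>l\<in>smooth_set (M * R) R. cmod (\<Sum>z\<in>C. ee (\<gamma> * real z) * g l z))"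
    by (intro sum_mono2 BS) auto
  also have "\<dots> = (\<Sum>l\<in>smooth_set (M * R) R. cmod (\<Sum>z\<in>smooth_set M R. \<beta> z * g l z))"
  proof (rule sum.cong[OF refl])
    fix l
    have "(\<Sum>z\<in>C. ee (\<gamma> * real z) * g l z) = (\<Sum>z\<in>smooth_set M R. \<beta> z * g l z)"
      by (rule sum.mono_neutral_cong_left) (use CS in \<open>auto simp: \<beta>_def\<close>)
    then show "cmod (\<Sum>z\<in>C. ee (\<gamma> * real z) * g l z) = cmod (\<Sum>z\<in>smooth_set M R. \<beta> z * g l z)" by simp
  qed
  also have "\<dots> \<le> K" unfolding g_def M_def by (rule K) (simp add: \<beta>_def)
  finally have leK: "(\<Sum>l\<in>B. cmod (\<Sum>z\<in>C. ee (\<gamma> * real z) * g l z)) \<le> K" .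
  have lnn: "3 + 2 * ln (real n) \<le> 5 * ((1 + 1 / \<epsilon>) * X powr \<epsilon>)"
  proof -
    have "real n \<le> M + 1" unfolding n_def using of_nat_floor[of M] M1 by simp
    also have "\<dots> \<le> exp 1 * X"
    proof -
      have "M \<le> X" using MM M1 mult_left_mono[of 1 M M] by simp
      moreover have "2 * X \<le> exp 1 * X" using exp_ge_add_one_self[of 1] X by (intro mult_right_mono) auto
      ultimately show ?thesis using X by linarith
    qed
    finally have "ln (real n) \<le> ln (exp 1 * X)" by (intro ln_mono) (auto simp: n_def)
    also have "\<dots> = 1 + ln X" using X by (simp add: ln_mult)
    finally have "ln (real n) \<le> 1 + ln X" .
    moreover have "ln X \<ge> 0" using X by simp
    ultimately have "3 + 2 * ln (real n) \<le> 5 * (1 + ln X)" by simp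
    also have "\<dots> \<le> 5 * ((1 + 1 / \<epsilon>) * X powr \<epsilon>)" using X \<epsilon> by (intro mult_left_mono one_plus_ln_le) auto
    finally show ?thesis .
  qed
  have "(\<Sum>l\<in>B. cmod (\<Sum>y\<in>psmooth (low_primes Ps Ps p) (X / real l). ee (\<theta> * real (l * y) ^ k)))
     = (\<Sum>l\<in>B. cmod (\<Sum>z\<in>{z\<in>C. z \<le> N l}. g l z))"
    using eqC by (intro sum.cong refl) (simp add: g_def power_mult_distrib mult.assoc)
  also have "\<dots> \<le> (3 + 2 * ln (real n)) * (\<Sum>l\<in>B. cmod (\<Sum>z\<in>C. ee (\<gamma> * real z) * g l z))" by (rule \<gamma>)
  also have "\<dots> \<le> 5 * ((1 + 1 / \<epsilon>) * X powr \<epsilon>) * K"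
    using lnn leK X \<epsilon> by (intro mult_mono) (auto intro!: sum_nonneg)
  finally show ?thesis unfolding B_def M_def .
qed

text \<open>The factorization with all of \<open>Ps\<close> in the role of \<open>Qs\<close> and the
  cut at sqrt X makes the sum bilinear. An arbitrary set \<open>Ps\<close> of small primes is needed
  because the cofactors to which it is applied have irregular prime sets.\<close>

lemma psmooth_minor_bound:
  assumes k: "k \<ge> 1" and w: "w \<ge> 1" and adm: "admissible_exponent k (2 * real w) \<Delta>" and \<epsilon>: "\<epsilon> > 0"
  defines "\<tau> \<equiv> (real k - 2 * \<Delta>) / (4 * real w ^ 2)"
  obtains c a where "c \<ge> 0" "a \<ge> 0"
    "\<And>X R \<theta> Ps. X \<ge> 1 \<Longrightarrow> R \<ge> 1 \<Longrightarrow> well_approximated k R X \<theta> \<Longrightarrow>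
       Ps \<subseteq> {p. prime p \<and> real p \<le> R} \<Longrightarrow>
       cmod (\<Sum>x\<in>psmooth Ps X. ee (\<theta> * real x ^ k)) \<le> pow_bound c a (1 - \<tau> + \<epsilon>) R X"
proof -
  define \<delta> where "\<delta> = \<epsilon> / 2"
  have \<delta>: "\<delta> > 0" using \<epsilon> unfolding \<delta>_def by simp
  obtain v where v: "w = Suc v" using w by (cases w) auto
  obtain c a where ca: "c \<ge> 0" "a \<ge> 0"
    "\<And>X R \<theta> \<beta>. X \<ge> 1 \<Longrightarrow> R \<ge> 1 \<Longrightarrow> well_approximated k R X \<theta> \<Longrightarrow>
       (\<forall>z. cmod (\<beta> z) \<le> 1) \<Longrightarrow>
       (\<Sum>m\<in>smooth_set (sqrt X * R) R. cmod (\<Sum>z\<in>smooth_set (sqrt X) R. \<beta> z * ee (\<theta> * real m ^ k * real z ^ k)))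
         \<le> pow_bound c a (1 - \<tau> + \<delta>) R X"
    by (rule bilinear_bound[OF k adm[unfolded v] \<delta>, folded v, folded \<tau>_def]) (rule that; assumption)
  define c1 where "c1 = 5 * (1 + 1 / \<delta>)"
  have c1: "c1 \<ge> 0" using \<delta> unfolding c1_def by simp
  show ?thesis
  proof (rule that[of "c1 * c + 1" "a + 1"])
    show "c1 * c + 1 \<ge> 0" "a + 1 \<ge> 0" using ca c1 by auto
    fix X R \<theta> :: real and Ps :: "nat set"
    assume X: "X \<ge> 1" and R: "R \<ge> 1" and h: "well_approximated k R X \<theta>"
      and Ps: "Ps \<subseteq> {p. prime p \<and> real p \<le> R}"
    define K where "K = pow_bound c a (1 - \<tau> + \<delta>) R X"
    have K0: "K \<ge> 0" unfolding K_def pow_bound_def using ca by simp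
    have sq1: "sqrt X \<ge> 1" using X by simp
    have fin: "finite Ps" "real (card Ps) \<le> R" using card_primes_le[OF Ps] R by auto
    have "cmod (\<Sum>x\<in>psmooth Ps X. ee (\<theta> * real x ^ k)) \<le> 
      (\<Sum>p\<in>Ps. \<Sum>l\<in>block Ps (sqrt X) p. cmod (\<Sum>y\<in>psmooth (low_primes Ps Ps p) (X / real l). ee (\<theta> * real (l * y) ^ k)))
      + sqrt X * real (card (psmooth (Ps - Ps) X))"
      using Ps by (intro cmod_sum_psmooth_le fin sq1) auto
    also have "(\<Sum>p\<in>Ps. \<Sum>l\<in>block Ps (sqrt X) p. cmod (\<Sum>y\<in>psmooth (low_primes Ps Ps p) (X / real l). ee (\<theta> * real (l * y) ^ k)))
      \<le> (\<Sum>p\<in>Ps. 5 * ((1 + 1 / \<delta>) * X powr \<delta>) * K)"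
      unfolding K_def by (intro sum_mono psmooth_bilinear_block[OF Ps X R _ \<delta>] ca(3)[OF X R h])
    also have "\<dots> = real (card Ps) * (c1 * X powr \<delta> * K)" unfolding c1_def by (simp add: mult.assoc)
    also have "\<dots> \<le> R * (c1 * X powr \<delta> * K)" using fin c1 K0 by (intro mult_right_mono) auto
    also have "\<dots> = pow_bound (c1 * c) (a + 1) (1 - \<tau> + \<epsilon>) R X"
    proof -
      have "X powr (1 - \<tau> + \<epsilon>) = X powr \<delta> * X powr (1 - \<tau> + \<delta>)"
        unfolding powr_add[symmetric] \<delta>_def by (simp add: algebra_simps)
      moreover have "R powr (a + 1) = R * R powr a" using R by (simp add: powr_add)
      ultimately show ?thesis unfolding K_def pow_bound_def by (simp add: mult_ac)
    qed
    \<comment> \<open>No prime is left for u, so u = 1 and there are at most sqrt X exceptional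
      numbers; \<tau> <= 1/2 absorbs them.\<close>
    also have "sqrt X * real (card (psmooth (Ps - Ps) X)) \<le> pow_bound 1 (a + 1) (1 - \<tau> + \<epsilon>) R X"
    proof -
      have "psmooth {} X \<subseteq> {1}" unfolding psmooth_def primes_in_def using prime_factor_nat by auto
      then have "card (psmooth {} X) \<le> 1" using card_mono[of "{1}" "psmooth {} X"] by simp
      then have "sqrt X * real (card (psmooth (Ps - Ps) X)) \<le> sqrt X * 1" using X by (intro mult_left_mono) auto
      also have "\<dots> = X powr (1/2)" using X by (simp add: powr_half_sqrt)
      also have "\<dots> = pow_bound 1 0 (1/2) R X" using R by (simp add: pow_bound_def)
      finally show ?thesis
        by (rule pow_bound_weaken) (use ca X R \<epsilon> tau_le_half[OF adm w k] in \<open>auto simp: \<tau>_def\<close>)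
    qed
    finally show "cmod (\<Sum>x\<in>psmooth Ps X. ee (\<theta> * real x ^ k)) \<le> pow_bound (c1 * c + 1) (a + 1) (1 - \<tau> + \<epsilon>) R X"
      by (simp add: pow_bound_def distrib_right)
  qed
qed

text \<open>If q > Q / 2, then q itself serves. Otherwise the error at q exceeds Q / (2 V), a
  Dirichlet approximation with smaller error has another fraction b' / r, and |r b - q b'| >= 1
  forces r >= 7/8 V / Q.\<close>

lemma minor_denominator:
  fixes q :: nat and b :: int and \<theta> V Q :: real
  assumes q: "1 \<le> q" "real q \<le> Q" and cop: "coprime b (int q)" and V: "4 * Q\<^sup>2 \<le> V"
    and le: "\<bar>real q * \<theta> - of_int b\<bar> \<le> Q / V"
    and minor: "\<not> (real q \<le> Q / 2 \<and> \<bar>real q * \<theta> - of_int b\<bar> \<le> Q / (2 * V))"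
  obtains r :: nat and b' :: int where "r \<ge> 1" "\<bar>real r * \<theta> - of_int b'\<bar> \<le> 1 / real r" "coprime b' (int r)"
    "Q / 2 \<le> real r" "real r \<le> 9 / 4 * (V / Q)"
proof -
  have Q1: "Q \<ge> 1" using q by linarith
  have "4 * Q\<^sup>2 > 0" using Q1 by simp
  then have V0: "V > 0" using V by linarith
  have VQ: "4 * Q \<le> V / Q" using V Q1 by (simp add: pos_le_divide_eq power2_eq_square)
  have QV: "Q / V \<le> 1 / (4 * Q)" using VQ Q1 V0 by (simp add: field_simps)
  show ?thesis
  proof (cases "real q \<le> Q / 2")
    case False
    have "Q / V \<le> 1 / real q"
    proof -
      have "1 / (4 * Q) \<le> 1 / real q" using q Q1 by (intro divide_left_mono) auto
      then show ?thesis using QV by linarith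
    qed
    then have "\<bar>real q * \<theta> - of_int b\<bar> \<le> 1 / real q" using le by linarith
    then show ?thesis using that[of q b] q cop False VQ Q1 by linarith
  next
    case True
    then have big: "\<bar>real q * \<theta> - of_int b\<bar> > Q / (2 * V)" using minor by simp
    \<comment> \<open>The order of the Dirichlet approximation: 1 / D <= Q / (2 V) beats the error
      at q, and V / Q >= 4 turns 2 V / Q + 1 into at most 9/4 V / Q.\<close>
    define D where "D = nat \<lceil>2 * (V / Q)\<rceil>"
    have D: "2 * (V / Q) \<le> real D" "real D \<le> 2 * (V / Q) + 1"
      using V0 Q1 unfolding D_def by (auto simp: of_nat_nat ceiling_correct intro: less_imp_le)
    have D0: "D > 0" using D VQ Q1 by (cases D) auto
    obtain b' rr where rr: "coprime b' rr" "0 < rr" "rr \<le> int D" "\<bar>of_int rr * \<theta> - of_int b'\<bar> < 1 / real D"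
      using Dirichlet_approx_coprime[OF D0] by blast
    define r where "r = nat rr"
    have r: "int r = rr" "r \<ge> 1" "r \<le> D" using rr unfolding r_def by auto
    have ap: "\<bar>real r * \<theta> - of_int b'\<bar> < 1 / real D" using rr(4) r(1) by (metis of_int_of_nat_eq)
    have invD: "1 / real D \<le> Q / (2 * V)"
    proof -
      have "2 * (V / Q) > 0" using V0 Q1 by simp
      then have "1 / real D \<le> 1 / (2 * (V / Q))" using D(1) by (intro frac_le) auto
      then show ?thesis by simp
    qed
    have "1 / real D \<le> 1 / real r" using r by (intro divide_left_mono) auto
    then have ap1: "\<bar>real r * \<theta> - of_int b'\<bar> \<le> 1 / real r" using ap by linarith
    \<comment> \<open>Equality would make the reduced fractions b / q and b' / r the same, while the
      error at r is below 1 / D and the error at q is not.\<close>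
    have ne: "int r * b - int q * b' \<noteq> 0"
    proof
      assume "int r * b - int q * b' = 0"
      then have eq: "int r * b = int q * b'" by simp
      have "int r dvd int q" using rr(1) eq r(1) by (metis coprime_commute coprime_dvd_mult_left_iff dvd_triv_left)
      moreover have "int q dvd int r" using cop eq by (metis coprime_commute coprime_dvd_mult_left_iff dvd_triv_left)
      ultimately have "r = q" by (simp add: dvd_antisym)
      then have "b = b'" using eq q by simp
      then have "\<bar>real q * \<theta> - of_int b\<bar> < 1 / real D" using ap \<open>r = q\<close> by simp
      then show False using big invD by linarith
    qed
    have "1 \<le> \<bar>int r * b - int q * b'\<bar>" using ne by linarith
    then have "1 \<le> \<bar>real_of_int (int r * b - int q * b')\<bar>" by linarith
    also have "real_of_int (int r * b - int q * b') = real q * (real r * \<theta> - of_int b') - real r * (real q * \<theta> - of_int b)"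
      by (simp add: algebra_simps)
    also have "\<bar>\<dots>\<bar> \<le> real q * \<bar>real r * \<theta> - of_int b'\<bar> + real r * \<bar>real q * \<theta> - of_int b\<bar>"
      by (rule order_trans[OF abs_triangle_ineq4]) (simp add: abs_mult)
    also have "\<dots> \<le> Q * (Q / (2 * V)) + real r * (Q / V)"
      using q le ap invD Q1 by (intro add_mono mult_mono) auto
    also have "Q * (Q / (2 * V)) \<le> 1 / 8" using V V0 by (simp add: field_simps power2_eq_square)
    finally have "7 / 8 \<le> real r * (Q / V)" by linarith
    then have "7 / 8 * (V / Q) \<le> real r" using V0 Q1 by (simp add: field_simps)
    then have "Q / 2 \<le> real r" using VQ Q1 by linarith
    moreover have "real r \<le> 9 / 4 * (V / Q)" using r(3) D(2) VQ Q1 by linarith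
    ultimately show ?thesis using that[of r b'] r ap1 rr(1) by simp
  qed
qed

section \<open>Dividing out a factor prime to the denominator\<close>

definition primes_upto :: "real \<Rightarrow> nat set" where
  "primes_upto R = {p. prime p \<and> real p \<le> R}"

definition coprime_primes_upto :: "real \<Rightarrow> nat \<Rightarrow> nat set" where
  "coprime_primes_upto R q = {p\<in>primes_upto R. \<not> p dvd q}"

text \<open>Factors l are built from the primes not dividing q, so in the exceptional numbers u v
  the part u consists of primes of q, and few such u exist.\<close>

lemma weyl_f_decomposition:
  assumes R: "R \<ge> 0" and L: "L \<ge> 1"
  shows "cmod (weyl_f k P R \<alpha>) \<le> (\<Sum>p\<in>coprime_primes_upto R q. \<Sum>l\<in>block (coprime_primes_upto R q) L p.
       cmod (\<Sum>y\<in>psmooth (low_primes (primes_upto R) (coprime_primes_upto R q) p) (P / real l). ee (\<alpha> * real (l * y) ^ k)))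
     + L * real (card (psmooth {p. p dvd q} P))"
proof -
  have fin: "finite (coprime_primes_upto R q)"
    by (rule finite_subset[OF _ card_primes_le(1)[OF subset_refl R]]) (auto simp: coprime_primes_upto_def primes_upto_def)
  have eq: "smooth_set P R = psmooth (primes_upto R) P"
    unfolding smooth_set_psmooth psmooth_def primes_in_def primes_upto_def by auto
  have "psmooth (primes_upto R - coprime_primes_upto R q) P \<subseteq> psmooth {p. p dvd q} P"
    by (rule psmooth_mono) (auto simp: coprime_primes_upto_def)
  then have "real (card (psmooth (primes_upto R - coprime_primes_upto R q) P)) \<le> real (card (psmooth {p. p dvd q} P))"
    by (simp add: card_mono)
  then have "L * real (card (psmooth (primes_upto R - coprime_primes_upto R q) P)) \<le> L * real (card (psmooth {p. p dvd q} P))"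
    using L by (intro mult_left_mono) auto
  moreover have "cmod (weyl_f k P R \<alpha>) \<le> (\<Sum>p\<in>coprime_primes_upto R q. \<Sum>l\<in>block (coprime_primes_upto R q) L p.
       cmod (\<Sum>y\<in>psmooth (low_primes (primes_upto R) (coprime_primes_upto R q) p) (P / real l). ee (\<alpha> * real (l * y) ^ k)))
     + L * real (card (psmooth (primes_upto R - coprime_primes_upto R q) P))"
    unfolding weyl_f_def eq
    by (rule cmod_sum_psmooth_le[OF fin _ _ L]) (auto simp: coprime_primes_upto_def primes_upto_def)
  ultimately show ?thesis by linarith
qed

lemma block_facts:
  assumes l: "l \<in> block (coprime_primes_upto R q) L p" and p: "p \<in> coprime_primes_upto R q" and L: "L \<ge> 1"
  shows "l \<ge> 1" "coprime l q" "L < real l" "real l \<le> L * R"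
proof -
  show "l \<ge> 1" "L < real l" using l unfolding block_def primes_in_def by auto
  have "real l \<le> L * real p" using l unfolding block_def by auto
  also have "\<dots> \<le> L * R" using p L unfolding coprime_primes_upto_def primes_upto_def by (intro mult_left_mono) auto
  finally show "real l \<le> L * R" .
  show "coprime l q"
  proof (rule ccontr)
    assume "\<not> coprime l q"
    then obtain p' where "prime p'" "p' dvd l" "p' dvd q"
      using prime_factor_nat[of "gcd l q"] by (auto simp: coprime_iff_gcd_eq_1)
    then show False using l unfolding block_def primes_in_def coprime_primes_upto_def by auto
  qed
qed

lemma card_coprime_primes_upto: "R \<ge> 0 \<Longrightarrow> finite (coprime_primes_upto R q) \<and> real (card (coprime_primes_upto R q)) \<le> R"
  using card_primes_le[of "coprime_primes_upto R q" R] unfolding coprime_primes_upto_def primes_upto_def by auto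

lemma card_block_le:
  assumes "p \<in> coprime_primes_upto R q" "L \<ge> 1" "R \<ge> 0"
  shows "real (card (block (coprime_primes_upto R q) L p)) \<le> L * R"
proof -
  have "block (coprime_primes_upto R q) L p \<subseteq> {1..nat \<lfloor>L * R\<rfloor>}"
  proof
    fix l assume l: "l \<in> block (coprime_primes_upto R q) L p"
    show "l \<in> {1..nat \<lfloor>L * R\<rfloor>}" using block_facts(1,4)[OF l assms(1,2)] by (simp add: le_nat_floor)
  qed
  then have "card (block (coprime_primes_upto R q) L p) \<le> nat \<lfloor>L * R\<rfloor>" using card_mono[of "{1..nat \<lfloor>L * R\<rfloor>}"] by fastforce
  then have "real (card (block (coprime_primes_upto R q) L p)) \<le> real (nat \<lfloor>L * R\<rfloor>)" by simp
  also have "\<dots> \<le> L * R" using assms by (intro of_nat_floor) auto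
  finally show ?thesis .
qed

text \<open>q is at most a fixed power of P, so a bound in terms of q and P becomes one in P alone;
  \<delta> shares \<epsilon> in the proportion 1 to k/2.\<close>

lemma dvd_count_bound:
  fixes k :: nat
  assumes "\<epsilon> > 0"
  obtains C where "C > 0" "\<And>P Q q. P \<ge> 1 \<Longrightarrow> 1 \<le> q \<Longrightarrow> real q \<le> Q \<Longrightarrow> Q \<le> P powr (real k / 2) \<Longrightarrow>
     real (card (psmooth {p. p dvd q} P)) \<le> C * P powr \<epsilon>"
proof -
  define \<delta> where "\<delta> = \<epsilon> / (1 + real k / 2)"
  have \<delta>: "\<delta> > 0" using assms unfolding \<delta>_def by (intro divide_pos_pos) auto
  obtain C where C: "C > 0" "\<And>q X. q \<ge> 1 \<Longrightarrow> X \<ge> 1 \<Longrightarrow>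
     real (card (psmooth {p. p dvd q} X)) \<le> C * X powr \<delta> * real q powr \<delta>"
    using card_psmooth_dvd_bound[OF \<delta>] by blast
  show ?thesis
  proof (rule that[OF C(1)])
    fix P Q :: real and q :: nat
    assume P: "P \<ge> 1" and q: "1 \<le> q" "real q \<le> Q" and Q: "Q \<le> P powr (real k / 2)"
    have "real (card (psmooth {p. p dvd q} P)) \<le> C * P powr \<delta> * real q powr \<delta>" using C(2) q P by simp
    also have "\<dots> \<le> C * P powr \<delta> * (P powr (real k / 2)) powr \<delta>"
      using C(1) q Q \<delta> by (intro mult_left_mono powr_mono2) auto
    also have "\<dots> = C * P powr (\<delta> * (1 + real k / 2))"
      by (simp add: powr_powr powr_add[symmetric] algebra_simps)
    also have "\<delta> * (1 + real k / 2) = \<epsilon>" unfolding \<delta>_def by (simp add: field_simps add_pos_nonneg)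
    finally show "real (card (psmooth {p. p dvd q} P)) \<le> C * P powr \<epsilon>" .
  qed
qed

text \<open>\<open>Y = (2 * Q) powr (2 / k)\<close> is the length at which the arcs of level \<open>Q\<close> just cover the unit interval,
  and \<open>L = P / (R * Y)\<close> is the factor by which \<open>P\<close> is reduced to it.\<close>
lemma scale_facts:
  fixes k :: nat and P Q R :: real
  defines "Y \<equiv> (2 * Q) powr (2 / real k)"
  assumes k: "k \<ge> 1" and P: "P \<ge> 1" and R: "R \<ge> 1" and Q: "1 \<le> Q" "Q \<le> 1/2 * P powr (real k / 2) * R powr (- real k)"
  shows "Y \<ge> 1" "Y \<le> P" "P / (R * Y) \<ge> 1" "Y ^ k = 4 * Q\<^sup>2" "Y powr (real k / 2) = 2 * Q" "Q \<le> P powr (real k / 2)"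
proof -
  show Y1: "Y \<ge> 1" unfolding Y_def using Q by (intro ge_one_powr_ge_zero) auto
  show Y2: "Y powr (real k / 2) = 2 * Q" unfolding Y_def using Q k by (simp add: powr_powr)
  have "Y ^ k = Y powr real k" using Y1 by (simp add: powr_realpow)
  also have "\<dots> = (Y powr (real k / 2)) ^ 2" using Y1 by (simp add: powr_mult_nat)
  finally show "Y ^ k = 4 * Q\<^sup>2" unfolding Y2 by (simp add: power_mult_distrib)
  have Rk: "R powr (- real k) \<le> 1" using R powr_mono[of "- real k" 0 R] by simp
  have "Q \<le> 1/2 * P powr (real k / 2) * R powr (- real k)" by (rule Q)
  also have "\<dots> \<le> 1/2 * P powr (real k / 2) * 1" using Rk by (intro mult_left_mono) auto
  finally show "Q \<le> P powr (real k / 2)" using powr_ge_zero[of P "real k / 2"] by linarith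
  have "2 * Q \<le> P powr (real k / 2) * R powr (- real k)" using Q by simp
  then have "Y \<le> (P powr (real k / 2) * R powr (- real k)) powr (2 / real k)"
    unfolding Y_def using Q by (intro powr_mono2) auto
  also have "\<dots> = P powr 1 * R powr (- 2)" using k P R by (simp add: powr_mult powr_powr)
  also have "\<dots> = P / R\<^sup>2" using P R by (simp add: powr_minus_divide)
  \<comment> \<open>The factor R^(-k) in the range of Q is spent here: one R covers the overshoot of
    l, the other the use of Y <= R Y.\<close>
  finally have YP: "Y * R\<^sup>2 \<le> P" using R by (simp add: field_simps)
  have "R \<le> R\<^sup>2" using R self_le_power[of R 2] by simp
  have "Y * 1 \<le> Y * R\<^sup>2" using Y1 R by (intro mult_left_mono) auto
  then show "Y \<le> P" using YP by simp
  have "Y * R \<le> Y * R\<^sup>2" using Y1 \<open>R \<le> R\<^sup>2\<close> by (intro mult_left_mono) auto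
  then have "R * Y \<le> P" using YP by (simp add: mult.commute)
  then show "P / (R * Y) \<ge> 1" using R Y1 by (simp add: pos_le_divide_eq)
qed

text \<open>Each inner sum has length X between Y and R Y and is at most (R Y)^(1 - \<tau> +
  \<epsilon>) up to powers of R. There are at most R (L R) pairs (p, l), and L R = P / Y, which
  leaves P Y^(-\<tau>).\<close>

lemma minor_arc_bound:
  assumes k: "k \<ge> 1" and w: "w \<ge> 1" and adm: "admissible_exponent k (2 * real w) \<Delta>" and \<epsilon>: "\<epsilon> > 0"
  defines "\<tau> \<equiv> (real k - 2 * \<Delta>) / (4 * real w ^ 2)"
  obtains c a where "c \<ge> 0" "a \<ge> 0"
    "\<And>P R Q \<alpha>. P \<ge> 1 \<Longrightarrow> R \<ge> 1 \<Longrightarrow> 1 \<le> Q \<Longrightarrow> Q \<le> 1/2 * P powr (real k / 2) * R powr (- real k) \<Longrightarrow>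
       \<alpha> \<in> major_arcs_N k Q P \<Longrightarrow>
       cmod (weyl_f k P R \<alpha>) \<le> c * R powr a * P powr (1 + \<epsilon>) * ((2 * Q) powr (2 / real k)) powr (- \<tau>)"
proof -
  obtain c a where ca: "c \<ge> 0" "a \<ge> 0"
    "\<And>X R \<theta> Ps. X \<ge> 1 \<Longrightarrow> R \<ge> 1 \<Longrightarrow> well_approximated k R X \<theta> \<Longrightarrow>
       Ps \<subseteq> {p. prime p \<and> real p \<le> R} \<Longrightarrow>
       cmod (\<Sum>x\<in>psmooth Ps X. ee (\<theta> * real x ^ k)) \<le> pow_bound c a (1 - \<tau> + \<epsilon>) R X"
    by (rule psmooth_minor_bound[OF k w adm \<epsilon>, folded \<tau>_def]) (rule that; assumption)
  obtain C where C: "C > 0" "\<And>P Q q. P \<ge> 1 \<Longrightarrow> 1 \<le> q \<Longrightarrow> real q \<le> Q \<Longrightarrow> Q \<le> P powr (real k / 2) \<Longrightarrow>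
     real (card (psmooth {p. p dvd q} P)) \<le> C * P powr \<epsilon>"
    using dvd_count_bound[OF \<epsilon>, of k] by blast
  have \<tau>: "\<tau> \<le> 1/2" unfolding \<tau>_def by (rule tau_le_half[OF adm w k])
  define e where "e = 1 - \<tau> + \<epsilon>"
  have e0: "e > 0" using \<tau> \<epsilon> unfolding e_def by simp
  show ?thesis
  proof (rule that[of "c + C" "a + e + 1"])
    show "c + C \<ge> 0" "a + e + 1 \<ge> 0" using ca C e0 by auto
    fix P R Q \<alpha> :: real
    assume P: "P \<ge> 1" and R: "R \<ge> 1" and Q: "1 \<le> Q" "Q \<le> 1/2 * P powr (real k / 2) * R powr (- real k)"
      and \<alpha>: "\<alpha> \<in> major_arcs_N k Q P"
    define Y where "Y = (2 * Q) powr (2 / real k)"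
    note Y = scale_facts[OF k P R Q, folded Y_def]
    define L where "L = P / (R * Y)"
    have L1: "L \<ge> 1" unfolding L_def by (rule Y(3))
    obtain q d :: nat where qd: "1 \<le> q" "real q \<le> Q" "d \<le> q" "coprime d q" "\<bar>real q * \<alpha> - real d\<bar> \<le> Q * P powr (- real k)"
      using \<alpha> unfolding major_arcs_N_def major_arcs_def by blast
    \<comment> \<open>The chosen pair (q, d) itself is not a witness at level Q / 2, although it
      satisfies the other conditions there.\<close>
    have notminor: "\<not> (real q \<le> Q / 2 \<and> \<bar>real q * \<alpha> - real d\<bar> \<le> Q / 2 * P powr (- real k))"
      using \<alpha> qd unfolding major_arcs_N_def major_arcs_def by blast
    define Qs where "Qs = coprime_primes_upto R q"
    define K where "K = c * R powr a * (R * Y) powr e"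
    have K0: "K \<ge> 0" unfolding K_def using ca by simp
    have inner: "cmod (\<Sum>y\<in>psmooth (low_primes (primes_upto R) Qs p) (P / real l). ee (\<alpha> * real (l * y) ^ k)) \<le> K"
      if p: "p \<in> Qs" and l: "l \<in> block Qs L p" for p l
    proof -
      note lf = block_facts[OF l[unfolded Qs_def] p[unfolded Qs_def] L1]
      define X where "X = P / real l"
      define \<theta> where "\<theta> = \<alpha> * real l ^ k"
      define b where "b = int (l ^ k * d)"
      define V where "V = X ^ k"
      have XY: "Y \<le> X"
      proof -
        have "P / (L * R) \<le> P / real l" using lf P L1 by (intro divide_left_mono) auto
        moreover have "P / (L * R) = Y" unfolding L_def using P R Y(1) by simp
        ultimately show ?thesis unfolding X_def by simp
      qed
      have XR: "X \<le> R * Y"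
      proof -
        have "P / real l \<le> P / L" using lf P L1 by (intro divide_left_mono) auto
        moreover have "P / L = R * Y" unfolding L_def using P R Y(1) by simp
        ultimately show ?thesis unfolding X_def by simp
      qed
      have X1: "X \<ge> 1" using XY Y(1) by linarith
      have V4: "4 * Q\<^sup>2 \<le> V" unfolding V_def Y(4)[symmetric] using XY Y(1) by (intro power_mono) auto
      have V0: "V > 0" unfolding V_def using X1 by simp
      have scale: "\<bar>real q * \<theta> - of_int b\<bar> = real l ^ k * \<bar>real q * \<alpha> - real d\<bar>"
      proof -
        have "real q * \<theta> - of_int b = real l ^ k * (real q * \<alpha> - real d)"
          unfolding \<theta>_def b_def by (simp add: algebra_simps)
        then show ?thesis by (simp add: abs_mult)
      qed
      \<comment> \<open>Dilation by l^k magnifies P^(-k) to X^(-k), so levels are preserved exactly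
        and \<open>notminor\<close> carries over.\<close>
      have PV: "real l ^ k * P powr (- real k) = 1 / V"
        unfolding V_def X_def using P by (simp add: powr_minus_divide powr_realpow power_divide)
      have "coprime b (int q)"
        unfolding b_def coprime_int_iff using qd(4) lf(2) by simp
      moreover have "\<bar>real q * \<theta> - of_int b\<bar> \<le> Q / V"
      proof -
        have "real l ^ k * \<bar>real q * \<alpha> - real d\<bar> \<le> real l ^ k * (Q * P powr (- real k))"
          using qd by (intro mult_left_mono) auto
        also have "\<dots> = Q * (real l ^ k * P powr (- real k))" by simp
        finally show ?thesis unfolding scale PV by simp
      qed
      moreover have "\<not> (real q \<le> Q / 2 \<and> \<bar>real q * \<theta> - of_int b\<bar> \<le> Q / (2 * V))"
      proof
        assume as: "real q \<le> Q / 2 \<and> \<bar>real q * \<theta> - of_int b\<bar> \<le> Q / (2 * V)"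
        have "Q / (2 * V) = Q / 2 * (real l ^ k * P powr (- real k))" unfolding PV by simp
        then have "real l ^ k * \<bar>real q * \<alpha> - real d\<bar> \<le> real l ^ k * (Q / 2 * P powr (- real k))"
          using as unfolding scale by (simp add: mult_ac)
        then have "\<bar>real q * \<alpha> - real d\<bar> \<le> Q / 2 * P powr (- real k)"
          using lf(1) by (subst (asm) mult_le_cancel_left_pos) auto
        then show False using notminor as by blast
      qed
      ultimately obtain r :: nat and b' :: int where r: "r \<ge> 1" "\<bar>real r * \<theta> - of_int b'\<bar> \<le> 1 / real r" "coprime b' (int r)"
        "Q / 2 \<le> real r" "real r \<le> 9 / 4 * (V / Q)"
        using minor_denominator[OF qd(1,2) _ V4] by blast
      define N where "N = X powr (real k / 2)"
      have N0: "N > 0" unfolding N_def using X1 by simp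
      have NN: "V = N * N" unfolding V_def N_def using X1 by (simp add: powr_add[symmetric] powr_realpow)
      \<comment> \<open>With Q / 2 <= r <= 9/4 N^2 / Q, this gives N <= 4 R^k r and r <= 9/2 R^k N,
        the two bounds behind the constant 5.\<close>
      have NQ: "N \<le> 2 * R ^ k * Q"
      proof -
        have "N \<le> (R * Y) powr (real k / 2)" unfolding N_def using XR X1 by (intro powr_mono2) auto
        also have "\<dots> = R powr (real k / 2) * (2 * Q)" using R Y by (simp add: powr_mult)
        also have "\<dots> \<le> R powr real k * (2 * Q)" using R Q by (intro mult_right_mono powr_mono) auto
        finally show ?thesis using R by (simp add: powr_realpow mult_ac)
      qed
      have "N \<le> 5 * R ^ k * real r"
      proof -
        have "2 * R ^ k * Q \<le> 2 * R ^ k * (2 * real r)" using r(4) R by (intro mult_left_mono) auto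
        also have "\<dots> \<le> 5 * R ^ k * real r" using R by simp
        finally show ?thesis using NQ by linarith
      qed
      moreover have "real r \<le> 5 * R ^ k * N"
      proof -
        have "V / Q \<le> N * (2 * R ^ k)"
          unfolding NN using NQ N0 Q by (simp add: pos_divide_le_eq mult_left_mono mult.assoc)
        then have "9 / 4 * (V / Q) \<le> 9 / 4 * (N * (2 * R ^ k))" by (intro mult_left_mono) auto
        also have "\<dots> \<le> 5 * R ^ k * N" using N0 R by simp
        finally show ?thesis using r(5) by linarith
      qed
      ultimately have "well_approximated k R X \<theta>"
        unfolding well_approximated_def N_def using r(1-3) by blast
      then have "cmod (\<Sum>x\<in>psmooth (low_primes (primes_upto R) Qs p) X. ee (\<theta> * real x ^ k)) \<le> pow_bound c a e R X"
        unfolding e_def by (rule ca(3)[OF X1 R]) (auto simp: low_primes_def primes_upto_def)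
      also have "\<dots> \<le> K" unfolding pow_bound_def K_def using XR X1 e0 ca by (intro mult_left_mono powr_mono2) auto
      finally show ?thesis unfolding \<theta>_def X_def by (simp add: power_mult_distrib mult.assoc)
    qed
    have "cmod (weyl_f k P R \<alpha>) \<le> (\<Sum>p\<in>Qs. \<Sum>l\<in>block Qs L p.
       cmod (\<Sum>y\<in>psmooth (low_primes (primes_upto R) Qs p) (P / real l). ee (\<alpha> * real (l * y) ^ k)))
     + L * real (card (psmooth {p. p dvd q} P))"
      unfolding Qs_def using R by (intro weyl_f_decomposition L1) auto
    also have "\<dots> \<le> (\<Sum>p\<in>Qs. \<Sum>l\<in>block Qs L p. K) + L * (C * P powr \<epsilon>)"
      using L1 by (intro add_mono sum_mono inner mult_left_mono C(2)[OF P qd(1,2) Y(6)]) auto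
    also have "(\<Sum>p\<in>Qs. \<Sum>l\<in>block Qs L p. K) \<le> (\<Sum>p\<in>Qs. L * R * K)"
    proof (rule sum_mono)
      fix p assume "p \<in> Qs"
      then have "real (card (block Qs L p)) \<le> L * R" unfolding Qs_def using L1 R by (intro card_block_le) auto
      then show "(\<Sum>l\<in>block Qs L p. K) \<le> L * R * K" using K0 by (simp add: mult_right_mono)
    qed
    also have "\<dots> = real (card Qs) * (L * R * K)" by simp
    also have "\<dots> \<le> R * (L * R * K)"
      using card_coprime_primes_upto[of R q] R L1 K0 unfolding Qs_def by (intro mult_right_mono) auto
    also have "R * (L * R * K) + L * (C * P powr \<epsilon>) \<le> (c + C) * R powr (a + e + 1) * P powr (1 + \<epsilon>) * Y powr (- \<tau>)"
    proof -
      have LR: "L * R = P / Y" unfolding L_def using R by simp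
      have KR: "K = c * R powr a * (R powr e * Y powr e)" unfolding K_def using R Y(1) by (simp add: powr_mult)
      have Ye: "Y powr e / Y = Y powr (- \<tau>) * Y powr \<epsilon>"
      proof -
        have "Y powr e / Y = Y powr (e - 1)" using Y(1) by (simp add: powr_diff)
        also have "e - 1 = - \<tau> + \<epsilon>" unfolding e_def by simp
        finally show ?thesis by (simp only: powr_add)
      qed
      have Ra: "R powr (a + e + 1) = R powr a * R powr e * R" using R by (simp add: powr_add)
      have "R * (L * R * K) = c * (R powr a * R powr e * R) * (P * (Y powr e / Y))"
        unfolding LR KR by (simp add: mult_ac)
      also have "\<dots> = c * R powr (a + e + 1) * (P * (Y powr (- \<tau>) * Y powr \<epsilon>))"
        unfolding Ye Ra ..
      also have "\<dots> \<le> c * R powr (a + e + 1) * (P * (Y powr (- \<tau>) * P powr \<epsilon>))"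
        using ca P Y \<epsilon> by (intro mult_left_mono powr_mono2) auto
      finally have t1: "R * (L * R * K) \<le> c * R powr (a + e + 1) * P powr (1 + \<epsilon>) * Y powr (- \<tau>)"
        using P by (simp add: powr_add mult_ac)
      \<comment> \<open>The exceptional numbers contribute about L <= P / Y, which is below P
        Y^(-\<tau>) as \<tau> <= 1/2 and Y >= 1.\<close>
      have "L * (C * P powr \<epsilon>) \<le> P * Y powr (- \<tau>) * (C * P powr \<epsilon>)"
      proof (intro mult_right_mono)
        have "L \<le> P / Y" unfolding L_def using R Y(1) P by (intro divide_left_mono) auto
        also have "\<dots> = P * Y powr (- 1)" using Y(1) by (simp add: powr_minus_divide)
        also have "\<dots> \<le> P * Y powr (- \<tau>)" using Y(1) P \<tau> by (intro mult_left_mono powr_mono) auto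
        finally show "L \<le> P * Y powr (- \<tau>)" .
      qed (use C in auto)
      also have "\<dots> = 1 * (C * P powr (1 + \<epsilon>) * Y powr (- \<tau>))" using P by (simp add: powr_add mult_ac)
      also have "\<dots> \<le> R powr (a + e + 1) * (C * P powr (1 + \<epsilon>) * Y powr (- \<tau>))"
        using R C ca e0 by (intro mult_right_mono ge_one_powr_ge_zero) auto
      finally have t2: "L * (C * P powr \<epsilon>) \<le> C * R powr (a + e + 1) * P powr (1 + \<epsilon>) * Y powr (- \<tau>)"
        by (simp add: mult_ac)
      show ?thesis using t1 t2 by (simp add: distrib_right)
    qed
    finally show "cmod (weyl_f k P R \<alpha>) \<le> (c + C) * R powr (a + e + 1) * P powr (1 + \<epsilon>) * ((2 * Q) powr (2 / real k)) powr (- \<tau>)"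
      unfolding Y_def by simp
  qed
qed

section \<open>Mean values over major arcs\<close>

text \<open>Major arcs with a condition on the denominator. With \<open>S\<close> the coprimality to
  l they are the arcs on which multiplication by l^k is well behaved.\<close>

definition arcs :: "nat \<Rightarrow> real \<Rightarrow> real \<Rightarrow> (nat \<Rightarrow> bool) \<Rightarrow> real set" where
  "arcs k Q P S = {\<alpha>. 0 \<le> \<alpha> \<and> \<alpha> < 1 \<and>
     (\<exists>q a::nat. 1 \<le> q \<and> real q \<le> Q \<and> a \<le> q \<and> coprime a q \<and> S q \<and>
        \<bar>real q * \<alpha> - real a\<bar> \<le> Q * P powr (- real k))}"

lemma major_arcs_eq: "major_arcs k Q P = arcs k Q P (\<lambda>_. True)"
  unfolding major_arcs_def arcs_def by simp

definition arc_index :: "real \<Rightarrow> (nat \<times> nat) set" where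
  "arc_index Q = (SIGMA q:{1..nat \<lfloor>Q\<rfloor>}. {0..q})"

lemma arcs_eq_UN:
  "arcs k Q P S = {0..<1} \<inter> (\<Union>(q, a)\<in>{(q, a)\<in>arc_index Q. coprime a q \<and> S q}.
      {(real a - Q * P powr (- real k)) / real q..(real a + Q * P powr (- real k)) / real q})"
proof -
  have "\<bar>real q * \<alpha> - real a\<bar> \<le> \<delta> \<longleftrightarrow> \<alpha> \<in> {(real a - \<delta>) / real q..(real a + \<delta>) / real q}" if "1 \<le> q" for q a :: nat and \<alpha> \<delta>
    using that by (auto simp: field_simps abs_le_iff)
  moreover have "(q, a) \<in> arc_index Q \<longleftrightarrow> 1 \<le> q \<and> real q \<le> Q \<and> a \<le> q" for q a
  proof -
    have "q \<le> nat \<lfloor>Q\<rfloor> \<longleftrightarrow> real q \<le> Q" if "1 \<le> q"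
    proof
      assume q: "q \<le> nat \<lfloor>Q\<rfloor>"
      then have "\<lfloor>Q\<rfloor> \<ge> int q" using that by linarith
      then show "real q \<le> Q" by (simp add: le_floor_iff)
    qed (rule le_nat_floor)
    then show ?thesis unfolding arc_index_def by auto
  qed
  ultimately show ?thesis unfolding arcs_def by (auto split: prod.splits) blast+
qed

lemma finite_arc_index [simp]: "finite (arc_index Q)"
  unfolding arc_index_def by simp

lemma arcs_measurable: "arcs k Q P S \<in> sets lebesgue"
proof -
  have "finite {(q, a)\<in>arc_index Q. coprime a q \<and> S q}"
    by (rule finite_subset[OF _ finite_arc_index[of Q]]) auto
  then show ?thesis unfolding arcs_eq_UN by (intro sets.Int sets.finite_UN) auto
qed

lemma arcs_subset: "arcs k Q P S \<subseteq> {0..1}"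
  unfolding arcs_def by auto

lemma arcs_lmeasurable: "arcs k Q P S \<in> lmeasurable"
  by (rule bounded_set_imp_lmeasurable[OF bounded_subset[OF _ arcs_subset] arcs_measurable]) simp

text \<open>Each q has q + 1 <= 2 q numerators a, and each interval has length 2 \<delta> / q; thus
  every q <= Q contributes at most 4 \<delta>.\<close>

lemma measure_arcs_le:
  assumes Q: "Q \<ge> 1"
  shows "measure lebesgue (arcs k Q P S) \<le> 4 * Q\<^sup>2 * P powr (- real k)"
proof -
  define \<delta> where "\<delta> = Q * P powr (- real k)"
  have \<delta>: "\<delta> \<ge> 0" unfolding \<delta>_def using Q by simp
  define I where "I = (\<lambda>(q::nat, a::nat). {(real a - \<delta>) / real q..(real a + \<delta>) / real q})"
  have I: "I t \<in> lmeasurable" for t unfolding I_def by (auto split: prod.splits)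
  have "measure lebesgue (arcs k Q P S) \<le> measure lebesgue (\<Union>t\<in>arc_index Q. I t)"
  proof (rule measure_mono_fmeasurable)
    show "arcs k Q P S \<subseteq> (\<Union>t\<in>arc_index Q. I t)" unfolding arcs_eq_UN I_def \<delta>_def by auto
    show "(\<Union>t\<in>arc_index Q. I t) \<in> lmeasurable" by (intro fmeasurable.finite_UN I) auto
  qed (rule arcs_measurable)
  also have "\<dots> \<le> (\<Sum>t\<in>arc_index Q. measure lebesgue (I t))"
    using I by (intro measure_UNION_le) auto
  also have "\<dots> = (\<Sum>q\<in>{1..nat \<lfloor>Q\<rfloor>}. \<Sum>a\<in>{0..q}. measure lebesgue (I (q, a)))"
    unfolding arc_index_def by (subst sum.Sigma) (auto simp: split_def)
  also have "\<dots> \<le> (\<Sum>q\<in>{1..nat \<lfloor>Q\<rfloor>}. 4 * \<delta>)"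
  proof (rule sum_mono)
    fix q assume q: "q \<in> {1..nat \<lfloor>Q\<rfloor>}"
    have "measure lebesgue (I (q, a)) = 2 * \<delta> / real q" for a
    proof -
      have "(real a - \<delta>) / real q \<le> (real a + \<delta>) / real q" using \<delta> q by (intro divide_right_mono) auto
      then have "measure lebesgue (I (q, a)) = (real a + \<delta>) / real q - (real a - \<delta>) / real q"
        unfolding I_def by simp
      then show ?thesis by (simp add: diff_divide_distrib[symmetric])
    qed
    then have "(\<Sum>a\<in>{0..q}. measure lebesgue (I (q, a))) = (real q + 1) * (2 * \<delta> / real q)" by simp
    also have "\<dots> \<le> (2 * real q) * (2 * \<delta> / real q)" using q \<delta> by (intro mult_right_mono) auto
    also have "\<dots> = 4 * \<delta>" using q by simp
    finally show "(\<Sum>a\<in>{0..q}. measure lebesgue (I (q, a))) \<le> 4 * \<delta>" .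
  qed
  also have "\<dots> = real (nat \<lfloor>Q\<rfloor>) * (4 * \<delta>)" by simp
  also have "\<dots> \<le> Q * (4 * \<delta>)" using Q \<delta> by (intro mult_right_mono of_nat_floor) auto
  finally show ?thesis unfolding \<delta>_def by (simp add: power2_eq_square mult_ac)
qed

text \<open>As \<open>l\<close> is coprime to the denominators, multiplication by \<open>l ^ k\<close> permutes the reduced fractions modulo one,
  and the dilated arcs remain disjoint.\<close>
lemma arcs_dilate_unique:
  fixes k l :: nat and P Q \<theta> :: real
  assumes l: "l \<ge> 1" and P: "P \<ge> 1" and Q: "Q \<ge> 1" and V: "4 * Q\<^sup>2 \<le> (P / real l) ^ k"
    and i: "(\<theta> + real i) / real (l ^ k) \<in> arcs k Q P (coprime l)" "i < l ^ k"
    and j: "(\<theta> + real j) / real (l ^ k) \<in> arcs k Q P (coprime l)" "j < l ^ k"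
  shows "i = j"
proof -
  define m where "m = l ^ k"
  have m: "m > 0" unfolding m_def using l by simp
  define V where "V = (P / real l) ^ k"
  have V0: "V > 0" unfolding V_def using P l by simp
  have PV: "real m * P powr (- real k) = 1 / V"
    unfolding V_def m_def using P by (simp add: powr_minus_divide powr_realpow power_divide)
  have ex: "\<exists>q a::nat. 1 \<le> q \<and> real q \<le> Q \<and> coprime a q \<and> coprime l q \<and> 
      \<bar>real q * (\<theta> + real n) - real (m * a)\<bar> \<le> Q / V"
    if n: "(\<theta> + real n) / real m \<in> arcs k Q P (coprime l)" for n
  proof -
    obtain q a :: nat where qa: "1 \<le> q" "real q \<le> Q" "coprime a q" "coprime l q"
      "\<bar>real q * ((\<theta> + real n) / real m) - real a\<bar> \<le> Q * P powr (- real k)"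
      using n unfolding arcs_def by blast
    have "real q * (\<theta> + real n) - real (m * a) = real m * (real q * ((\<theta> + real n) / real m) - real a)"
      using m by (simp add: field_simps)
    then have "\<bar>real q * (\<theta> + real n) - real (m * a)\<bar> = real m * \<bar>real q * ((\<theta> + real n) / real m) - real a\<bar>"
      by (simp add: abs_mult)
    also have "\<dots> \<le> real m * (Q * P powr (- real k))" using qa by (intro mult_left_mono) auto
    also have "\<dots> = Q * (real m * P powr (- real k))" by simp
    also have "\<dots> = Q / V" unfolding PV by simp
    finally show ?thesis using qa by blast
  qed
  obtain q1 a1 where 1: "1 \<le> q1" "real q1 \<le> Q" "coprime a1 q1" "coprime l q1" 
      "\<bar>real q1 * (\<theta> + real i) - real (m * a1)\<bar> \<le> Q / V"
    using ex[OF i(1)[folded m_def]] by blast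
  obtain q2 a2 where 2: "1 \<le> q2" "real q2 \<le> Q" "coprime a2 q2" "coprime l q2" 
      "\<bar>real q2 * (\<theta> + real j) - real (m * a2)\<bar> \<le> Q / V"
    using ex[OF j(1)[folded m_def]] by blast
  \<comment> \<open>The integer that remains when \<theta> is eliminated from the two
    approximations. Each error contributes at most Q^2 / V <= 1/4.\<close>
  define z where "z = int (q1 * q2) * (int i - int j) - int m * (int (a1 * q2) - int (a2 * q1))"
  have "real_of_int z = real q2 * (real q1 * (\<theta> + real i) - real (m * a1)) - real q1 * (real q2 * (\<theta> + real j) - real (m * a2))"
    unfolding z_def by (simp add: algebra_simps)
  then have "\<bar>real_of_int z\<bar> \<le> real q2 * \<bar>real q1 * (\<theta> + real i) - real (m * a1)\<bar> + real q1 * \<bar>real q2 * (\<theta> + real j) - real (m * a2)\<bar>"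
    by (simp only:) (rule order_trans[OF abs_triangle_ineq4], simp add: abs_mult)
  also have "\<dots> \<le> Q * (Q / V) + Q * (Q / V)" using 1 2 Q by (intro add_mono mult_mono) auto
  also have "\<dots> \<le> 1 / 2" using V V0 unfolding V_def[symmetric] by (simp add: field_simps power2_eq_square)
  finally have "\<bar>real_of_int z\<bar> < 1" by simp
  then have "z = 0" by linarith
  then have eq: "int (q1 * q2) * (int i - int j) = int m * (int (a1 * q2) - int (a2 * q1))" unfolding z_def by simp
  have cop: "coprime (int m) (int q1)" "coprime (int m) (int q2)" "coprime (int a1) (int q1)" "coprime (int a2) (int q2)"
    unfolding m_def coprime_int_iff using 1 2 by auto
  \<comment> \<open>z = 0 makes q1 divide m a1 q2, and q1 is coprime to m and to a1. By symmetry the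
    denominators agree.\<close>
  have d1: "int q1 dvd int q2"
  proof -
    have "int m * int a1 * int q2 = int q1 * (int q2 * (int i - int j) + int m * int a2)"
      using eq by (simp add: algebra_simps)
    then have "int q1 dvd int m * int a1 * int q2" by simp
    moreover have "coprime (int q1) (int m * int a1)" using cop by (simp add: coprime_commute)
    ultimately show ?thesis by (simp add: coprime_dvd_mult_right_iff)
  qed
  have d2: "int q2 dvd int q1"
  proof -
    have "int m * int a2 * int q1 = int q2 * (int m * int a1 - int q1 * (int i - int j))"
      using eq by (simp add: algebra_simps)
    then have "int q2 dvd int m * int a2 * int q1" by simp
    moreover have "coprime (int q2) (int m * int a2)" using cop by (simp add: coprime_commute)
    ultimately show ?thesis by (simp add: coprime_dvd_mult_right_iff)
  qed
  \<comment> \<open>After cancelling the common denominator, m divides q1 (i - j), hence i - j,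
    which is smaller than m in absolute value.\<close>
  have "q1 = q2" using d1 d2 by (simp add: dvd_antisym)
  then have "int q1 * (int q1 * (int i - int j)) = int q1 * (int m * (int a1 - int a2))"
    using eq by (simp add: algebra_simps)
  then have "int q1 * (int i - int j) = int m * (int a1 - int a2)" using 1(1) by simp
  then have "int m dvd int q1 * (int i - int j)" by simp
  then have dv: "int m dvd int i - int j" using cop(1) by (simp add: coprime_dvd_mult_right_iff)
  have "\<bar>int i - int j\<bar> < int m" using i(2) j(2) unfolding m_def[symmetric] by linarith
  then have "int i - int j = 0" using dv dvd_imp_le_int[of "int i - int j" "int m"] by auto
  then show ?thesis by simp
qed

text \<open>The allowed primes are all primes up to p and the primes of q above p. Splitting off the
  part h made of the latter leaves an ordinary p-smooth Weyl sum, to which a mean value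
  applies.\<close>

lemma low_primes_sum_bound:
  assumes p: "p \<in> coprime_primes_upto R q" 
  shows "cmod (\<Sum>y\<in>psmooth (low_primes (primes_upto R) (coprime_primes_upto R q) p) X. ee (\<alpha> * real (l * y) ^ k)) \<le>
    (\<Sum>h\<in>psmooth {p'\<in>primes_upto R. p' dvd q \<and> p < p'} X. cmod (weyl_f k (X / real h) (real p) (real (l ^ k) * \<alpha> * real (h ^ k))))"
proof -
  define A where "A = {p'\<in>primes_upto R. p' dvd q \<and> p < p'}"
  define B where "B = {p'\<in>primes_upto R. p' \<le> p}"
  have eq: "low_primes (primes_upto R) (coprime_primes_upto R q) p = A \<union> B"
    unfolding low_primes_def A_def B_def coprime_primes_upto_def by auto
  have disj: "A \<inter> B = {}" unfolding A_def B_def by auto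
  have "p' \<in> B \<longleftrightarrow> real p' \<le> real p" if "prime p'" for p'
    using p that unfolding B_def coprime_primes_upto_def primes_upto_def by auto
  then have sm: "psmooth B Z = smooth_set Z (real p)" for Z
    unfolding smooth_set_psmooth psmooth_def primes_in_def by blast
  have "(\<Sum>y\<in>psmooth (A \<union> B) X. ee (\<alpha> * real (l * y) ^ k)) = 
     (\<Sum>h\<in>psmooth A X. \<Sum>z\<in>psmooth B (X / real h). ee (\<alpha> * real (l * (h * z)) ^ k))"
    by (rule sum_psmooth_union[OF disj])
  also have "\<dots> = (\<Sum>h\<in>psmooth A X. weyl_f k (X / real h) (real p) (real (l ^ k) * \<alpha> * real (h ^ k)))"
  proof (rule sum.cong[OF refl])
    fix h
    have "\<alpha> * real (l * (h * z)) ^ k = real (l ^ k) * \<alpha> * real (h ^ k) * real z ^ k" for z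
      by (simp add: power_mult_distrib)
    then show "(\<Sum>z\<in>psmooth B (X / real h). ee (\<alpha> * real (l * (h * z)) ^ k)) =
        weyl_f k (X / real h) (real p) (real (l ^ k) * \<alpha> * real (h ^ k))"
      unfolding weyl_f_def sm by (simp only:)
  qed
  finally show ?thesis unfolding eq A_def[symmetric] by (simp only: norm_sum)
qed

text \<open>An index set free of q that contains every (p, l, h) that can occur; being the same for
  all \<alpha>, it can be taken out of the integral.\<close>

definition triples :: "real \<Rightarrow> real \<Rightarrow> real \<Rightarrow> (nat \<times> nat \<times> nat) set" where
  "triples P R L = (SIGMA p:primes_upto R. SIGMA l:{l. 1 \<le> l \<and> L < real l \<and> real l \<le> L * R}. {h. 1 \<le> h \<and> real h \<le> P / real l})"

definition dilated_moment :: "nat \<Rightarrow> real \<Rightarrow> real \<Rightarrow> nat \<times> nat \<times> nat \<Rightarrow> real \<Rightarrow> real" where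
  "dilated_moment k u P = (\<lambda>(p, l, h) \<theta>. cmod (weyl_f k (P / real l / real h) (real p) (\<theta> * real (h ^ k))) powr u)"

lemma finite_nat_real_le: "finite {h::nat. Q h \<and> real h \<le> x}"
  by (rule finite_subset[of _ "{..nat \<lfloor>x\<rfloor>}"]) (auto simp: le_nat_floor)

lemma finite_l_range: "finite {l::nat. 1 \<le> l \<and> L < real l \<and> real l \<le> L * R}"
  using finite_nat_real_le[of "\<lambda>l. 1 \<le> l \<and> L < real l" "L * R"] by (simp add: conj_assoc)

lemma card_nat_real_le:
  assumes "x \<ge> 0" shows "real (card {h::nat. 1 \<le> h \<and> S h \<and> real h \<le> x}) \<le> x"
proof -
  have "card {h::nat. 1 \<le> h \<and> S h \<and> real h \<le> x} \<le> card {1..nat \<lfloor>x\<rfloor>}"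
    by (rule card_mono) (auto simp: le_nat_floor)
  then have "real (card {h::nat. 1 \<le> h \<and> S h \<and> real h \<le> x}) \<le> real (nat \<lfloor>x\<rfloor>)" by simp
  also have "\<dots> \<le> x" using assms by (rule of_nat_floor)
  finally show ?thesis .
qed

lemma finite_primes_upto: "R \<ge> 0 \<Longrightarrow> finite (primes_upto R)"
  using card_primes_le(1)[of "primes_upto R" R] unfolding primes_upto_def by simp

lemma finite_triples: "R \<ge> 0 \<Longrightarrow> finite (triples P R L)"
  unfolding triples_def by (intro finite_SigmaI finite_primes_upto finite_l_range finite_nat_real_le)

text \<open>Hoelder's inequality over the triples belonging to one denominator q of \<alpha>. Their
  number involves H, the small count of h composed of primes of q, and the enlargement to all
  triples comes afterwards.\<close>

lemma weyl_powr_pointwise: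
  assumes P: "P \<ge> 1" and R: "R \<ge> 1" and L: "L \<ge> 1" and u: "u \<ge> 2" and H0: "H \<ge> 0"
    and H: "\<And>q. 1 \<le> q \<Longrightarrow> real q \<le> Q \<Longrightarrow> real (card (psmooth {p. p dvd q} P)) \<le> H"
    and \<alpha>: "\<alpha> \<in> major_arcs k Q P"
  shows "cmod (weyl_f k P R \<alpha>) powr u \<le> 2 powr (u - 1) * ((R * (L * R) * H) powr (u - 1) *
     (\<Sum>t\<in>triples P R L. if \<alpha> \<in> arcs k Q P (coprime (fst (snd t))) then dilated_moment k u P t (real (fst (snd t) ^ k) * \<alpha>) else 0)
     + (L * H) powr u)"
proof -
  obtain q d :: nat where qd: "1 \<le> q" "real q \<le> Q" "d \<le> q" "coprime d q" "\<bar>real q * \<alpha> - real d\<bar> \<le> Q * P powr (- real k)"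
    and \<alpha>01: "0 \<le> \<alpha>" "\<alpha> < 1"
    using \<alpha> unfolding major_arcs_def by blast
  define Qs where "Qs = coprime_primes_upto R q"
  define A where "A p = {p'\<in>primes_upto R. p' dvd q \<and> p < p'}" for p
  define W where "W = (\<lambda>(p::nat, l::nat, h::nat). cmod (weyl_f k (P / real l / real h) (real p) (real (l ^ k) * \<alpha> * real (h ^ k))))"
  define T where "T = (SIGMA p:Qs. SIGMA l:block Qs L p. psmooth (A p) (P / real l))"
  have finQ: "finite Qs" "real (card Qs) \<le> R" using card_coprime_primes_upto[of R q] R unfolding Qs_def by auto
  have finT: "finite T" unfolding T_def using finQ by (intro finite_SigmaI) auto
  have W0: "W t \<ge> 0" for t unfolding W_def by (auto split: prod.splits)
  have lf: "l \<ge> 1" "coprime l q" "L < real l" "real l \<le> L * R" if "p \<in> Qs" "l \<in> block Qs L p" for p l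
    using block_facts[OF that(2)[unfolded Qs_def] that(1)[unfolded Qs_def] L] by auto
  have cardA: "real (card (psmooth (A p) (P / real l))) \<le> H" if "p \<in> Qs" "l \<in> block Qs L p" for p l
  proof -
    have "P / real l \<le> P / 1" using lf[OF that] P by (intro divide_left_mono) auto
    then have "psmooth (A p) (P / real l) \<subseteq> psmooth {p. p dvd q} P" by (intro psmooth_mono) (auto simp: A_def)
    then have "real (card (psmooth (A p) (P / real l))) \<le> real (card (psmooth {p. p dvd q} P))" by (simp add: card_mono)
    then show ?thesis using H[OF qd(1,2)] by linarith
  qed
  have cardT: "real (card T) \<le> R * (L * R) * H"
  proof -
    have "real (card T) = (\<Sum>p\<in>Qs. \<Sum>l\<in>block Qs L p. real (card (psmooth (A p) (P / real l))))"
      unfolding T_def using finQ by (subst card_SigmaI; simp)+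
    also have "\<dots> \<le> (\<Sum>p\<in>Qs. (L * R) * H)"
    proof (rule sum_mono)
      fix p assume p: "p \<in> Qs"
      have "(\<Sum>l\<in>block Qs L p. real (card (psmooth (A p) (P / real l)))) \<le> (\<Sum>l\<in>block Qs L p. H)"
        using p by (intro sum_mono cardA)
      also have "\<dots> = real (card (block Qs L p)) * H" by simp
      also have "\<dots> \<le> (L * R) * H" using card_block_le[of p R q L] p L R H0 unfolding Qs_def by (intro mult_right_mono) auto
      finally show "(\<Sum>l\<in>block Qs L p. real (card (psmooth (A p) (P / real l)))) \<le> (L * R) * H" .
    qed
    also have "\<dots> = real (card Qs) * ((L * R) * H)" by simp
    also have "\<dots> \<le> R * ((L * R) * H)" using finQ L R H0 by (intro mult_right_mono) auto
    finally show ?thesis by (simp add: mult.assoc)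
  qed
  define SS where "SS = (\<Sum>t\<in>T. W t)"
  have SS0: "SS \<ge> 0" unfolding SS_def by (intro sum_nonneg W0)
  have "cmod (weyl_f k P R \<alpha>) \<le> (\<Sum>p\<in>Qs. \<Sum>l\<in>block Qs L p.
       cmod (\<Sum>y\<in>psmooth (low_primes (primes_upto R) Qs p) (P / real l). ee (\<alpha> * real (l * y) ^ k)))
     + L * real (card (psmooth {p. p dvd q} P))"
    unfolding Qs_def using R by (intro weyl_f_decomposition L) auto
  also have "\<dots> \<le> (\<Sum>p\<in>Qs. \<Sum>l\<in>block Qs L p. \<Sum>h\<in>psmooth (A p) (P / real l). W (p, l, h)) + L * H"
  proof (intro add_mono mult_left_mono sum_mono H qd)
    fix p l assume "p \<in> Qs" "l \<in> block Qs L p"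
    then show "cmod (\<Sum>y\<in>psmooth (low_primes (primes_upto R) Qs p) (P / real l). ee (\<alpha> * real (l * y) ^ k))
       \<le> (\<Sum>h\<in>psmooth (A p) (P / real l). W (p, l, h))"
      unfolding W_def A_def Qs_def prod.case by (intro low_primes_sum_bound)
  qed (use L in auto)
  also have "(\<Sum>p\<in>Qs. \<Sum>l\<in>block Qs L p. \<Sum>h\<in>psmooth (A p) (P / real l). W (p, l, h)) = SS"
  proof -
    have "(\<Sum>p\<in>Qs. \<Sum>l\<in>block Qs L p. \<Sum>h\<in>psmooth (A p) (P / real l). W (p, l, h)) = 
       (\<Sum>p\<in>Qs. \<Sum>(l, h)\<in>(SIGMA l:block Qs L p. psmooth (A p) (P / real l)). W (p, l, h))"
      by (intro sum.cong refl sum.Sigma) auto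
    also have "\<dots> = (\<Sum>(p, l, h)\<in>T. W (p, l, h))" unfolding T_def using finQ by (intro sum.Sigma) auto
    finally show ?thesis unfolding SS_def by simp
  qed
  finally have "cmod (weyl_f k P R \<alpha>) powr u \<le> (SS + L * H) powr u"
    using u by (intro powr_mono2) auto
  also have "\<dots> \<le> 2 powr (u - 1) * (SS powr u + (L * H) powr u)"
    using power_mean_powr[of "UNIV :: bool set" u "\<lambda>b. if b then SS else L * H"] u SS0 L H0
    by (simp add: UNIV_bool add.commute)
  also have "SS powr u \<le> real (card T) powr (u - 1) * (\<Sum>t\<in>T. W t powr u)"
    unfolding SS_def using u by (intro power_mean_powr finT W0) auto
  also have "\<dots> \<le> (R * (L * R) * H) powr (u - 1) * (\<Sum>t\<in>T. W t powr u)"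
    using cardT u by (intro mult_right_mono powr_mono2 sum_nonneg) auto
  \<comment> \<open>Since l is coprime to q, \<alpha> lies in the arcs with denominators coprime to
    l, so the indicator is 1 on \<open>T\<close>; the added terms are nonnegative.\<close>
  also have "(\<Sum>t\<in>T. W t powr u) \<le> (\<Sum>t\<in>triples P R L. if \<alpha> \<in> arcs k Q P (coprime (fst (snd t))) then dilated_moment k u P t (real (fst (snd t) ^ k) * \<alpha>) else 0)"
  proof -
    have "T \<subseteq> triples P R L"
      unfolding T_def triples_def Qs_def[symmetric] using lf
      by (auto simp: psmooth_def primes_in_def Qs_def coprime_primes_upto_def)
    moreover have "\<alpha> \<in> arcs k Q P (coprime (fst (snd t)))" if "t \<in> T" for t
    proof -
      have "coprime (fst (snd t)) q" using that lf unfolding T_def by auto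
      then show ?thesis unfolding arcs_def using qd \<alpha>01 by blast
    qed
    ultimately have "(\<Sum>t\<in>T. W t powr u) = (\<Sum>t\<in>T. if \<alpha> \<in> arcs k Q P (coprime (fst (snd t))) then dilated_moment k u P t (real (fst (snd t) ^ k) * \<alpha>) else 0)"
      by (intro sum.cong refl) (auto simp: W_def dilated_moment_def split: prod.splits)
    also have "\<dots> \<le> (\<Sum>t\<in>triples P R L. if \<alpha> \<in> arcs k Q P (coprime (fst (snd t))) then dilated_moment k u P t (real (fst (snd t) ^ k) * \<alpha>) else 0)"
      using \<open>T \<subseteq> triples P R L\<close> R by (intro sum_mono2 finite_triples) (auto simp: dilated_moment_def split: prod.splits)
    finally show ?thesis .
  qed
  finally show ?thesis by (simp add: mult_left_mono)
qed

text \<open>Integrating the pointwise bound, each triple gains 1 / l^k, because multiplication by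
  l^k is injective on the arcs with denominators coprime to l. The exceptional numbers are
  multiplied by the measure of the arcs.\<close>

lemma weyl_powr_integral:
  fixes k :: nat
  assumes k: "k \<ge> 1" and P: "P \<ge> 1" and R: "R \<ge> 1" and L: "L \<ge> 1" and u: "u \<ge> 2" and H0: "H \<ge> 0" and Q: "Q \<ge> 1"
    and H: "\<And>q. 1 \<le> q \<Longrightarrow> real q \<le> Q \<Longrightarrow> real (card (psmooth {p. p dvd q} P)) \<le> H"
    and V: "4 * Q\<^sup>2 \<le> (P / (L * R)) ^ k"
  shows "integral (major_arcs k Q P) (\<lambda>\<alpha>. cmod (weyl_f k P R \<alpha>) powr u) \<le>
     2 powr (u - 1) * ((R * (L * R) * H) powr (u - 1) *
     (\<Sum>(p, l, h)\<in>triples P R L. U_mean k u (P / real l / real h) (real p) / real (l ^ k))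
     + (L * H) powr u * (4 * Q\<^sup>2 * P powr (- real k)))"
proof -
  define M where "M = major_arcs k Q P"
  have M: "M \<in> sets lebesgue" "M \<subseteq> {0..1}" "M \<in> lmeasurable" "measure lebesgue M \<le> 4 * Q\<^sup>2 * P powr (- real k)"
    unfolding M_def major_arcs_eq
    using arcs_measurable arcs_subset arcs_lmeasurable measure_arcs_le[OF Q] by auto
  define a where "a t = fst (snd t)" for t :: "nat \<times> nat \<times> nat"
  define N where "N t = arcs k Q P (coprime (a t))" for t
  define F where "F t \<alpha> = (if \<alpha> \<in> N t then dilated_moment k u P t (real (a t ^ k) * \<alpha>) else 0)" for t \<alpha>
  define c where "c = (R * (L * R) * H) powr (u - 1)"
  define d where "d = (L * H) powr u"
  have NM: "N t \<subseteq> M" for t unfolding N_def M_def major_arcs_eq arcs_def by blast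
  have Nmeas: "N t \<in> sets lebesgue" "N t \<subseteq> {0..1}" for t
    unfolding N_def using arcs_measurable arcs_subset by auto
  have contd: "continuous_on UNIV (dilated_moment k u P t)" for t
    unfolding dilated_moment_def using u
    by (cases t) (auto intro!: continuous_on_weyl_powr continuous_intros)
  have contl: "continuous_on {0..1} (\<lambda>\<alpha>. dilated_moment k u P t (real (a t ^ k) * \<alpha>))" for t
    by (intro continuous_on_compose2[OF contd] continuous_intros) auto
  have Fint: "F t integrable_on M" for t
  proof -
    have "N t \<inter> M = N t" using NM by blast
    then show ?thesis
      unfolding F_def integrable_restrict_Int using continuous_integrable_on_subset[OF contl Nmeas] by simp
  qed
  have FI: "integral M (F t) \<le> (case t of (p, l, h) \<Rightarrow> U_mean k u (P / real l / real h) (real p) / real (l ^ k))"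
    if t: "t \<in> triples P R L" for t
  proof -
    obtain p l h where e: "t = (p, l, h)" by (metis prod_cases3)
    have l: "1 \<le> l" "real l \<le> L * R" "1 \<le> h" using t unfolding e triples_def by auto
    have "integral M (F t) = integral (N t) (\<lambda>\<alpha>. dilated_moment k u P t (real (a t ^ k) * \<alpha>))"
    proof -
      have "N t \<inter> M = N t" using NM[of t] by blast
      then show ?thesis unfolding F_def Henstock_Kurzweil_Integration.integral_restrict_Int by (simp only:)
    qed
    also have "\<dots> \<le> integral {0..1} (dilated_moment k u P t) / real (a t ^ k)"
    proof (rule integral_dilate_le[OF contd])
      show "dilated_moment k u P t (x + real j) = dilated_moment k u P t x" for x j
      proof -
        have "(x + real j) * real (h ^ k) = x * real (h ^ k) + real (j * h ^ k)" by (simp add: distrib_right)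
        then show ?thesis unfolding dilated_moment_def e by (simp only: prod.case weyl_f_add_nat)
      qed
      show "1 \<le> a t ^ k" using l unfolding a_def e by simp
      show "dilated_moment k u P t x \<ge> 0" for x unfolding dilated_moment_def e by simp
      show "N t \<in> sets lebesgue" "N t \<subseteq> {0..1}" by (rule Nmeas)+
      fix \<theta> i j
      assume ij: "(\<theta> + real i) / real (a t ^ k) \<in> N t" "(\<theta> + real j) / real (a t ^ k) \<in> N t" "i < a t ^ k" "j < a t ^ k"
      have "P / (L * R) \<le> P / real l" using l P L R by (intro divide_left_mono) auto
      then have "(P / (L * R)) ^ k \<le> (P / real l) ^ k" using P L R by (intro power_mono) auto
      then have "4 * Q\<^sup>2 \<le> (P / real l) ^ k" using V by linarith
      from arcs_dilate_unique[OF l(1) P Q this] ij show "i = j"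
        unfolding N_def a_def e by simp
    qed
    \<comment> \<open>The second dilation, by h^k, takes place over a full period and leaves the
      integral unchanged.\<close>
    also have "integral {0..1} (dilated_moment k u P t) = U_mean k u (P / real l / real h) (real p)"
    proof -
      have "dilated_moment k u P t = (\<lambda>\<theta>. (\<lambda>\<beta>. cmod (weyl_f k (P / real l / real h) (real p) \<beta>) powr u) (real (h ^ k) * \<theta>))"
        unfolding dilated_moment_def e by (simp add: mult.commute)
      then show ?thesis unfolding U_mean_def
        using u l by (simp only:) (intro integral_dilate continuous_on_weyl_powr continuous_intros, auto simp: weyl_f_add_nat)
    qed
    finally show ?thesis unfolding a_def e by simp
  qed
  have intc: "(\<lambda>_. x) integrable_on M" for x :: real
    using continuous_integrable_on_subset[of "\<lambda>_. x" M] M by auto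
  have intS: "(\<lambda>\<alpha>. \<Sum>t\<in>triples P R L. F t \<alpha>) integrable_on M"
    using R by (intro integrable_sum finite_triples Fint) auto
  have "integral M (\<lambda>\<alpha>. cmod (weyl_f k P R \<alpha>) powr u) \<le>
     integral M (\<lambda>\<alpha>. 2 powr (u - 1) * (c * (\<Sum>t\<in>triples P R L. F t \<alpha>) + d))"
  proof (rule integral_le)
    show "(\<lambda>\<alpha>. cmod (weyl_f k P R \<alpha>) powr u) integrable_on M"
      using u M by (intro continuous_integrable_on_subset continuous_on_weyl_powr continuous_intros) auto
    show "(\<lambda>\<alpha>. 2 powr (u - 1) * (c * (\<Sum>t\<in>triples P R L. F t \<alpha>) + d)) integrable_on M"
      by (intro integrable_on_mult_right integrable_add intS intc)
    show "cmod (weyl_f k P R \<alpha>) powr u \<le> 2 powr (u - 1) * (c * (\<Sum>t\<in>triples P R L. F t \<alpha>) + d)" if "\<alpha> \<in> M" for \<alpha>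
      using weyl_powr_pointwise[OF P R L u H0 H that[unfolded M_def]]
      unfolding c_def d_def F_def N_def a_def by simp
  qed
  also have "\<dots> = 2 powr (u - 1) * (c * (\<Sum>t\<in>triples P R L. integral M (F t)) + d * measure lebesgue M)"
  proof -
    have "integral M (\<lambda>\<alpha>. c * (\<Sum>t\<in>triples P R L. F t \<alpha>) + d) = integral M (\<lambda>\<alpha>. c * (\<Sum>t\<in>triples P R L. F t \<alpha>)) + integral M (\<lambda>_. d)"
      by (intro integral_add integrable_on_mult_right intS intc)
    also have "integral M (\<lambda>_. d) = d * measure lebesgue M"
      using lmeasure_integral[OF M(3)] integral_mult_right[of M d "\<lambda>_. 1"] by simp
    also have "integral M (\<lambda>\<alpha>. c * (\<Sum>t\<in>triples P R L. F t \<alpha>)) = c * (\<Sum>t\<in>triples P R L. integral M (F t))"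
      using R by (simp add: integral_sum finite_triples Fint)
    finally show ?thesis by simp
  qed
  also have "\<dots> \<le> 2 powr (u - 1) * (c * (\<Sum>t\<in>triples P R L. (case t of (p, l, h) \<Rightarrow> U_mean k u (P / real l / real h) (real p) / real (l ^ k)))
      + d * (4 * Q\<^sup>2 * P powr (- real k)))"
    using M(4) FI by (intro mult_left_mono add_mono sum_mono) (auto simp: c_def d_def)
  finally show ?thesis unfolding M_def c_def d_def .
qed

text \<open>The mean value at length P / (l h) decays like h^(-\<kappa>), so the sum over h is at
  most harmonic. The sums over p and l are estimated by their numbers of terms.\<close>

lemma triples_sum_bound:
  fixes k :: nat
  assumes P: "P \<ge> 1" and R: "R \<ge> 1" and L: "L \<ge> 1" and Y: "Y \<ge> 1" "P = L * (R * Y)" and \<kappa>: "\<kappa> \<ge> 1" and AC: "A \<ge> 0" "C > 0"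
    "\<And>Y R. Y \<ge> 1 \<Longrightarrow> R \<ge> 1 \<Longrightarrow> U_mean k u Y R \<le> C * R powr A * Y powr \<kappa>"
  shows "(\<Sum>(p, l, h)\<in>triples P R L. U_mean k u (P / real l / real h) (real p) / real (l ^ k))
    \<le> R * (L * R) * (C * R powr A * (R * Y) powr \<kappa> * L powr (- real k) * (1 + ln P))"
proof -
  define I where "I = {l::nat. 1 \<le> l \<and> L < real l \<and> real l \<le> L * R}"
  define J where "J l = {h::nat. 1 \<le> h \<and> real h \<le> P / real l}" for l :: nat
  define B where "B = C * R powr A * (R * Y) powr \<kappa> * L powr (- real k)"
  have B0: "B \<ge> 0" unfolding B_def using AC by simp
  have lnP: "1 + ln P \<ge> 0" using P by simp
  have each: "U_mean k u (P / real l / real h) (real p) / real (l ^ k) \<le> B * (1 / real h)"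
    if p: "p \<in> primes_upto R" and l: "l \<in> I" and h: "h \<in> J l" for p l h
  proof -
    have l1: "1 \<le> l" "L < real l" and h1: "1 \<le> h" "real h \<le> P / real l" using l h unfolding I_def J_def by auto
    have p1: "real p \<ge> 1" "real p \<le> R" using p prime_ge_1_nat unfolding primes_upto_def by fastforce+
    define Z where "Z = P / real l / real h"
    have Z1: "Z \<ge> 1" unfolding Z_def using h1 l1 by (simp add: field_simps)
    have "U_mean k u Z (real p) \<le> C * real p powr A * Z powr \<kappa>" using AC(3) Z1 p1 by blast
    also have "\<dots> \<le> C * R powr A * ((R * Y) powr \<kappa> * (1 / real h))"
    proof (intro mult_mono powr_mono2)
      have "Z powr \<kappa> = (P / real l) powr \<kappa> * real h powr (- \<kappa>)"
        unfolding Z_def by (simp add: powr_divide powr_mult powr_minus_divide)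
      \<comment> \<open>P / l is at most R Y because l > L, and \<kappa> >= 1 replaces h^(-\<kappa>)
        by 1 / h.\<close>
      also have "\<dots> \<le> (R * Y) powr \<kappa> * real h powr (- 1)"
      proof (intro mult_mono powr_mono2 powr_mono)
        have "P / real l \<le> P / L" using l1 L P by (intro divide_left_mono) auto
        then show "P / real l \<le> R * Y" using Y L by simp
      qed (use P l1 h1 \<kappa> in auto)
      finally show "Z powr \<kappa> \<le> (R * Y) powr \<kappa> * (1 / real h)" using h1 by (simp add: powr_minus_divide)
    qed (use AC p1 in auto)
    finally have "U_mean k u Z (real p) \<le> C * R powr A * ((R * Y) powr \<kappa> * (1 / real h))" .
    then have "U_mean k u Z (real p) * (1 / real (l ^ k)) \<le> (C * R powr A * ((R * Y) powr \<kappa> * (1 / real h))) * L powr (- real k)"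
    proof (intro mult_mono)
      have "L ^ k \<le> real l ^ k" using l1 L by (intro power_mono) auto
      then have "1 / real (l ^ k) \<le> 1 / L ^ k" using L by (simp add: frac_le)
      then show "1 / real (l ^ k) \<le> L powr (- real k)" using L by (simp add: powr_minus_divide powr_realpow)
    qed (use AC in auto)
    then show ?thesis unfolding Z_def B_def by (simp add: mult_ac)
  qed
  have sumh: "(\<Sum>h\<in>J l. B * (1 / real h)) \<le> B * (1 + ln P)" if l: "l \<in> I" for l
  proof -
    define n where "n = nat \<lfloor>P / real l\<rfloor>"
    have l1: "1 \<le> l" using l unfolding I_def by auto
    have "P / real l \<le> P / 1" using l1 P by (intro divide_left_mono) auto
    moreover have "real n \<le> P / real l" unfolding n_def using P by (intro of_nat_floor) auto
    ultimately have nP: "real n \<le> P" by simp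
    have "(\<Sum>h\<in>J l. 1 / real h) \<le> (\<Sum>h=1..n. 1 / real h)"
      unfolding J_def n_def by (intro sum_mono2) (auto simp: le_nat_floor)
    also have "\<dots> \<le> 1 + ln P"
    proof (cases "n = 0")
      case False
      then have "(\<Sum>h=1..n. 1 / real h) \<le> 1 + ln (real n)" by (intro sum_inverse_le_ln) auto
      also have "\<dots> \<le> 1 + ln P" using False nP by simp
      finally show ?thesis .
    qed (use lnP in simp)
    finally show ?thesis unfolding sum_distrib_left[symmetric] using B0 by (rule mult_left_mono)
  qed
  have finI: "finite I" unfolding I_def by (rule finite_l_range)
  have finJ: "finite (J l)" for l unfolding J_def by (rule finite_nat_real_le)
  have finp: "finite (primes_upto R)" "real (card (primes_upto R)) \<le> R"
    using card_primes_le[of "primes_upto R" R] R unfolding primes_upto_def by auto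
  have cardI: "real (card I) \<le> L * R" unfolding I_def using L R by (intro card_nat_real_le) auto
  have "(\<Sum>(p, l, h)\<in>triples P R L. U_mean k u (P / real l / real h) (real p) / real (l ^ k))
     = (\<Sum>p\<in>primes_upto R. \<Sum>l\<in>I. \<Sum>h\<in>J l. U_mean k u (P / real l / real h) (real p) / real (l ^ k))"
  proof -
    have "(\<Sum>p\<in>primes_upto R. \<Sum>l\<in>I. \<Sum>h\<in>J l. U_mean k u (P / real l / real h) (real p) / real (l ^ k))
      = (\<Sum>p\<in>primes_upto R. \<Sum>(l, h)\<in>(SIGMA l:I. J l). U_mean k u (P / real l / real h) (real p) / real (l ^ k))"
      using finI finJ by (intro sum.cong refl sum.Sigma) auto
    also have "\<dots> = (\<Sum>(p, l, h)\<in>triples P R L. U_mean k u (P / real l / real h) (real p) / real (l ^ k))"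
      unfolding triples_def I_def[symmetric] J_def[symmetric] using finp finI finJ by (intro sum.Sigma) auto
    finally show ?thesis by simp
  qed
  also have "\<dots> \<le> (\<Sum>p\<in>primes_upto R. \<Sum>l\<in>I. B * (1 + ln P))"
    by (intro sum_mono order_trans[OF sum_mono sumh] each)
  also have "\<dots> = real (card (primes_upto R)) * (real (card I) * (B * (1 + ln P)))" by simp
  also have "\<dots> \<le> R * ((L * R) * (B * (1 + ln P)))"
    using finp cardI B0 lnP R L by (intro mult_mono mult_right_mono) auto
  finally show ?thesis unfolding B_def by (simp only: mult.assoc)
qed

text \<open>Apart from R and small powers, the main term is L^(u-k) Y^\<kappa> with L = P / Y and
  \<kappa> = u - k + \<Delta>, that is P^(u-k) Y^\<Delta>. The exceptional numbers give L^u Y^k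
  P^(-k) = P^(u-k) Y^(k-u), which is no larger as \<Delta> >= k - u.\<close>

lemma major_arc_mean:
  fixes k :: nat
  assumes k: "k \<ge> 1" and u: "u \<ge> 2" and adm: "admissible_exponent k u \<Delta>" and \<epsilon>: "\<epsilon> > 0"
  obtains c a where "c \<ge> 0" "a \<ge> 0"
    "\<And>P R Q. P \<ge> 1 \<Longrightarrow> R \<ge> 1 \<Longrightarrow> 1 \<le> Q \<Longrightarrow> Q \<le> 1/2 * P powr (real k / 2) * R powr (- real k) \<Longrightarrow>
       integral (major_arcs k Q P) (\<lambda>\<alpha>. cmod (weyl_f k P R \<alpha>) powr u)
         \<le> c * R powr a * P powr (u - real k + \<epsilon>) * ((2 * Q) powr (2 / real k)) powr \<Delta>"
proof -
  define \<kappa> where "\<kappa> = u - real k + \<Delta>"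
  have \<kappa>: "\<kappa> \<ge> 1" using admissible_lower[OF adm u] u unfolding \<kappa>_def by linarith
  \<comment> \<open>Covers the power u - 1 of H, the logarithm from the sum over h and the surplus
    Y^\<delta> of the mean value: together \<delta> (u + 1).\<close>
  define \<delta> where "\<delta> = \<epsilon> / (u + 1)"
  have \<delta>: "\<delta> > 0" using \<epsilon> u unfolding \<delta>_def by simp
  have \<delta>\<epsilon>: "\<delta> * u + \<delta> = \<epsilon>"
  proof -
    have "\<delta> * (u + 1) = \<epsilon>" using u unfolding \<delta>_def by simp
    then show ?thesis by (simp add: distrib_left)
  qed
  obtain A C where AC: "A \<ge> 0" "C > 0"
    "\<And>Y R. Y \<ge> 1 \<Longrightarrow> R \<ge> 1 \<Longrightarrow> U_mean k u Y R \<le> C * R powr A * Y powr (\<kappa> + \<delta>)"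
    using admissible_uniform[OF adm u \<delta>] unfolding \<kappa>_def by blast
  obtain D where D: "D > 0" "\<And>P Q q. P \<ge> 1 \<Longrightarrow> 1 \<le> q \<Longrightarrow> real q \<le> Q \<Longrightarrow> Q \<le> P powr (real k / 2) \<Longrightarrow>
     real (card (psmooth {p. p dvd q} P)) \<le> D * P powr \<delta>"
    using dvd_count_bound[OF \<delta>, of k] by blast
  \<comment> \<open>The absolute value bounds the exponent of R^(-(u-k)) whatever the sign of u -
    k.\<close>
  define a where "a = 2 * u + A + (\<kappa> + \<delta>) + \<bar>u - real k\<bar>"
  define c1 where "c1 = D powr (u - 1) * C * (1 + 1 / \<delta>)"
  define c2 where "c2 = D powr u"
  have a0: "a \<ge> 0" unfolding a_def using u AC \<kappa> \<delta> by simp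
  have c0: "c1 \<ge> 0" "c2 \<ge> 0" unfolding c1_def c2_def using AC \<delta> by auto
  show ?thesis
  proof (rule that[of "2 powr (u - 1) * (c1 + c2)" a])
    show "2 powr (u - 1) * (c1 + c2) \<ge> 0" "a \<ge> 0" using a0 c0 by auto
    fix P R Q :: real
    assume P: "P \<ge> 1" and R: "R \<ge> 1" and Q: "1 \<le> Q" "Q \<le> 1/2 * P powr (real k / 2) * R powr (- real k)"
    define Y where "Y = (2 * Q) powr (2 / real k)"
    note Y = scale_facts[OF k P R Q, folded Y_def]
    define L where "L = P / (R * Y)"
    have L1: "L \<ge> 1" unfolding L_def by (rule Y(3))
    have PL: "P = L * (R * Y)" unfolding L_def using R Y(1) by simp
    define H where "H = D * P powr \<delta>"
    have H0: "H \<ge> 0" unfolding H_def using D by simp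
    have V: "4 * Q\<^sup>2 \<le> (P / (L * R)) ^ k"
    proof -
      have "P / (L * R) = Y" unfolding PL using L1 R by simp
      then show ?thesis using Y(4) by simp
    qed
    define S where "S = (\<Sum>(p, l, h)\<in>triples P R L. U_mean k u (P / real l / real h) (real p) / real (l ^ k))"
    have Lp: "L powr x = P powr x * R powr (- x) * Y powr (- x)" for x
      unfolding L_def using P R Y(1) by (simp add: powr_divide powr_mult powr_minus_divide)
    have H: "real (card (psmooth {p. p dvd q} P)) \<le> H" if "1 \<le> q" "real q \<le> Q" for q
      unfolding H_def by (rule D(2)[OF P that Y(6)])
    have main: "integral (major_arcs k Q P) (\<lambda>\<alpha>. cmod (weyl_f k P R \<alpha>) powr u) \<le>
       2 powr (u - 1) * ((R * (L * R) * H) powr (u - 1) * S + (L * H) powr u * (4 * Q\<^sup>2 * P powr (- real k)))"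
      unfolding S_def by (rule weyl_powr_integral[OF k P R L1 u H0 Q(1) H V])
    define T where "T = R powr a * P powr (u - real k + \<epsilon>) * Y powr \<Delta>"
    have t1: "(R * (L * R) * H) powr (u - 1) * S \<le> c1 * T"
    proof -
      have "S \<le> R * (L * R) * (C * R powr A * (R * Y) powr (\<kappa> + \<delta>) * L powr (- real k) * (1 + ln P))"
        unfolding S_def using \<kappa> \<delta> by (intro triples_sum_bound[OF P R L1 Y(1) PL _ AC]) auto
      also have "\<dots> \<le> R * (L * R) * (C * R powr A * (R * Y) powr (\<kappa> + \<delta>) * L powr (- real k) * ((1 + 1 / \<delta>) * P powr \<delta>))"
        using one_plus_ln_le[OF P \<delta>] R L1 AC by (intro mult_left_mono) auto
      finally have "(R * (L * R) * H) powr (u - 1) * S \<le> (R * (L * R) * H) powr (u - 1) *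
         (R * (L * R) * (C * R powr A * (R * Y) powr (\<kappa> + \<delta>) * L powr (- real k) * ((1 + 1 / \<delta>) * P powr \<delta>)))"
        by (intro mult_left_mono) auto
      also have "\<dots> = c1 * ((R * (L * R)) powr (u - 1) * (R * (L * R)) * L powr (- real k) * R powr A * R powr (\<kappa> + \<delta>)) *
          ((P powr \<delta>) powr (u - 1) * P powr \<delta>) * Y powr (\<kappa> + \<delta>)"
        unfolding c1_def H_def using R L1 D Y(1) by (simp add: powr_mult mult_ac)
      also have "(R * (L * R)) powr (u - 1) * (R * (L * R)) = R powr (2 * u) * L powr u"
      proof -
        have "(R * (L * R)) powr (u - 1) * (R * (L * R)) = (R * (L * R)) powr (u - 1) * (R * (L * R)) powr 1"
          using R L1 by simp
        also have "\<dots> = (R * (L * R)) powr u" by (simp only: powr_add[symmetric]) simp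
        also have "\<dots> = R powr u * R powr u * L powr u" using R L1 by (simp add: powr_mult mult_ac)
        also have "R powr u * R powr u = R powr (2 * u)" by (simp only: powr_add[symmetric]) simp
        finally show ?thesis .
      qed
      also have "c1 * (R powr (2 * u) * L powr u * L powr (- real k) * R powr A * R powr (\<kappa> + \<delta>)) *
          ((P powr \<delta>) powr (u - 1) * P powr \<delta>) * Y powr (\<kappa> + \<delta>)
         = c1 * (R powr (2 * u) * R powr A * R powr (\<kappa> + \<delta>) * R powr (- (u - real k))) *
           (P powr (u - real k) * (P powr (\<delta> * (u - 1)) * P powr \<delta>)) * (Y powr (- (u - real k)) * Y powr (\<kappa> + \<delta>))"
      proof -
        have "L powr u * L powr (- real k) = L powr (u - real k)" by (simp add: powr_add[symmetric])
        then have "L powr u * L powr (- real k) = P powr (u - real k) * R powr (- (u - real k)) * Y powr (- (u - real k))"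
          using Lp[of "u - real k"] by simp
        moreover have "c1 * (R powr (2 * u) * L powr u * L powr (- real k) * R powr A * R powr (\<kappa> + \<delta>)) *
          ((P powr \<delta>) powr (u - 1) * P powr \<delta>) * Y powr (\<kappa> + \<delta>) = 
          c1 * (R powr (2 * u) * (L powr u * L powr (- real k)) * R powr A * R powr (\<kappa> + \<delta>)) *
          ((P powr \<delta>) powr (u - 1) * P powr \<delta>) * Y powr (\<kappa> + \<delta>)" by (simp only: mult.assoc)
        ultimately show ?thesis by (simp only: powr_powr mult_ac)
      qed
      also have "R powr (2 * u) * R powr A * R powr (\<kappa> + \<delta>) * R powr (- (u - real k)) = R powr (2 * u + A + (\<kappa> + \<delta>) + (- (u - real k)))"
        by (simp only: powr_add)
      also have "P powr (u - real k) * (P powr (\<delta> * (u - 1)) * P powr \<delta>) = P powr (u - real k + \<delta> * u)"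
        by (simp only: powr_add[symmetric]) (simp add: algebra_simps)
      also have "Y powr (- (u - real k)) * Y powr (\<kappa> + \<delta>) = Y powr \<Delta> * Y powr \<delta>"
        unfolding \<kappa>_def by (simp only: powr_add[symmetric]) (simp add: algebra_simps)
      also have "c1 * R powr (2 * u + A + (\<kappa> + \<delta>) + (- (u - real k))) * P powr (u - real k + \<delta> * u) * (Y powr \<Delta> * Y powr \<delta>)
         \<le> c1 * R powr a * P powr (u - real k + \<delta> * u) * (Y powr \<Delta> * P powr \<delta>)"
        using c0 R P Y \<delta> unfolding a_def by (intro mult_mono powr_mono powr_mono2 mult_left_mono) auto
      also have "\<dots> = c1 * R powr a * (P powr (u - real k + \<delta> * u) * P powr \<delta>) * Y powr \<Delta>" by simp
      also have "P powr (u - real k + \<delta> * u) * P powr \<delta> = P powr (u - real k + \<epsilon>)"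
        unfolding \<delta>\<epsilon>[symmetric] by (simp only: powr_add[symmetric] add.assoc)
      finally show ?thesis unfolding T_def by (simp only: mult.assoc)
    qed
    have t2: "(L * H) powr u * (4 * Q\<^sup>2 * P powr (- real k)) \<le> c2 * T"
    proof -
      have "(L * H) powr u * (4 * Q\<^sup>2 * P powr (- real k)) = (L powr u * (D powr u * P powr (\<delta> * u))) * (Y powr real k * P powr (- real k))"
        unfolding H_def Y(4)[symmetric] using L1 D Y(1) P by (simp add: powr_mult powr_powr powr_realpow)
      also have "\<dots> = c2 * R powr (- u) * (P powr u * P powr (\<delta> * u) * P powr (- real k)) * (Y powr (- u) * Y powr real k)"
        unfolding c2_def Lp by (simp only: mult_ac)
      also have "P powr u * P powr (\<delta> * u) * P powr (- real k) = P powr (u - real k + \<delta> * u)"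
        by (simp only: powr_add[symmetric]) (simp add: algebra_simps)
      also have "Y powr (- u) * Y powr real k = Y powr (real k - u)"
        by (simp only: powr_add[symmetric]) (simp add: algebra_simps)
      also have "c2 * R powr (- u) * P powr (u - real k + \<delta> * u) * Y powr (real k - u) \<le>
          c2 * R powr a * P powr (u - real k + \<epsilon>) * Y powr \<Delta>"
        using c0 R P Y a0 u \<delta> \<delta>\<epsilon> \<kappa> unfolding \<kappa>_def by (intro mult_mono powr_mono mult_left_mono) auto
      finally show ?thesis unfolding T_def by (simp only: mult.assoc)
    qed
    have "integral (major_arcs k Q P) (\<lambda>\<alpha>. cmod (weyl_f k P R \<alpha>) powr u) \<le> 2 powr (u - 1) * (c1 * T + c2 * T)"
      by (rule order_trans[OF main]) (intro mult_left_mono add_mono t1 t2, simp)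
    also have "\<dots> = 2 powr (u - 1) * (c1 + c2) * T" by (simp only: distrib_right mult.assoc)
    finally show "integral (major_arcs k Q P) (\<lambda>\<alpha>. cmod (weyl_f k P R \<alpha>) powr u)
         \<le> 2 powr (u - 1) * (c1 + c2) * R powr a * P powr (u - real k + \<epsilon>) * ((2 * Q) powr (2 / real k)) powr \<Delta>"
      unfolding T_def Y_def by (simp only: mult.assoc)
  qed
qed

theorem theorem5p2:
  fixes k :: nat and s :: real and \<Delta> :: "real \<Rightarrow> real" and \<Delta>s :: real
  assumes "1 \<le> k"
    and "2 \<le> s"
    and adm: "\<And>u. (2 \<le> u \<and> u \<le> s) \<or> (\<exists>w::nat. 1 \<le> w \<and> u = 2 * real w) \<Longrightarrow>
                   admissible_exponent k u (\<Delta> u)"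
    and minor: "minor_arc_exponent k \<Delta> s \<Delta>s"
  shows "\<forall>\<epsilon>>0. \<exists>\<eta>>0. \<exists>C. \<exists>P0. \<forall>P\<ge>P0. \<forall>R Q.
           2 \<le> R \<and> R \<le> P powr \<eta> \<and> 1 \<le> Q \<and> Q \<le> 1/2 * P powr (real k / 2) * R powr (- real k) \<longrightarrow>
           integral (major_arcs_N k Q P) (\<lambda>\<alpha>. cmod (weyl_f k P R \<alpha>) powr s)
             \<le> C * P powr (s - real k + \<epsilon>) * Q powr (2 * \<Delta>s / real k)"
proof (intro allI impI)
  fix \<epsilon> :: real assume \<epsilon>: "\<epsilon> > 0"
  obtain \<tau> where tau: "is_tau k \<Delta> \<tau>" and S: "\<Delta>s \<in> {\<Delta> (s - t) - t * \<tau> | t::real. 0 \<le> t \<and> t \<le> s - 2}"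
    using minor unfolding minor_arc_exponent_def Let_def by blast
  obtain w :: nat where w: "1 \<le> w" "\<tau> = (real k - 2 * \<Delta> (2 * real w)) / (4 * real w ^ 2)"
    using tau unfolding is_tau_def Let_def by blast
  obtain t where t: "0 \<le> t" "t \<le> s - 2" "\<Delta>s = \<Delta> (s - t) - t * \<tau>" using S by blast
  define u where "u = s - t"
  have u: "2 \<le> u" "u \<le> s" using t unfolding u_def by auto
  \<comment> \<open>\<epsilon> is shared in thirds: the t-th power of the supremum bound, the mean
    value, and the powers of R. The 1 added to t in the denominator covers t = 0.\<close>
  define \<epsilon>1 where "\<epsilon>1 = \<epsilon> / (3 * (t + 1))"
  have \<epsilon>1: "\<epsilon>1 > 0" using \<epsilon> t unfolding \<epsilon>1_def by simp
  have \<epsilon>1t: "\<epsilon>1 * t \<le> \<epsilon> / 3"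
  proof -
    have "\<epsilon>1 * t \<le> \<epsilon>1 * (t + 1)" using \<epsilon>1 by (intro mult_left_mono) auto
    also have "\<dots> = \<epsilon> / 3" using t unfolding \<epsilon>1_def by (simp add: field_simps)
    finally show ?thesis .
  qed
  obtain c1 a1 where b1: "c1 \<ge> 0" "a1 \<ge> 0"
    "\<And>P R Q \<alpha>. P \<ge> 1 \<Longrightarrow> R \<ge> 1 \<Longrightarrow> 1 \<le> Q \<Longrightarrow> Q \<le> 1/2 * P powr (real k / 2) * R powr (- real k) \<Longrightarrow>
       \<alpha> \<in> major_arcs_N k Q P \<Longrightarrow>
       cmod (weyl_f k P R \<alpha>) \<le> c1 * R powr a1 * P powr (1 + \<epsilon>1) * ((2 * Q) powr (2 / real k)) powr (- \<tau>)"
  proof -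
    have "admissible_exponent k (2 * real w) (\<Delta> (2 * real w))" using adm w(1) by blast
    from minor_arc_bound[OF assms(1) w(1) this \<epsilon>1, folded w(2)] that show ?thesis by metis
  qed
  obtain c2 a2 where b2: "c2 \<ge> 0" "a2 \<ge> 0"
    "\<And>P R Q. P \<ge> 1 \<Longrightarrow> R \<ge> 1 \<Longrightarrow> 1 \<le> Q \<Longrightarrow> Q \<le> 1/2 * P powr (real k / 2) * R powr (- real k) \<Longrightarrow>
       integral (major_arcs k Q P) (\<lambda>\<alpha>. cmod (weyl_f k P R \<alpha>) powr u)
         \<le> c2 * R powr a2 * P powr (u - real k + \<epsilon> / 3) * ((2 * Q) powr (2 / real k)) powr (\<Delta> u)"
  proof -
    have "admissible_exponent k u (\<Delta> u)" using adm u by blast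
    from major_arc_mean[OF assms(1) u(1) this, of "\<epsilon> / 3"] \<epsilon> that show ?thesis by (metis divide_pos_pos zero_less_numeral)
  qed
  define a where "a = a1 * t + a2"
  have a: "a \<ge> 0" using b1 b2 t unfolding a_def by simp
  \<comment> \<open>Small enough that the accumulated R^a is at most P^(\<eta> a) <=
    P^(\<epsilon>/3); again the added 1 covers a = 0.\<close>
  define \<eta> where "\<eta> = \<epsilon> / (3 * (a + 1))"
  have \<eta>: "\<eta> > 0" using \<epsilon> a unfolding \<eta>_def by simp
  have \<eta>a: "\<eta> * a \<le> \<epsilon> / 3"
  proof -
    have "\<eta> * a \<le> \<eta> * (a + 1)" using \<eta> by (intro mult_left_mono) auto
    also have "\<dots> = \<epsilon> / 3" using a unfolding \<eta>_def by (simp add: field_simps)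
    finally show ?thesis .
  qed
  define c where "c = (c1 + 1) powr t * c2"
  have c: "c \<ge> 0" using b2 unfolding c_def by simp
  define C where "C = c * 2 powr (2 * \<Delta>s / real k)"
  \<comment> \<open>No large threshold for P is required: both ingredients hold for all P >=
    1.\<close>
  have "integral (major_arcs_N k Q P) (\<lambda>\<alpha>. cmod (weyl_f k P R \<alpha>) powr s)
             \<le> C * P powr (s - real k + \<epsilon>) * Q powr (2 * \<Delta>s / real k)"
    if P: "P \<ge> 1" and h: "2 \<le> R \<and> R \<le> P powr \<eta> \<and> 1 \<le> Q \<and> Q \<le> 1/2 * P powr (real k / 2) * R powr (- real k)" for P R Q
  proof -
    have R: "R \<ge> 1" "R > 0" and RP: "R \<le> P powr \<eta>" and Q: "1 \<le> Q" "Q \<le> 1/2 * P powr (real k / 2) * R powr (- real k)"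
      using h by auto
    define Y where "Y = (2 * Q) powr (2 / real k)"
    have Y: "Y > 0" unfolding Y_def using Q by simp
    define N where "N = major_arcs_N k Q P"
    define M where "M = major_arcs k Q P"
    have Mm: "M \<in> sets lebesgue" "M \<subseteq> {0..1}" unfolding M_def major_arcs_eq by (rule arcs_measurable arcs_subset)+
    have NM: "N \<subseteq> M" unfolding N_def M_def major_arcs_N_def by blast
    have Nm: "N \<in> sets lebesgue" "N \<subseteq> {0..1}"
    proof -
      show "N \<in> sets lebesgue" unfolding N_def major_arcs_N_def major_arcs_eq by (intro sets.Diff arcs_measurable)
      show "N \<subseteq> {0..1}" using NM Mm(2) by (rule subset_trans)
    qed
    have intg: "(\<lambda>\<alpha>. cmod (weyl_f k P R \<alpha>) powr x) integrable_on S" if "x > 0" "S \<in> sets lebesgue" "S \<subseteq> {0..1}" for x S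
      using that by (intro continuous_integrable_on_subset continuous_on_weyl_powr continuous_intros) auto
    define B where "B = (c1 + 1) * R powr a1 * P powr (1 + \<epsilon>1) * Y powr (- \<tau>)"
    have B: "B > 0" unfolding B_def using b1 R P Y by simp
    have "integral N (\<lambda>\<alpha>. cmod (weyl_f k P R \<alpha>) powr s) \<le> integral N (\<lambda>\<alpha>. B powr t * cmod (weyl_f k P R \<alpha>) powr u)"
    proof (rule integral_le)
      show "(\<lambda>\<alpha>. cmod (weyl_f k P R \<alpha>) powr s) integrable_on N" using assms(2) Nm by (intro intg) auto
      show "(\<lambda>\<alpha>. B powr t * cmod (weyl_f k P R \<alpha>) powr u) integrable_on N"
        using u Nm by (intro integrable_on_mult_right intg) auto
      fix \<alpha> assume \<alpha>: "\<alpha> \<in> N"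
      have "cmod (weyl_f k P R \<alpha>) \<le> c1 * (R powr a1 * P powr (1 + \<epsilon>1) * Y powr (- \<tau>))"
        using b1(3)[OF P R(1) Q \<alpha>[unfolded N_def]] unfolding Y_def by (simp only: mult.assoc)
      also have "\<dots> \<le> (c1 + 1) * (R powr a1 * P powr (1 + \<epsilon>1) * Y powr (- \<tau>))" by (intro mult_right_mono) auto
      finally have le: "cmod (weyl_f k P R \<alpha>) \<le> B" unfolding B_def by (simp only: mult.assoc)
      show "cmod (weyl_f k P R \<alpha>) powr s \<le> B powr t * cmod (weyl_f k P R \<alpha>) powr u"
      proof -
        \<comment> \<open>Also valid where the Weyl sum vanishes, since 0 \<open>powr\<close>
          anything is 0.\<close>
        have "cmod (weyl_f k P R \<alpha>) powr s = cmod (weyl_f k P R \<alpha>) powr t * cmod (weyl_f k P R \<alpha>) powr u"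
          unfolding u_def by (simp only: powr_add[symmetric]) simp
        also have "\<dots> \<le> B powr t * cmod (weyl_f k P R \<alpha>) powr u"
          using le t by (intro mult_right_mono powr_mono2) auto
        finally show ?thesis .
      qed
    qed
    also have "\<dots> = B powr t * integral N (\<lambda>\<alpha>. cmod (weyl_f k P R \<alpha>) powr u)" by simp
    also have "\<dots> \<le> B powr t * integral M (\<lambda>\<alpha>. cmod (weyl_f k P R \<alpha>) powr u)"
      using u Nm Mm by (intro mult_left_mono integral_subset_le[OF NM] intg) auto
    also have "\<dots> \<le> B powr t * (c2 * R powr a2 * P powr (u - real k + \<epsilon> / 3) * Y powr (\<Delta> u))"
      using b2(3)[OF P R(1) Q] unfolding M_def Y_def by (intro mult_left_mono) auto
    also have "B powr t = (c1 + 1) powr t * R powr (a1 * t) * P powr ((1 + \<epsilon>1) * t) * Y powr (- \<tau> * t)"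
      unfolding B_def using b1 by (simp add: powr_mult powr_powr)
    also have "(c1 + 1) powr t * R powr (a1 * t) * P powr ((1 + \<epsilon>1) * t) * Y powr (- \<tau> * t) *
        (c2 * R powr a2 * P powr (u - real k + \<epsilon> / 3) * Y powr (\<Delta> u))
      = c * (R powr (a1 * t) * R powr a2) * (P powr ((1 + \<epsilon>1) * t) * P powr (u - real k + \<epsilon> / 3)) * (Y powr (- \<tau> * t) * Y powr (\<Delta> u))"
      unfolding c_def by (simp only: mult_ac)
    \<comment> \<open>The powers of Y combine to \<Delta> (s - t) - t \<tau>, the value attained by
      \<Delta>s.\<close>
    also have "\<dots> = c * R powr a * P powr (s - real k + \<epsilon>1 * t + \<epsilon> / 3) * Y powr \<Delta>s"
      unfolding a_def t(3) u_def by (simp only: powr_add[symmetric]) (simp add: algebra_simps)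
    also have "\<dots> \<le> c * P powr (\<epsilon> / 3) * P powr (s - real k + \<epsilon>1 * t + \<epsilon> / 3) * Y powr \<Delta>s"
    proof (intro mult_right_mono mult_left_mono c)
      have "R powr a \<le> (P powr \<eta>) powr a" using RP R a by (intro powr_mono2) auto
      also have "\<dots> = P powr (\<eta> * a)" by (rule powr_powr)
      also have "\<dots> \<le> P powr (\<epsilon> / 3)" using P \<eta>a by (intro powr_mono) auto
      finally show "R powr a \<le> P powr (\<epsilon> / 3)" .
    qed auto
    also have "\<dots> = c * (P powr (s - real k + \<epsilon>1 * t + \<epsilon> / 3) * P powr (\<epsilon> / 3)) * Y powr \<Delta>s"
      by (simp only: mult_ac)
    also have "P powr (s - real k + \<epsilon>1 * t + \<epsilon> / 3) * P powr (\<epsilon> / 3) = P powr (s - real k + \<epsilon>1 * t + \<epsilon> / 3 + \<epsilon> / 3)"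
      by (simp only: powr_add)
    also have "c * P powr (s - real k + \<epsilon>1 * t + \<epsilon> / 3 + \<epsilon> / 3) * Y powr \<Delta>s \<le> c * P powr (s - real k + \<epsilon>) * Y powr \<Delta>s"
      using P \<epsilon>1t by (intro mult_right_mono mult_left_mono c powr_mono) auto
    \<comment> \<open>The factor 2 in Y = (2 Q)^(2/k) passes into the constant C, whatever the sign
      of \<Delta>s.\<close>
    also have "Y powr \<Delta>s = 2 powr (2 * \<Delta>s / real k) * Q powr (2 * \<Delta>s / real k)"
      unfolding Y_def using Q by (simp add: powr_powr powr_mult)
    finally show ?thesis unfolding N_def C_def by (simp only: mult_ac)
  qed
  then show "\<exists>\<eta>>0. \<exists>C. \<exists>P0. \<forall>P\<ge>P0. \<forall>R Q.
           2 \<le> R \<and> R \<le> P powr \<eta> \<and> 1 \<le> Q \<and> Q \<le> 1/2 * P powr (real k / 2) * R powr (- real k) \<longrightarrow>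
           integral (major_arcs_N k Q P) (\<lambda>\<alpha>. cmod (weyl_f k P R \<alpha>) powr s)
             \<le> C * P powr (s - real k + \<epsilon>) * Q powr (2 * \<Delta>s / real k)"
    using \<eta> by blast
qed

end
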